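(* Let $N,Q\in\mathbb{N}$ with $Q\le N$, let $g_Q:\mathbb{N}\to\mathbb{C}$ have Eratosthenes Transform $g_Q'$ vanishing outside $[1,Q]$, put $\widehat{g_Q}(\ell)=\sum_{d\le Q,\ \ell\mid d} g_Q'(d)/d$, and assume $\widehat{g_Q}$ is supported on square-free numbers. Let $f:\mathbb{N}\to\mathbb{C}$ be supported on primes. Define, for $a\in\mathbb{N}$, $$\mathcal{S}_{f,g_Q}(N,a)=\sum_{p\mid a} f(p)\,p\sum_{q'\ge1}\mu(q')\widehat{g_Q}(pq')\sum_{\substack{m'\mid q'\\ \frac ap\equiv -1\ (\mathrm{mod}\ m')}}\mu(m')\,m',$$ and its IPPification $\widetilde{\mathcal{S}_{f,g_Q}}(N,a)=\mathcal{S}_{f,g_Q}(N,\kappa(a))$. Then for every $\ell\in\mathbb{N}$, $$\mathrm{Win}_\ell\,\widetilde{\mathcal{S}_{f,g_Q}}=-\frac{\mu(\ell)\widehat{g_Q}(\ell)}{\varphi(\ell)}\sum_{p\mid \ell} f(p)\varphi(p)+\frac{\mu(\ell)}{\varphi(\ell)}\sum_{p\nmid \ell} f(p)\,\widehat{g_Q}(p\ell).$$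
   Context: $p$ always denotes a prime. $\mu$ is the Möbius function, $\varphi$ Euler's totient, $\kappa(a)=\prod_{p\mid a}p$ the square-free kernel. The Eratosthenes Transform of $h:\mathbb{N}\to\mathbb{C}$ is $h'(d)=\sum_{t\mid d}h(t)\mu(d/t)$. For $F:\mathbb{N}\to\mathbb{C}$ (here a function of $a$ with $N$ fixed), the $\ell$-th Wintner coefficient is $\mathrm{Win}_\ell F=\sum_{d\ge1,\ \ell\mid d} F'(d)/d$ (series in increasing $d$). *)

theory Defs
  imports "HOL-Analysis.Analysis" "HOL-Number_Theory.Number_Theory"
    "HOL-Computational_Algebra.Squarefree"
begin

text \<open>
  Arithmetic functions have type \<^typ>\<open>nat \<Rightarrow> complex\<close>; only their values at positive
  arguments are meaningful.
\<close>

definition moebius_mu :: "nat \<Rightarrow> complex" where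
  "moebius_mu n = (if squarefree n then (-1) ^ card (prime_factors n) else 0)"

definition sqfree_kernel :: "nat \<Rightarrow> nat" where
  "sqfree_kernel a = (\<Prod>p\<in>prime_factors a. p)"

definition eratosthenes :: "(nat \<Rightarrow> complex) \<Rightarrow> nat \<Rightarrow> complex" where
  "eratosthenes h d = (\<Sum>t | t dvd d. h t * moebius_mu (d div t))"

text \<open>
  The series defining a Wintner coefficient is in general only conditionally convergent, so it is
  an ordered series and not an unconditional sum; its index is shifted because it starts at
  \<open>d = 1\<close>.
\<close>

definition wintner_term :: "nat \<Rightarrow> (nat \<Rightarrow> complex) \<Rightarrow> nat \<Rightarrow> complex" where
  "wintner_term l F d = (if l dvd d then eratosthenes F d / of_nat d else 0)"

definition wintner_converges :: "nat \<Rightarrow> (nat \<Rightarrow> complex) \<Rightarrow> bool" where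
  "wintner_converges l F \<longleftrightarrow> summable (\<lambda>n. wintner_term l F (Suc n))"

definition wintner :: "nat \<Rightarrow> (nat \<Rightarrow> complex) \<Rightarrow> complex" where
  "wintner l F = (\<Sum>n. wintner_term l F (Suc n))"

definition ghat :: "nat \<Rightarrow> (nat \<Rightarrow> complex) \<Rightarrow> nat \<Rightarrow> complex" where
  "ghat Q g l = (\<Sum>d | d \<in> {1..Q} \<and> l dvd d. eratosthenes g d / of_nat d)"

text \<open>
  The sum over \<open>q\<close> is finite in effect, since \<^term>\<open>ghat Q g (p * q) = 0\<close> for \<open>p * q > Q\<close>.
  The right-hand side does not involve \<open>N\<close>; the argument is kept to match the notation
  \<open>S(N, a)\<close>. For prime \<open>p\<close> dividing \<open>a\<close> the quotient \<^term>\<open>a div p\<close> is exact.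
\<close>

definition S_sum ::
  "(nat \<Rightarrow> complex) \<Rightarrow> nat \<Rightarrow> (nat \<Rightarrow> complex) \<Rightarrow> nat \<Rightarrow> nat \<Rightarrow> complex" where
  "S_sum f Q g N a =
     (\<Sum>p\<in>prime_factors a. f p * of_nat p *
        (\<Sum>\<^sub>\<infinity>q\<in>{1..}. moebius_mu q * ghat Q g (p * q) *
           (\<Sum>m | m dvd q \<and> [int (a div p) = - 1] (mod int m). moebius_mu m * of_nat m)))"

definition S_IPP ::
  "(nat \<Rightarrow> complex) \<Rightarrow> nat \<Rightarrow> (nat \<Rightarrow> complex) \<Rightarrow> nat \<Rightarrow> nat \<Rightarrow> complex" where
  "S_IPP f Q g N a = S_sum f Q g N (sqfree_kernel a)"

end

theory Submission
  imports Defs "HOL-Complex_Analysis.Complex_Analysis"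
begin

text \<open>
  For prime \<open>p\<close> and square-free \<open>m\<close> prime to \<open>p\<close>, consider the indicator of \<open>p | a\<close>,
  \<open>\<kappa>(a)/p \<equiv> -1 (mod m)\<close>. Its Eratosthenes transform lives on square-free \<open>d\<close>, and after removing
  \<open>p\<close> and \<open>l\<close> from \<open>d\<close> its Wintner coefficient becomes a series
  \<open>\<Sum> \<mu>\<^sup>2(e) (u * \<mu>)(e) / e\<close> over \<open>e\<close> prime to some \<open>D\<close>, with \<open>u\<close> periodic modulo \<open>m\<close> and
  supported on the units. Only the mean value of \<open>u\<close> contributes, by a finite sum; for the rest,
  \<open>u\<close> has bounded partial sums, and the series converges to \<open>0\<close>. Without the factor \<open>\<mu>\<^sup>2\<close> this
  follows from \<open>\<Sum> \<mu>(n)/n = 0\<close> by the hyperbola method; \<open>\<mu>\<^sup>2\<close> is then put in by an absolutely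
  convergent convolution over square-full numbers. The equation \<open>\<Sum> \<mu>(n)/n = 0\<close>, as deep as the
  prime number theorem, is proved by Newman's contour integral for \<open>1/\<zeta>\<close>.
\<close>

section \<open>The Moebius function and the square-free kernel\<close>

text \<open>The obstacle is that the series over \<open>e\<close> converges in general only
  conditionally: sums are exchanged at finite height \<open>x\<close>, with bounds uniform in the
  parameters, and only then is the limit taken. The hyperbola method needs bounded partial sums of
  \<open>u\<close>, hence the mean is removed first; what is removed is a multiple of the indicator
  of the units modulo \<open>m\<close>, whose transform at a square-free \<open>n\<close> is mu(n)
  if \<open>n\<close> divides \<open>m\<close> and 0 otherwise, so that a finite sum remains. The
  factor mu^2 is absorbed by composing with the kernel: the transform of the composed function
  agrees with that of \<open>u\<close> at square-free arguments and vanishes elsewhere. This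
  destroys periodicity. The square-full expansion restores it, at the price of replacing
  \<open>u\<close> by its dilates t -> u(t c) for infinitely many \<open>c\<close>. Therefore bounds
  on partial sums are demanded for all dilates at once, and they hold because \<open>u\<close>
  vanishes off the units: a dilation by a unit permutes the residues, any other dilation gives
  0.\<close>

lemma moebius_mu_0 [simp]: "moebius_mu 0 = 0"
  and moebius_mu_1 [simp]: "moebius_mu (Suc 0) = 1"
  by (simp_all add: moebius_mu_def)

lemma norm_moebius_mu_le: "norm (moebius_mu n) \<le> 1"
  by (simp add: moebius_mu_def norm_power)

lemma moebius_mu_prime: "prime p \<Longrightarrow> moebius_mu p = - 1"
  by (simp add: moebius_mu_def squarefree_prime prime_prime_factors)

lemma moebius_mu_mult_coprime:
  assumes "coprime a b"
  shows "moebius_mu (a * b) = moebius_mu a * moebius_mu b"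
proof (cases "a = 0 \<or> b = 0")
  case True
  then show ?thesis by auto
next
  case False
  have "prime_factors a \<inter> prime_factors b = {}"
    using assms by (auto simp: prime_factors_dvd dest: coprime_common_divisor not_prime_unit)
  then have "card (prime_factors (a * b)) = card (prime_factors a) + card (prime_factors b)"
    using False by (simp add: prime_factors_product card_Un_disjoint)
  moreover have "squarefree (a * b) \<longleftrightarrow> squarefree a \<and> squarefree b"
    using assms squarefree_mult_coprime squarefree_multD by blast
  ultimately show ?thesis
    by (simp add: moebius_mu_def power_add)
qed

lemma moebius_mu_square: "squarefree n \<Longrightarrow> moebius_mu n * moebius_mu n = 1"
  by (simp add: moebius_mu_def flip: power_mult_distrib)

text \<open>Each divisor \<open>s\<close> prime to \<open>p\<close> is paired with
  \<open>p * s\<close>, where mu changes sign; the remaining divisors are multiples of p^2, where mu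
  is 0. The cancellations in divisor sums below rest on this pairing.\<close>

lemma sum_moebius_mu_prime_split:
  fixes G :: "nat \<Rightarrow> complex"
  assumes p: "prime p" "p dvd n" and n: "n > 0"
  shows "(\<Sum>s | s dvd n. moebius_mu s * G s)
    = (\<Sum>s | s dvd n \<and> \<not> p dvd s. moebius_mu s * (G s - G (p * s)))"
proof -
  let ?A = "{s. s dvd n \<and> \<not> p dvd s}" and ?B = "{s. s dvd n \<and> p dvd s}"
  have fin: "finite {s. s dvd n}" using n by simp
  have dv: "p * s dvd n" if "s \<in> ?A" for s
    using that p by (auto intro!: divides_mult prime_imp_coprime)
  have B: "(\<Sum>s\<in>?B. moebius_mu s * G s) = (\<Sum>s\<in>?A. - moebius_mu s * G (p * s))"
  proof -
    have "(\<Sum>s\<in>?B. moebius_mu s * G s) = (\<Sum>s\<in>(*) p ` ?A. moebius_mu s * G s)"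
    proof (rule sum.mono_neutral_right)
      show "finite ?B" using fin by simp
      show "(*) p ` ?A \<subseteq> ?B"
        by (rule image_subsetI) (use dv in \<open>simp only: mem_Collect_eq dvd_triv_left simp_thms\<close>)
      show "\<forall>s\<in>?B - (*) p ` ?A. moebius_mu s * G s = 0"
      proof
        fix s assume s: "s \<in> ?B - (*) p ` ?A"
        then obtain k where k: "s = p * k" by auto
        have "p dvd k"
        proof (rule ccontr)
          assume "\<not> p dvd k"
          then have "k \<in> ?A" using s k by (auto intro: dvd_mult_right)
          then show False using s k by blast
        qed
        then have "p\<^sup>2 dvd s" using k by (simp add: power2_eq_square mult_dvd_mono)
        then have "\<not> squarefree s"
          using p(1) not_prime_unit not_squarefreeI by blast
        then show "moebius_mu s * G s = 0" by (simp add: moebius_mu_def)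
      qed
    qed
    also have "\<dots> = (\<Sum>s\<in>?A. moebius_mu (p * s) * G (p * s))"
      using p(1) by (subst sum.reindex) (auto simp: inj_on_def)
    also have "\<dots> = (\<Sum>s\<in>?A. - moebius_mu s * G (p * s))"
      using p(1) by (intro sum.cong)
        (auto simp: moebius_mu_mult_coprime prime_imp_coprime moebius_mu_prime)
    finally show ?thesis .
  qed
  have "(\<Sum>s | s dvd n. moebius_mu s * G s) = (\<Sum>s\<in>?A \<union> ?B. moebius_mu s * G s)"
    by (rule sum.cong) blast+
  also have "\<dots> = (\<Sum>s\<in>?A. moebius_mu s * G s) + (\<Sum>s\<in>?B. moebius_mu s * G s)"
  proof (rule sum.union_disjoint)
    show "finite ?A" "finite ?B" using fin by simp_all
  qed blast
  finally show ?thesis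
    unfolding B by (simp add: right_diff_distrib sum_subtractf sum_negf)
qed

lemma sum_moebius_mu_divisors:
  assumes "n > 0"
  shows "(\<Sum>d | d dvd n. moebius_mu d) = (if n = 1 then 1 else 0)"
proof (cases "n = 1")
  case False
  then obtain p where "prime p" "p dvd n" using prime_factor_nat by blast
  then show ?thesis
    using sum_moebius_mu_prime_split[of p n "\<lambda>_. 1"] assms False by simp
qed simp

lemma sum_dvd_flip:
  fixes n :: nat assumes "n > 0"
  shows "(\<Sum>d | d dvd n. F d (n div d)) = (\<Sum>d | d dvd n. F (n div d) d)"
  by (rule sum.reindex_bij_witness[of _ "\<lambda>d. n div d" "\<lambda>d. n div d"])
     (use assms in \<open>auto elim!: dvdE\<close>)

lemma sqfree_kernel_pos [simp]: "sqfree_kernel a > 0"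
  by (auto simp: sqfree_kernel_def intro!: prod_pos prime_gt_0_nat)

lemma sqfree_kernel_1 [simp]: "sqfree_kernel (Suc 0) = 1"
  by (simp add: sqfree_kernel_def)

lemma squarefree_sqfree_kernel: "squarefree (sqfree_kernel a)"
  unfolding sqfree_kernel_def
  by (rule squarefree_prod_coprime)
     (auto intro: primes_coprime squarefree_prime)

lemma prime_factors_sqfree_kernel [simp]: "prime_factors (sqfree_kernel a) = prime_factors a"
proof -
  have "prime_factors (sqfree_kernel a) = (\<Union>p\<in>prime_factors a. prime_factors p)"
    unfolding sqfree_kernel_def by (subst prime_factors_prod) auto
  also have "\<dots> = (\<Union>p\<in>prime_factors a. {p})"
    by (rule SUP_cong) (auto intro!: prime_prime_factors)
  also have "\<dots> = prime_factors a"
    by simp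
  finally show ?thesis .
qed

lemma prime_dvd_sqfree_kernel_iff:
  assumes "prime p" "a > 0" shows "p dvd sqfree_kernel a \<longleftrightarrow> p dvd a"
  using prime_factors_sqfree_kernel[of a] assms sqfree_kernel_pos[of a]
  by (metis (no_types, lifting) in_prime_factors_iff neq0_conv)

lemma sqfree_kernel_mult_coprime:
  assumes "coprime a b" "a > 0" "b > 0"
  shows "sqfree_kernel (a * b) = sqfree_kernel a * sqfree_kernel b"
proof -
  have "prime_factors a \<inter> prime_factors b = {}"
    using assms by (auto simp: prime_factors_dvd dest: coprime_common_divisor not_prime_unit)
  then show ?thesis
    using assms by (simp add: sqfree_kernel_def prime_factors_product prod.union_disjoint)
qed

lemma sqfree_kernel_prime_power: "prime p \<Longrightarrow> k > 0 \<Longrightarrow> sqfree_kernel (p ^ k) = p"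
  by (simp add: sqfree_kernel_def prime_factors_power prime_prime_factors)

lemma sqfree_kernel_squarefree:
  assumes "squarefree a" shows "sqfree_kernel a = a"
proof -
  have "a > 0" using assms by (auto intro!: Nat.gr0I)
  have "sqfree_kernel a = (\<Prod>p\<in>prime_factors a. p ^ multiplicity p a)"
    unfolding sqfree_kernel_def
  proof (rule prod.cong)
    fix p assume p: "p \<in> prime_factors a"
    then have "multiplicity p a \<le> 1" "multiplicity p a > 0"
      using assms \<open>a > 0\<close>
      by (auto simp: squarefree_factorial_semiring'' prime_factors_multiplicity)
    then have "multiplicity p a = 1" by linarith
    then show "p = p ^ multiplicity p a" by simp
  qed simp
  also have "\<dots> = a"
    using \<open>a > 0\<close> prime_factorization_nat by presburger
  finally show ?thesis .
qed

lemma sqfree_kernel_cong: "prime_factors a = prime_factors b \<Longrightarrow> sqfree_kernel a = sqfree_kernel b"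
  by (simp add: sqfree_kernel_def)

text \<open>If p^2 divides \<open>d\<close> and \<open>p\<close> does not divide \<open>s\<close>,
  then \<open>d div s\<close> and \<open>d div (p * s)\<close> are both still divisible by
  \<open>p\<close>. They have the same prime factors, so the paired terms cancel.\<close>

lemma eratosthenes_kernel_eq_0:
  assumes h: "\<And>t. t > 0 \<Longrightarrow> h t = h (sqfree_kernel t)" and d: "\<not> squarefree d" "d > 0"
  shows "eratosthenes h d = 0"
proof -
  from d obtain p where p: "prime p" "p\<^sup>2 dvd d"
    by (metis squarefree_factorial_semiring not_gr0)
  have "eratosthenes h d = (\<Sum>s | s dvd d. moebius_mu s * h (d div s))"
    unfolding eratosthenes_def using sum_dvd_flip[OF d(2), of "\<lambda>t s. h t * moebius_mu s"]
    by (simp add: mult.commute)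
  also have "\<dots> = (\<Sum>s | s dvd d \<and> \<not> p dvd s. moebius_mu s * (h (d div s) - h (d div (p * s))))"
    using p d by (intro sum_moebius_mu_prime_split) (auto intro: dvd_trans simp: power2_eq_square)
  also have "\<dots> = 0"
  proof (rule sum.neutral, safe)
    fix s assume s: "s dvd d" "\<not> p dvd s"
    have "coprime (p\<^sup>2) s" using p(1) s(2) by (simp add: prime_imp_coprime)
    then have "p\<^sup>2 * s dvd d" using p s by (simp add: divides_mult)
    then obtain k where k: "d = p\<^sup>2 * s * k" by blast
    have pos: "p > 0" "s > 0" "k > 0" using d(2) k by auto
    have "d div s = p * (p * k)" "d div (p * s) = p * k"
      using pos by (simp_all add: k power2_eq_square)
    moreover have "prime_factors (p * (p * k)) = prime_factors (p * k)"
      using pos by (auto simp: prime_factors_product)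
    ultimately have "h (d div s) = h (d div (p * s))"
      using h[of "p * (p * k)"] h[of "p * k"] pos sqfree_kernel_cong[of "p * (p * k)" "p * k"]
      by (simp only: nat_0_less_mult_iff)
    then show "moebius_mu s * (h (d div s) - h (d div (p * s))) = 0" by simp
  qed
  finally show ?thesis .
qed

section \<open>Non-vanishing of the zeta function on the line Re s = 1\<close>

lemma norm_nat_powr: "n > 0 \<Longrightarrow> norm (of_nat n powr s :: complex) = real n powr Re s"
  using norm_powr_real_powr[of "of_nat n" s] by simp

lemma summable_on_nat_powr:
  "\<sigma> > 1 \<Longrightarrow> (\<lambda>n. real n powr - \<sigma>) summable_on {1..}"
  by (rule summable_on_subset_banach[where A = UNIV])
     (auto simp: summable_on_UNIV_nonneg_real_iff summable_real_powr_iff)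

lemma ln_powr_le: 
  assumes "\<epsilon> > 0" "n > 0" shows "ln (real n) \<le> real n powr \<epsilon> / \<epsilon>"
proof -
  have "\<epsilon> * ln n = ln (real n powr \<epsilon>)" using assms by (simp add: ln_powr)
  also have "\<dots> \<le> real n powr \<epsilon>" using ln_less_self[of "real n powr \<epsilon>"] assms by simp
  finally show ?thesis using assms by (simp add: field_simps)
qed

lemma summable_on_ln_nat_powr:
  assumes "\<sigma> > 1" shows "(\<lambda>n. ln (real n) * real n powr - \<sigma>) summable_on {1..}"
proof -
  define \<epsilon> where "\<epsilon> = (\<sigma> - 1) / 2"
  have e: "\<epsilon> > 0" "\<sigma> - \<epsilon> > 1" using assms by (auto simp: \<epsilon>_def field_simps)
  have "(\<lambda>n. norm (ln (real n) * real n powr - \<sigma>)) summable_on {1..}"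
  proof (rule Infinite_Sum.abs_summable_on_comparison_test')
    show "(\<lambda>n. (1 / \<epsilon>) * real n powr - (\<sigma> - \<epsilon>)) summable_on {1..}"
      using summable_on_nat_powr[OF e(2)] by (rule summable_on_cmult_right)
    show "norm (ln (real n) * real n powr - \<sigma>) \<le> 1 / \<epsilon> * real n powr - (\<sigma> - \<epsilon>)" if "n \<in> {1..}" for n
    proof -
      have "norm (ln (real n) * real n powr - \<sigma>) = ln (real n) * real n powr - \<sigma>"
        using that by simp
      also have "\<dots> \<le> real n powr \<epsilon> / \<epsilon> * real n powr - \<sigma>"
        using that e by (intro mult_right_mono ln_powr_le) auto
      also have "\<dots> = 1 / \<epsilon> * real n powr - (\<sigma> - \<epsilon>)"
        by (simp add: powr_add[symmetric])
      finally show ?thesis .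
    qed
  qed
  then show ?thesis by (rule abs_summable_summable)
qed

text \<open>Absolute convergence of the double series over \<open>(a, b)\<close> permits regrouping
  it along \<open>n = a * b\<close>.\<close>

lemma dirichlet_product_has_sum:
  fixes f g :: "nat \<Rightarrow> complex"
  assumes f: "(\<lambda>n. norm (f n * of_nat n powr - s)) summable_on {1..}"
    and g: "(\<lambda>n. norm (g n * of_nat n powr - s)) summable_on {1..}"
  shows "((\<lambda>n. (\<Sum>d | d dvd n. f d * g (n div d)) * of_nat n powr - s) has_sum
    infsum (\<lambda>n. f n * of_nat n powr - s) {1..} * infsum (\<lambda>n. g n * of_nat n powr - s) {1..}) {1..}"
    (is "(_ has_sum infsum ?f _ * infsum ?g _) _")
proof -
  let ?h = "\<lambda>(a, b). ?f a * ?g b"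
  have "(\<lambda>x. norm (?h x)) summable_on {1..} \<times> {1..}"
  proof (subst Infinite_Sum.abs_summable_on_Sigma_iff, intro conjI ballI)
    show "(\<lambda>b. norm (?h (a, b))) summable_on {1..}" for a
      using summable_on_cmult_right[OF g, of "norm (?f a)"] by (simp add: norm_mult)
    have eq: "norm (\<Sum>\<^sub>\<infinity>b\<in>{1..}. norm (?h (a, b)))
        = norm (?f a) * norm (\<Sum>\<^sub>\<infinity>b\<in>{1..}. norm (?g b))" for a
    proof -
      have "(\<Sum>\<^sub>\<infinity>b\<in>{1..}. norm (?h (a, b))) = (\<Sum>\<^sub>\<infinity>b\<in>{1..}. norm (?f a) * norm (?g b))"
        by (simp only: prod.case norm_mult)
      also have "\<dots> = norm (?f a) * (\<Sum>\<^sub>\<infinity>b\<in>{1..}. norm (?g b))"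
        by (rule infsum_cmult_right')
      finally show ?thesis by (simp add: abs_mult)
    qed
    show "(\<lambda>a. norm (\<Sum>\<^sub>\<infinity>b\<in>{1..}. norm (?h (a, b)))) summable_on {1..}"
      unfolding eq by (rule summable_on_cmult_left[OF f])
  qed
  then have hs: "?h summable_on {1..} \<times> {1..}" by (rule abs_summable_summable)
  have "(?h has_sum (infsum ?f {1..} * infsum ?g {1..})) ({1..} \<times> {1..})"
  proof (rule has_sum_SigmaI[OF _ _ hs])
    show "((\<lambda>b. ?h (a, b)) has_sum ?f a * infsum ?g {1..}) {1..}" for a
      using has_sum_cmult_right[OF has_sum_infsum[OF abs_summable_summable[OF g]], of "?f a"] by simp
    show "((\<lambda>a. ?f a * infsum ?g {1..}) has_sum infsum ?f {1..} * infsum ?g {1..}) {1..}"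
      by (rule has_sum_cmult_left[OF has_sum_infsum[OF abs_summable_summable[OF f]]])
  qed
  also have "?this \<longleftrightarrow> ((\<lambda>(n, d). f d * g (n div d) * of_nat n powr - s) has_sum
      (infsum ?f {1..} * infsum ?g {1..})) (SIGMA n:{1..}. {d. d dvd n})"
  proof (rule has_sum_reindex_bij_witness[where j = "\<lambda>(a, b). (a * b, a)" and i = "\<lambda>(n, d). (d, n div d)"])
    fix x :: "nat \<times> nat" assume "x \<in> {1..} \<times> {1..}"
    then obtain a b where x: "x = (a, b)" "a > 0" "b > 0" by auto
    have "(of_nat (a * b) :: complex) powr - s = of_nat a powr - s * of_nat b powr - s"
      by (simp add: powr_times_real)
    then show "(case case x of (a, b) \<Rightarrow> (a * b, a) of (n, d) \<Rightarrow> f d * g (n div d) * of_nat n powr - s) = ?h x"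
      using x by simp
  qed (auto elim!: dvdE intro: Suc_leI dest: dvd_pos_nat)
  finally show ?thesis
  proof (rule has_sum_SigmaD)
    fix n :: nat assume "n \<in> {1..}"
    then have "finite {d. d dvd n}" by simp
    then show "((\<lambda>d. case (n, d) of (n, d) \<Rightarrow> f d * g (n div d) * of_nat n powr - s) has_sum
        (\<Sum>d | d dvd n. f d * g (n div d)) * of_nat n powr - s) {d. d dvd n}"
      by (intro has_sum_finiteI) (simp_all add: sum_distrib_right)
  qed
qed

text \<open>The factor 1 keeps the shape \<open>f n * of_nat n powr - s\<close>, so that the product
  and summability lemmas apply with a constant \<open>f\<close>.\<close>

definition zeta_sum :: "complex \<Rightarrow> complex" where
  "zeta_sum s = (\<Sum>\<^sub>\<infinity>n\<in>{1..}. 1 * of_nat n powr - s)"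

lemma abs_summable_bounded_powr:
  fixes f :: "nat \<Rightarrow> complex"
  assumes "\<And>n. norm (f n) \<le> 1" "Re s > 1"
  shows "(\<lambda>n. norm (f n * of_nat n powr - s)) summable_on {1..}"
proof (rule Infinite_Sum.abs_summable_on_comparison_test'[OF summable_on_nat_powr[OF assms(2)]])
  show "norm (f n * of_nat n powr - s) \<le> real n powr - Re s" if "n \<in> {1..}" for n
    using that assms(1)[of n] by (simp add: norm_mult norm_nat_powr mult_le_cancel_right1)
qed

lemma has_sum_imp_sums_Suc:
  fixes f :: "nat \<Rightarrow> 'a :: real_normed_vector"
  assumes "(f has_sum S) {1..}"
  shows "(\<lambda>n. f (Suc n)) sums S"
proof -
  have "bij_betw Suc UNIV {1..}"
    by (auto simp: bij_betw_def image_iff) (metis Suc_le_D One_nat_def)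
  then have "((\<lambda>n. f (Suc n)) has_sum S) UNIV"
    using has_sum_reindex_bij_betw assms by blast
  then show ?thesis by (rule has_sum_imp_sums)
qed

lemma zeta_sum_sums: "Re s > 1 \<Longrightarrow> (\<lambda>n. of_nat (Suc n) powr - s) sums zeta_sum s"
  using has_sum_imp_sums_Suc[OF has_sum_infsum[OF abs_summable_summable[OF
    abs_summable_bounded_powr[of "\<lambda>_. 1" s]]]]
  by (simp add: zeta_sum_def)

text \<open>The coefficients of the product are the divisor sums of mu, so only \<open>n = 1\<close>
  survives. Besides giving the series of 1/zeta, this excludes zeros with Re s > 1.\<close>

lemma zeta_sum_mult_moebius:
  assumes "Re s > 1"
  shows "zeta_sum s * (\<Sum>\<^sub>\<infinity>n\<in>{1..}. moebius_mu n * of_nat n powr - s) = 1"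
proof -
  have "((\<lambda>n. (\<Sum>d | d dvd n. moebius_mu d * 1) * of_nat n powr - s) has_sum
     (\<Sum>\<^sub>\<infinity>n\<in>{1..}. moebius_mu n * of_nat n powr - s) * zeta_sum s) {1..}"
    unfolding zeta_sum_def
    by (intro dirichlet_product_has_sum abs_summable_bounded_powr norm_moebius_mu_le assms) simp
  moreover have "((\<lambda>n. (\<Sum>d | d dvd n. moebius_mu d * 1) * of_nat n powr - s) has_sum 1) {1..}"
  proof (rule has_sum_finite_neutralI[of "{1}"])
    show "(\<Sum>d | d dvd n. moebius_mu d * 1) * of_nat n powr - s = 0" if "n \<in> {1..} - {1}" for n
      using that sum_moebius_mu_divisors[of n] by simp
  qed simp_all
  ultimately show ?thesis
    by (subst mult.commute) (rule has_sum_unique)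
qed

text \<open>This is -zeta'/zeta; see \<open>deriv_zeta_sum\<close>.\<close>

definition mangoldt_series :: "complex \<Rightarrow> complex" where
  "mangoldt_series s = (\<Sum>\<^sub>\<infinity>n\<in>{1..}. mangoldt n * of_nat n powr - s)"

lemma abs_summable_mangoldt:
  assumes "Re s > 1"
  shows "(\<lambda>n. norm (mangoldt n * of_nat n powr - s :: complex)) summable_on {1..}"
proof (rule Infinite_Sum.abs_summable_on_comparison_test'[OF summable_on_ln_nat_powr[OF assms]])
  show "norm (mangoldt n * of_nat n powr - s :: complex) \<le> ln (real n) * real n powr - Re s"
    if "n \<in> {1..}" for n
    using that by (simp add: norm_mult norm_nat_powr mangoldt_le mult_right_mono)
qed

lemma mangoldt_series_mult_zeta:
  assumes "Re s > 1"
  shows "((\<lambda>n. of_real (ln (real n)) * of_nat n powr - s) has_sum mangoldt_series s * zeta_sum s) {1..}"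
proof -
  have "((\<lambda>n. (\<Sum>d | d dvd n. mangoldt d * 1) * of_nat n powr - s) has_sum
     mangoldt_series s * zeta_sum s) {1..}"
    unfolding mangoldt_series_def zeta_sum_def
    by (intro dirichlet_product_has_sum abs_summable_bounded_powr abs_summable_mangoldt assms) simp
  then show ?thesis
    by (subst (asm) has_sum_cong[where g = "\<lambda>n. of_real (ln (real n)) * of_nat n powr - s"])
       (auto simp: mangoldt_sum)
qed

text \<open>Termwise differentiation gives minus the series with coefficients \<open>ln n\<close>,
  and \<open>ln\<close> is the convolution of \<open>mangoldt\<close> with 1.\<close>

lemma deriv_zeta_sum:
  assumes s: "Re s > 1"
  shows "(zeta_sum has_field_derivative - (mangoldt_series s * zeta_sum s)) (at s)"
proof -
  let ?S = "{s. Re s > 1}"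
  have "\<exists>g g'. \<forall>x\<in>?S. ((\<lambda>n. of_nat (Suc n) powr - x) sums g x) \<and>
     ((\<lambda>n. - (of_real (ln (real (Suc n))) * of_nat (Suc n) powr - x)) sums g' x) \<and> 
     (g has_field_derivative g' x) (at x)"
  proof (rule series_and_derivative_comparison_complex)
    show "open ?S" by (simp add: open_halfspace_Re_gt)
    show "((\<lambda>x. of_nat (Suc n) powr - x) has_field_derivative
       - (of_real (ln (real (Suc n))) * of_nat (Suc n) powr - x)) (at x)" for n and x :: complex
      using DERIV_chain2[OF has_field_derivative_powr_right[of "of_nat (Suc n)" "- x"]
          DERIV_minus[OF DERIV_ident]]
      by (simp add: Ln_of_nat del: of_nat_Suc)
  next
    fix x assume x: "x \<in> ?S"
    \<comment> \<open>Half the distance to the line Re s = 1, so that one exponent greater than 1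
      serves the whole ball.\<close>
    define d where "d = (Re x - 1) / 2"
    have d: "d > 0" "Re x - d > 1" using x by (auto simp: d_def field_simps)
    have "summable (\<lambda>n. real (Suc n) powr - (Re x - d))"
      using d by (subst summable_Suc_iff) (simp add: summable_real_powr_iff)
    then have 1: "summable (\<lambda>n. complex_of_real (real (Suc n) powr - (Re x - d)))"
      by (rule summable_of_real)
    have 2: "cmod (of_nat (Suc n) powr - y) \<le> cmod (complex_of_real (real (Suc n) powr - (Re x - d)))"
      if "y \<in> ball x d" for n y
    proof -
      have "\<bar>Re x - Re y\<bar> < d" using that abs_Re_le_cmod[of "x - y"] by (simp add: dist_norm)
      then have "- Re y \<le> - (Re x - d)" by linarith
      then show ?thesis
        by (subst norm_nat_powr) (auto intro!: powr_mono)
    qed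
    show "\<exists>d h. 0 < d \<and> summable h \<and> range h \<subseteq> \<real>\<^sub>\<ge>\<^sub>0 \<and>
        (\<forall>\<^sub>F n in sequentially. \<forall>y\<in>ball x d \<inter> ?S. cmod (of_nat (Suc n) powr - y) \<le> cmod (h n))"
      using d(1) 1 2
      by (intro exI[of _ d] exI[of _ "\<lambda>n. complex_of_real (real (Suc n) powr - (Re x - d))"])
         (auto intro!: always_eventually nonneg_Reals_of_real_iff[THEN iffD2])
  qed
  then obtain g g' where g: "\<And>x. Re x > 1 \<Longrightarrow> (\<lambda>n. of_nat (Suc n) powr - x) sums g x"
    "\<And>x. Re x > 1 \<Longrightarrow> (\<lambda>n. - (of_real (ln (real (Suc n))) * of_nat (Suc n) powr - x)) sums g' x"
    "\<And>x. Re x > 1 \<Longrightarrow> (g has_field_derivative g' x) (at x)"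
    by blast
  have "g' s = - (mangoldt_series s * zeta_sum s)"
    using g(2)[OF s] sums_minus[OF has_sum_imp_sums_Suc[OF mangoldt_series_mult_zeta[OF s]]]
    by (rule sums_unique2)
  moreover have "g x = zeta_sum x" if "Re x > 1" for x
    using g(1) zeta_sum_sums that sums_unique2 by blast
  moreover have "(zeta_sum has_field_derivative g' s) (at s)"
    by (rule has_field_derivative_transform_within_open[OF g(3)[OF s], of ?S])
       (use s calculation in \<open>simp_all add: open_halfspace_Re_gt\<close>)
  ultimately show ?thesis by simp
qed

text \<open>
  \<open>zeta_term\<close> is \<open>(s - 1)\<close> times the integral of \<open>(n+1) powr -s - x powr -s\<close> over \<open>[n+1, n+2]\<close>, so that
  \<open>zeta_cont\<close> continues \<open>(s - 1) \<zeta>(s)\<close> to \<open>Re s > 0\<close>.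
\<close>

definition zeta_term :: "nat \<Rightarrow> complex \<Rightarrow> complex" where
  "zeta_term n s = (s - 1) * of_nat (Suc n) powr - s
     + (of_nat (Suc (Suc n)) powr (1 - s) - of_nat (Suc n) powr (1 - s))"

definition zeta_cont :: "complex \<Rightarrow> complex" where
  "zeta_cont s = 1 + (\<Sum>n. zeta_term n s)"

text \<open>\<open>zeta_term n s\<close> is exactly the remainder of the first-order Taylor
  expansion of \<open>x powr (1 - s)\<close> from \<open>n + 1\<close> to \<open>n + 2\<close>. The
  second derivative supplies the extra power of \<open>n\<close>, and thereby convergence for Re s >
  0.\<close>

lemma norm_zeta_term_le:
  assumes s: "Re s > 0"
  shows "norm (zeta_term n s) \<le> norm (1 - s) * norm s * real (Suc n) powr (- Re s - 1)"
proof -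
  define N where "N = real (Suc n)"
  have N: "N > 0" by (simp add: N_def)
  \<comment> \<open>The function \<open>x powr (1 - s)\<close> and its first two derivatives,
    indexed as \<open>complex_Taylor\<close> expects.\<close>
  define f where "f = (\<lambda>(i::nat) (x::complex). if i = 0 then x powr (1 - s)
     else if i = 1 then (1 - s) * x powr - s else (1 - s) * (- s * x powr (- s - 1)))"
  define S where "S = closed_segment (complex_of_real N) (of_real (N + 1))"
  have S: "\<exists>y. x = complex_of_real y \<and> y \<ge> N" if "x \<in> S" for x
    using that unfolding S_def closed_segment_of_real by (auto simp: closed_segment_eq_real_ivl)
  have "norm (f 0 (of_real (N + 1)) - (\<Sum>i\<le>1. f i (of_real N) * (of_real (N + 1) - of_real N) ^ i / fact i))
     \<le> norm (1 - s) * norm s * N powr (- Re s - 1) * norm (complex_of_real (N + 1) - of_real N) ^ Suc 1 / fact 1"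
  proof (rule complex_Taylor[where S = S])
    show "convex S" by (simp add: S_def)
    show "of_real N \<in> S" "of_real (N + 1) \<in> S" by (simp_all add: S_def)
  next
    fix i :: nat and x assume x: "x \<in> S" "i \<le> 1"
    obtain y where y: "x = complex_of_real y" "y \<ge> N" using S[OF x(1)] by blast
    then have "x \<notin> \<real>\<^sub>\<le>\<^sub>0" using N by (auto simp: complex_nonpos_Reals_iff)
    then have "(f i has_field_derivative f (Suc i) x) (at x)"
      using x(2) unfolding f_def
      by (cases i) (auto intro!: derivative_eq_intros simp: diff_diff_eq)
    then show "(f i has_field_derivative f (Suc i) x) (at x within S)"
      by (rule has_field_derivative_at_within)
  next
    fix x assume x: "x \<in> S"
    obtain y where y: "x = complex_of_real y" "y \<ge> N" using S[OF x] by blast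
    have "norm (x powr (- s - 1)) = y powr (- Re s - 1)"
      using y N by (simp add: norm_powr_real_powr)
    also have "\<dots> \<le> N powr (- Re s - 1)"
      using y N s by (intro powr_mono2') auto
    finally show "norm (f (Suc 1) x) \<le> norm (1 - s) * norm s * N powr (- Re s - 1)"
      by (simp add: f_def norm_mult mult_left_mono mult.assoc)
  qed
  then have "norm (of_real (N + 1) powr (1 - s) - (of_real N powr (1 - s) + (1 - s) * of_real N powr - s))
     \<le> norm (1 - s) * norm s * N powr (- Re s - 1)"
    by (simp add: f_def)
  also have "of_real (N + 1) powr (1 - s) - (of_real N powr (1 - s) + (1 - s) * of_real N powr - s)
      = zeta_term n s"
    by (simp add: zeta_term_def N_def algebra_simps)
  finally show ?thesis by (simp add: N_def)
qed

lemma zeta_cont_holomorphic: "zeta_cont holomorphic_on {s. Re s > 0}"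
  and zeta_term_sums: "Re s > 0 \<Longrightarrow> (\<lambda>n. zeta_term n s) sums (zeta_cont s - 1)"
proof -
  let ?S = "{s. Re s > 0}"
  obtain g where g: "\<forall>x\<in>?S. (\<lambda>n. zeta_term n x) sums g x \<and> g field_differentiable (at x)"
  proof (rule series_differentiable_comparison_complex)
    show "open ?S" by (simp add: open_halfspace_Re_gt)
    show "zeta_term n field_differentiable (at x)" for n x
      unfolding zeta_term_def
      by (intro derivative_intros holomorphic_on_imp_differentiable_at[of _ UNIV]
            holomorphic_intros) auto
  next
    fix x assume x: "x \<in> ?S"
    define d where "d = Re x / 2"
    have d: "d > 0" "Re x - d > 0" using x by (auto simp: d_def)
    define C where "C = (norm (1 - x) + d) * (norm x + d)"
    have C: "C \<ge> 0" using d by (auto simp: C_def)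
    have "summable (\<lambda>n. real (Suc n) powr (- (Re x - d) - 1))"
      using d by (subst summable_Suc_iff) (simp add: summable_real_powr_iff)
    then have 1: "summable (\<lambda>n. complex_of_real (C * real (Suc n) powr (- (Re x - d) - 1)))"
      by (intro summable_of_real summable_mult)
    have 2: "cmod (zeta_term n y) \<le> cmod (complex_of_real (C * real (Suc n) powr (- (Re x - d) - 1)))"
      if y: "y \<in> ball x d" for n y
    proof -
      have xy: "norm (x - y) < d" using y by (simp add: dist_norm)
      then have "\<bar>Re x - Re y\<bar> < d" using abs_Re_le_cmod[of "x - y"] by simp
      then have Re: "- Re y - 1 \<le> - (Re x - d) - 1" "Re y > 0" using d by linarith+
      have "norm (1 - y) \<le> norm (1 - x) + d" "norm y \<le> norm x + d"
        using xy norm_triangle_ineq[of "1 - x" "x - y"] norm_triangle_ineq4[of x "x - y"] by auto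
      then have "norm (1 - y) * norm y * real (Suc n) powr (- Re y - 1)
          \<le> C * real (Suc n) powr (- (Re x - d) - 1)"
        unfolding C_def using Re d by (intro mult_mono powr_mono) auto
      then have "cmod (zeta_term n y) \<le> C * real (Suc n) powr (- (Re x - d) - 1)"
        using norm_zeta_term_le[OF Re(2), of n] by linarith
      also have "\<dots> = cmod (complex_of_real (C * real (Suc n) powr (- (Re x - d) - 1)))"
        using C by (simp del: of_real_mult)
      finally show ?thesis .
    qed
    show "\<exists>d h. 0 < d \<and> summable h \<and> range h \<subseteq> \<real>\<^sub>\<ge>\<^sub>0 \<and>
        (\<forall>\<^sub>F n in sequentially. \<forall>y\<in>ball x d \<inter> ?S. cmod (zeta_term n y) \<le> cmod (h n))"
      using d(1) 1 2 C
      by (intro exI[of _ d] exI[of _ "\<lambda>n. complex_of_real (C * real (Suc n) powr (- (Re x - d) - 1))"])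
         (auto intro!: always_eventually simp del: of_real_mult)
  qed
  have eq: "zeta_cont x = 1 + g x" if "Re x > 0" for x
    using that g by (auto simp: zeta_cont_def sums_iff)
  then show "Re s > 0 \<Longrightarrow> (\<lambda>n. zeta_term n s) sums (zeta_cont s - 1)"
    using g by auto
  have "(\<lambda>x. 1 + g x) holomorphic_on ?S"
    using g by (intro holomorphic_intros)
       (auto simp: holomorphic_on_def intro: field_differentiable_at_within)
  then show "zeta_cont holomorphic_on ?S"
    by (rule holomorphic_transform) (use eq in auto)
qed

text \<open>The residue of zeta at 1. It makes the order of vanishing at 1 equal to 0 in the 3-4-1
  argument and settles the constant case there.\<close>

lemma zeta_cont_1 [simp]: "zeta_cont 1 = 1"
  by (simp add: zeta_cont_def zeta_term_def del: of_nat_Suc)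

text \<open>For Re s > 1 the differences of powers with exponent \<open>1 - s\<close> telescope to
  -1, which cancels the leading 1 of \<open>zeta_cont\<close>.\<close>

lemma zeta_cont_eq:
  assumes s: "Re s > 1" shows "zeta_cont s = (s - 1) * zeta_sum s"
proof -
  have "(\<lambda>n. complex_of_nat (Suc n) powr (1 - s)) \<longlonglongrightarrow> 0"
  proof (rule Lim_null_comparison)
    show "\<forall>\<^sub>F n in sequentially. norm (complex_of_nat (Suc n) powr (1 - s)) \<le> real (Suc n) powr (1 - Re s)"
      by (intro always_eventually allI) (subst norm_nat_powr, auto)
    show "(\<lambda>n. real (Suc n) powr (1 - Re s)) \<longlonglongrightarrow> 0"
      using s by (intro tendsto_neg_powr filterlim_compose[OF filterlim_real_sequentially filterlim_Suc]) auto
  qed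
  then have "(\<lambda>n. of_nat (Suc (Suc n)) powr (1 - s) - of_nat (Suc n) powr (1 - s)) sums
      (0 - complex_of_nat (Suc 0) powr (1 - s))"
    by (rule telescope_sums)
  then have "(\<lambda>n. zeta_term n s) sums ((s - 1) * zeta_sum s + (0 - of_nat (Suc 0) powr (1 - s)))"
    unfolding zeta_term_def using s by (intro sums_add sums_mult zeta_sum_sums) auto
  moreover have "(\<lambda>n. zeta_term n s) sums (zeta_cont s - 1)"
    using s by (intro zeta_term_sums) auto
  ultimately have "(s - 1) * zeta_sum s + (0 - of_nat (Suc 0) powr (1 - s)) = zeta_cont s - 1"
    by (rule sums_unique2)
  then show ?thesis by simp
qed

section \<open>The 3-4-1 argument on the line Re s = 1\<close>

lemma zeta_sum_nonzero: "Re s > 1 \<Longrightarrow> zeta_sum s \<noteq> 0"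
  using zeta_sum_mult_moebius by force

text \<open>The logarithmic derivative of \<open>(s - 1) * zeta_sum s\<close> splits off the pole at
  1 and leaves a quotient that makes sense up to the line Re s = 1, except at zeros.\<close>

lemma mangoldt_series_eq:
  assumes s: "Re s > 1"
  shows "mangoldt_series s = 1 / (s - 1) - deriv zeta_cont s / zeta_cont s"
proof -
  have "((\<lambda>s. (s - 1) * zeta_sum s) has_field_derivative
     zeta_sum s + (s - 1) * - (mangoldt_series s * zeta_sum s)) (at s)"
    using s by (auto intro!: derivative_eq_intros deriv_zeta_sum)
  then have "(zeta_cont has_field_derivative
     zeta_sum s + (s - 1) * - (mangoldt_series s * zeta_sum s)) (at s)"
    by (rule has_field_derivative_transform_within_open[of _ _ _ "{s. Re s > 1}"])
       (use s in \<open>simp_all add: open_halfspace_Re_gt zeta_cont_eq\<close>)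
  then have "deriv zeta_cont s = zeta_sum s + (s - 1) * - (mangoldt_series s * zeta_sum s)"
    by (rule DERIV_imp_deriv)
  moreover have "zeta_sum s \<noteq> 0" "s - 1 \<noteq> 0" using s zeta_sum_nonzero by auto
  moreover have "m = 1 / w - (z + w * - (m * z)) / (w * z)" if "z \<noteq> 0" "w \<noteq> 0" for m w z :: complex
    using that by (simp add: field_simps)
  ultimately show ?thesis
    using s by (metis zeta_cont_eq)
qed

text \<open>The real part of each term is nonnegative, because 3 + 4 cos x + cos 2x = 2 (1 + cos
  x)^2.\<close>

lemma mangoldt_series_341:
  assumes "\<sigma> > 1"
  shows "Re (3 * mangoldt_series (of_real \<sigma>) + 4 * mangoldt_series (Complex \<sigma> t)
     + mangoldt_series (Complex \<sigma> (2 * t))) \<ge> 0"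
proof -
  have hs: "((\<lambda>n. mangoldt n * of_nat n powr - s) has_sum mangoldt_series s) {1..}" if "Re s > 1" for s
    unfolding mangoldt_series_def
    by (rule has_sum_infsum[OF abs_summable_summable[OF abs_summable_mangoldt[OF that]]])
  have "((\<lambda>n. Re (3 * (mangoldt n * of_nat n powr - of_real \<sigma>) + 4 * (mangoldt n * of_nat n powr - Complex \<sigma> t)
       + mangoldt n * of_nat n powr - Complex \<sigma> (2 * t))) has_sum
     Re (3 * mangoldt_series (of_real \<sigma>) + 4 * mangoldt_series (Complex \<sigma> t)
     + mangoldt_series (Complex \<sigma> (2 * t)))) {1..}"
    by (rule has_sum_Re[OF has_sum_add[OF has_sum_add[OF has_sum_cmult_right has_sum_cmult_right]]])
       (rule hs; use assms in simp)+
  then show ?thesis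
  proof (rule has_sum_nonneg)
    fix n :: nat assume n: "n \<in> {1..}"
    define c where "c = cos (t * ln n)"
    have *: "Re (of_nat n powr - Complex \<sigma> u) = real n powr - \<sigma> * cos (u * ln n)" for u
      using n by (simp add: powr_def Re_exp Ln_of_nat mult.commute)
    have "complex_of_real \<sigma> = Complex \<sigma> 0" by (simp add: complex_eq_iff)
    then have "Re (3 * (mangoldt n * of_nat n powr - of_real \<sigma>) + 4 * (mangoldt n * of_nat n powr - Complex \<sigma> t)
       + mangoldt n * of_nat n powr - Complex \<sigma> (2 * t))
       = mangoldt n * real n powr - \<sigma> * (3 + 4 * c + cos (2 * (t * ln n)))"
      by (simp add: * c_def algebra_simps)
    also have "cos (2 * (t * ln n)) = 2 * c\<^sup>2 - 1" by (simp add: c_def cos_double_cos)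
    also have "3 + 4 * c + (2 * c\<^sup>2 - 1) = 2 * (1 + c)\<^sup>2"
      by (simp add: power2_eq_square algebra_simps)
    also have "mangoldt n * real n powr - \<sigma> * (2 * (1 + c)\<^sup>2) \<ge> 0"
      by (intro mult_nonneg_nonneg mangoldt_nonneg) auto
    finally show "Re (3 * (mangoldt n * of_nat n powr - of_real \<sigma>) + 4 * (mangoldt n * of_nat n powr - Complex \<sigma> t)
       + mangoldt n * of_nat n powr - Complex \<sigma> (2 * t)) \<ge> 0" .
  qed
qed

text \<open>\<open>k\<close> is the order of vanishing of \<open>f\<close> at \<open>\<xi>\<close>:
  if \<open>f w = (w - \<xi>) ^ k * g w\<close> with \<open>g\<close> nonvanishing near
  \<open>\<xi>\<close>, then f'/f is \<open>k / (w - \<xi>)\<close> plus a bounded term.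
  Non-constancy makes the order finite.\<close>

lemma tendsto_log_deriv_at_right:
  fixes f :: "complex \<Rightarrow> complex"
  assumes f: "f holomorphic_on S" and S: "open S" "connected S" "\<xi> \<in> S" and nc: "\<not> f constant_on S"
  obtains k :: nat where "f \<xi> = 0 \<longleftrightarrow> k > 0"
    "((\<lambda>e. of_real e * (deriv f (\<xi> + of_real e) / f (\<xi> + of_real e))) \<longlongrightarrow> of_nat k) (at_right 0)"
proof (cases "f \<xi> = 0")
  case False
  have lim: "((\<lambda>e. \<xi> + of_real e) \<longlongrightarrow> \<xi>) (at_right 0)"
    by (rule tendsto_eq_intros | simp)+
  have "isCont f \<xi>" "isCont (deriv f) \<xi>"
    using f S holomorphic_deriv[OF f S(1)]
    by (auto intro: analytic_at_imp_isCont simp: analytic_at intro!: exI[of _ S])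
  then have "((\<lambda>e. of_real e * (deriv f (\<xi> + of_real e) / f (\<xi> + of_real e))) \<longlongrightarrow> of_real 0 * (deriv f \<xi> / f \<xi>)) (at_right 0)"
    using False lim by (intro tendsto_intros isCont_tendsto_compose[of \<xi> f] isCont_tendsto_compose[of \<xi> "deriv f"])
  then show ?thesis using that[of 0] False by simp
next
  case True
  obtain g r n where g: "0 < n" "0 < r" "ball \<xi> r \<subseteq> S" "g holomorphic_on ball \<xi> r"
      "\<And>w. w \<in> ball \<xi> r \<Longrightarrow> f w = (w - \<xi>) ^ n * g w" "\<And>w. w \<in> ball \<xi> r \<Longrightarrow> g w \<noteq> 0"
    using holomorphic_factor_zero_nonconstant[OF f S True nc] by metis
  have lim: "((\<lambda>e. \<xi> + of_real e) \<longlongrightarrow> \<xi>) (at_right 0)"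
    by (rule tendsto_eq_intros | simp)+
  have "isCont g \<xi>" "isCont (deriv g) \<xi>"
    using g(2) holomorphic_on_imp_continuous_on[OF g(4)]
      holomorphic_on_imp_continuous_on[OF holomorphic_deriv[OF g(4) open_ball]]
    by (simp_all add: continuous_on_eq_continuous_at)
  then have "((\<lambda>e. of_nat n + of_real e * (deriv g (\<xi> + of_real e) / g (\<xi> + of_real e))) \<longlongrightarrow>
      of_nat n + of_real 0 * (deriv g \<xi> / g \<xi>)) (at_right 0)"
    using lim g by (intro tendsto_intros isCont_tendsto_compose[of \<xi> g] isCont_tendsto_compose[of \<xi> "deriv g"]) auto
  moreover have "\<forall>\<^sub>F e in at_right 0. of_nat n + of_real e * (deriv g (\<xi> + of_real e) / g (\<xi> + of_real e)) =
     of_real e * (deriv f (\<xi> + of_real e) / f (\<xi> + of_real e))"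
    unfolding eventually_at_right_field
  proof (intro exI[of _ r] conjI allI impI)
    fix e :: real assume e: "0 < e" "e < r"
    define w where "w = \<xi> + of_real e"
    have w: "w \<in> ball \<xi> r" using e by (simp add: w_def dist_norm)
    have "(g has_field_derivative deriv g w) (at w)"
      using g(4) w by (intro holomorphic_derivI) auto
    then have "((\<lambda>w. (w - \<xi>) ^ n * g w) has_field_derivative
        of_nat n * (w - \<xi>) ^ (n - 1) * g w + (w - \<xi>) ^ n * deriv g w) (at w)"
      by (auto intro!: derivative_eq_intros simp: mult_ac)
    then have "(f has_field_derivative
        of_nat n * (w - \<xi>) ^ (n - 1) * g w + (w - \<xi>) ^ n * deriv g w) (at w)"
      by (rule has_field_derivative_transform_within_open[of _ _ _ "ball \<xi> r"]) (use w g in auto)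
    then have "deriv f w = of_nat n * (w - \<xi>) ^ (n - 1) * g w + (w - \<xi>) ^ n * deriv g w"
      by (rule DERIV_imp_deriv)
    moreover have "(w - \<xi>) ^ n = (w - \<xi>) * (w - \<xi>) ^ (n - 1)"
      using g(1) by (simp add: power_eq_if)
    moreover have "w - \<xi> = of_real e" by (simp add: w_def)
    ultimately show "of_nat n + of_real e * (deriv g (\<xi> + of_real e) / g (\<xi> + of_real e)) =
       of_real e * (deriv f (\<xi> + of_real e) / f (\<xi> + of_real e))"
      unfolding w_def[symmetric] using e g(5,6)[OF w] by (simp add: field_simps)
  qed (use g in auto)
  ultimately have "((\<lambda>e. of_real e * (deriv f (\<xi> + of_real e) / f (\<xi> + of_real e))) \<longlongrightarrow> of_nat n) (at_right 0)"
    by (simp add: tendsto_cong)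
  then show ?thesis using that[of n] True g(1) by simp
qed

text \<open>After multiplication by \<open>e\<close>, the pole term \<open>1 / (s - 1)\<close>
  contributes 1 at \<open>u = 0\<close> and nothing elsewhere; the quotient contributes minus the
  order of the zero at 1 + iu.\<close>

lemma tendsto_mangoldt_series_at_right:
  assumes nc: "\<not> zeta_cont constant_on {s. Re s > 0}"
  obtains k :: nat where "zeta_cont (Complex 1 u) = 0 \<longleftrightarrow> k > 0"
    "((\<lambda>e. of_real e * mangoldt_series (Complex (1 + e) u)) \<longlongrightarrow> (if u = 0 then 1 else 0) - of_nat k) (at_right 0)"
proof -
  have "connected {s. 0 < Re s}" by (simp add: convex_connected convex_halfspace_Re_gt)
  then obtain k :: nat where k: "zeta_cont (Complex 1 u) = 0 \<longleftrightarrow> k > 0"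
    "((\<lambda>e. of_real e * (deriv zeta_cont (Complex 1 u + of_real e) / zeta_cont (Complex 1 u + of_real e)))
       \<longlongrightarrow> of_nat k) (at_right 0)"
    using tendsto_log_deriv_at_right[OF zeta_cont_holomorphic _ _ _ nc, of "Complex 1 u"]
    by (auto simp: open_halfspace_Re_gt)
  have "((\<lambda>e. of_real e / (of_real e + \<i> * of_real u)) \<longlongrightarrow> (if u = 0 then 1 else 0)) (at_right 0)"
  proof (cases "u = 0")
    case True
    have "\<forall>\<^sub>F e in at_right 0. 1 = complex_of_real e / (of_real e + \<i> * of_real u)"
      using True by (auto simp: eventually_at_right_field intro!: exI[of _ 1])
    from Lim_transform_eventually[OF tendsto_const this] show ?thesis using True by simp
  next
    case False
    have "((\<lambda>e. complex_of_real e / (of_real e + \<i> * of_real u)) \<longlongrightarrow> of_real 0 / (of_real 0 + \<i> * of_real u)) (at_right 0)"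
      using False by (intro tendsto_intros) auto
    then show ?thesis using False by simp
  qed
  from tendsto_diff[OF this k(2)]
  have lim: "((\<lambda>e. of_real e / (of_real e + \<i> * of_real u) -
     of_real e * (deriv zeta_cont (Complex 1 u + of_real e) / zeta_cont (Complex 1 u + of_real e)))
       \<longlongrightarrow> (if u = 0 then 1 else 0) - of_nat k) (at_right 0)" .
  have "\<forall>\<^sub>F e in at_right 0. of_real e / (of_real e + \<i> * of_real u) -
     of_real e * (deriv zeta_cont (Complex 1 u + of_real e) / zeta_cont (Complex 1 u + of_real e))
     = of_real e * mangoldt_series (Complex (1 + e) u)"
    unfolding eventually_at_right_field
  proof (intro exI[of _ 1] conjI allI impI)
    fix e :: real assume e: "0 < e" "e < 1"
    have eq: "Complex 1 u + of_real e = Complex (1 + e) u" "Complex (1 + e) u - 1 = of_real e + \<i> * of_real u"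
      by (simp_all add: complex_eq_iff)
    show "of_real e / (of_real e + \<i> * of_real u) -
     of_real e * (deriv zeta_cont (Complex 1 u + of_real e) / zeta_cont (Complex 1 u + of_real e))
     = of_real e * mangoldt_series (Complex (1 + e) u)"
      using e by (subst mangoldt_series_eq) (simp_all add: eq right_diff_distrib)
  qed simp
  from Lim_transform_eventually[OF lim this] show ?thesis using that k(1) by blast
qed

text \<open>Multiplying the 3-4-1 inequality at \<open>1 + e\<close> by \<open>e\<close> and letting
  \<open>e\<close> tend to 0 yields \<open>3 - 4 * k1 - k2 \<ge> 0\<close> for the orders of
  vanishing at 1 + it and 1 + 2it; hence \<open>k1 = 0\<close>.\<close>

theorem zeta_cont_nonzero:
  assumes "Re s \<ge> 1" shows "zeta_cont s \<noteq> 0"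
proof (cases "zeta_cont constant_on {s. Re s > 0}")
  \<comment> \<open>A constant \<open>zeta_cont\<close> equals its value 1 at 1. The other case
    supplies the non-constancy that a finite order of vanishing requires.\<close>
  case True
  then obtain c where "\<And>s. Re s > 0 \<Longrightarrow> zeta_cont s = c" by (auto simp: constant_on_def)
  from this[of s] this[of 1] assms show ?thesis by simp
next
  case nc: False
  consider "Re s > 1" | "s = 1" | t where "t \<noteq> 0" "s = Complex 1 t"
    using assms by (metis complex.collapse less_eq_real_def one_complex.code)
  then show ?thesis
  proof cases
    case 1
    then show ?thesis using zeta_cont_eq[OF 1] zeta_sum_nonzero[OF 1] by auto
  next
    case 3
    obtain k0 where k0: "zeta_cont (Complex 1 0) = 0 \<longleftrightarrow> k0 > 0"
      "((\<lambda>e. of_real e * mangoldt_series (Complex (1 + e) 0)) \<longlongrightarrow> (if 0 = (0::real) then 1 else 0) - of_nat k0) (at_right 0)"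
      using tendsto_mangoldt_series_at_right[OF nc, of 0] by blast
    obtain k1 where k1: "zeta_cont (Complex 1 t) = 0 \<longleftrightarrow> k1 > 0"
      "((\<lambda>e. of_real e * mangoldt_series (Complex (1 + e) t)) \<longlongrightarrow> (if t = 0 then 1 else 0) - of_nat k1) (at_right 0)"
      using tendsto_mangoldt_series_at_right[OF nc, of t] by blast
    obtain k2 where k2:
      "((\<lambda>e. of_real e * mangoldt_series (Complex (1 + e) (2 * t))) \<longlongrightarrow> (if 2 * t = 0 then 1 else 0) - of_nat k2) (at_right 0)"
      using tendsto_mangoldt_series_at_right[OF nc, of "2 * t"] by blast
    have "Complex 1 0 = 1" by (simp add: complex_eq_iff)
    then have "k0 = 0" using k0(1) by simp
    let ?F = "\<lambda>e. 3 * (of_real e * mangoldt_series (Complex (1 + e) 0)) + 4 * (of_real e * mangoldt_series (Complex (1 + e) t))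
        + of_real e * mangoldt_series (Complex (1 + e) (2 * t))"
    have "(?F \<longlongrightarrow> 3 * 1 + 4 * (- of_nat k1) + - of_nat k2) (at_right 0)"
      using k0(2) k1(2) k2 \<open>k0 = 0\<close> 3 by (intro tendsto_intros) auto
    then have "((\<lambda>e. Re (?F e)) \<longlongrightarrow> Re (3 * 1 + 4 * (- of_nat k1) + - of_nat k2)) (at_right 0)"
      by (rule tendsto_Re)
    moreover have "\<forall>\<^sub>F e in at_right 0. Re (?F e) \<ge> 0"
      unfolding eventually_at_right_field
    proof (intro exI[of _ 1] conjI allI impI)
      fix e :: real assume e: "0 < e" "e < 1"
      have "Complex (1 + e) 0 = of_real (1 + e)" by (simp add: complex_eq_iff)
      then have "Re (?F e) = e * Re (3 * mangoldt_series (of_real (1 + e)) + 4 * mangoldt_series (Complex (1 + e) t)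
         + mangoldt_series (Complex (1 + e) (2 * t)))"
        by (simp add: algebra_simps)
      then show "Re (?F e) \<ge> 0"
        using e mangoldt_series_341[of "1 + e" t] by simp
    qed simp
    ultimately have "Re (3 * 1 + 4 * (- of_nat k1) + - of_nat k2) \<ge> 0"
      by (rule tendsto_lowerbound) simp
    then have "k1 = 0" by simp
    then show ?thesis using k1(1) 3 by simp
  qed simp
qed

section \<open>Newman's theorem\<close>

text \<open>Comparison of a term with an integral over \<open>[n, n + 1]\<close>, in mean value
  form. The right side telescopes, which sums up the tails in
  \<open>norm_dirichlet_tail_le\<close>.\<close>

lemma powr_diff_Suc_ge:
  assumes "x > 0" "n > 0"
  shows "x * real (Suc n) powr (- 1 - x) \<le> real n powr - x - real (Suc n) powr - x"
proof -
  have "\<exists>z. real n < z \<and> z < real (Suc n) \<and>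
     real (Suc n) powr - x - real n powr - x = (real (Suc n) - real n) * (- x * z powr (- x - 1))"
    using assms by (intro MVT2) (auto intro!: derivative_eq_intros)
  then obtain z where z: "real n < z" "z < real (Suc n)"
    "real (Suc n) powr - x - real n powr - x = - x * z powr (- x - 1)" by auto
  have "real (Suc n) powr (- 1 - x) \<le> z powr (- 1 - x)"
    using z assms by (intro powr_mono2') auto
  then have "x * real (Suc n) powr (- 1 - x) \<le> x * z powr (- 1 - x)"
    using assms by simp
  moreover have e: "- x - 1 = - 1 - x" by simp
  ultimately show ?thesis using z(3) unfolding e by simp
qed

text \<open>Comparison with the integral of \<open>t powr (y - 1)\<close>. For
  \<open>y \<le> 1\<close> the summand does not increase and the integral alone suffices; for
  \<open>y > 1\<close> it increases, and the last term has to be split off, which is the first term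
  of the bound.\<close>

lemma sum_powr_le:
  assumes y: "y > 0" and N: "N > 0"
  shows "(\<Sum>n=1..N. real n powr (y - 1)) \<le> real N powr (y - 1) + real N powr y / y"
proof -
  have mvt: "\<exists>z. real n < z \<and> z < real (Suc n) \<and>
     real (Suc n) powr y - real n powr y = y * z powr (y - 1)" if "n > 0" for n
  proof -
    have "\<exists>z. real n < z \<and> z < real (Suc n) \<and>
       real (Suc n) powr y - real n powr y = (real (Suc n) - real n) * (y * z powr (y - 1))"
      using that by (intro MVT2) (auto intro!: derivative_eq_intros)
    then show ?thesis by simp
  qed
  show ?thesis
  proof (cases "y \<le> 1")
    case True
    have "y * (\<Sum>n=1..N. real n powr (y - 1)) \<le> real N powr y"
    proof (induction N)
      case (Suc N)
      have "y * real (Suc N) powr (y - 1) \<le> real (Suc N) powr y - real N powr y"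
      proof (cases "N = 0")
        case False
        then obtain z where z: "real N < z" "z < real (Suc N)"
          "real (Suc N) powr y - real N powr y = y * z powr (y - 1)" using mvt[of N] by auto
        have "real (Suc N) powr (y - 1) \<le> z powr (y - 1)"
          using z True by (intro powr_mono2') auto
        then show ?thesis using z y by simp
      qed (use True y in simp)
      then show ?case using Suc by (simp add: algebra_simps)
    qed simp
    then have "(\<Sum>n=1..N. real n powr (y - 1)) \<le> real N powr y / y"
      using y by (simp add: field_simps)
    then show ?thesis by (smt (verit) powr_ge_zero)
  next
    case False
    have "y * (\<Sum>n=1..<N. real n powr (y - 1)) \<le> real N powr y"
      using N
    proof (induction N rule: nat_induct_non_zero)
      case (Suc N)
      obtain z where z: "real N < z" "z < real (Suc N)"
        "real (Suc N) powr y - real N powr y = y * z powr (y - 1)" using mvt[of N] Suc by auto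
      have "real N powr (y - 1) \<le> z powr (y - 1)"
        using z False by (intro powr_mono2) auto
      then have "y * real N powr (y - 1) \<le> real (Suc N) powr y - real N powr y" using z y by simp
      moreover have "(\<Sum>n=1..<Suc N. real n powr (y - 1)) = (\<Sum>n=1..<N. real n powr (y - 1)) + real N powr (y - 1)"
        using Suc by simp
      ultimately show ?case using Suc by (simp add: distrib_left)
    qed simp
    then have "(\<Sum>n=1..<N. real n powr (y - 1)) \<le> real N powr y / y"
      using y by (simp add: field_simps)
    moreover have "{1..N} = insert N {1..<N}" using N by auto
    ultimately show ?thesis by simp
  qed
qed

text \<open>Dominated convergence: the powers have norm at most 1 and tend to 0 where Re z < 0. Only
  interior points are assumed to satisfy this, because two of the segments used later have an
  endpoint on the imaginary axis.\<close>

lemma contour_integral_linepath_powr_tendsto_0: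
  fixes h :: "complex \<Rightarrow> complex"
  assumes h: "continuous_on (closed_segment a b) h"
    and neg: "\<And>t. 0 < t \<Longrightarrow> t < 1 \<Longrightarrow> Re (linepath a b t) < 0"
  shows "(\<lambda>N. contour_integral (linepath a b) (\<lambda>z. h z * of_nat (Suc N) powr z)) \<longlonglongrightarrow> 0"
proof -
  let ?f = "\<lambda>N t. h (linepath a b t) * of_nat (Suc N) powr (linepath a b t) * (b - a)"
  have cl: "continuous_on {0..1} (\<lambda>t. h (linepath a b t))"
    by (rule continuous_on_compose2[OF h]) (auto simp: linepath_in_path intro!: continuous_intros)
  then have "compact ((\<lambda>t. h (linepath a b t)) ` {0..1})"
    by (intro compact_continuous_image) auto
  then obtain C where C: "\<And>t. t \<in> {0..1} \<Longrightarrow> norm (h (linepath a b t)) \<le> C"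
    using compact_imp_bounded bounded_iff by (metis imageI)
  have integrable: "?f N integrable_on {0..1}" for N
    by (intro integrable_continuous_real continuous_intros cl) (auto simp del: of_nat_Suc)
  have "(\<lambda>N. integral {0<..<1} (?f N)) \<longlonglongrightarrow> integral {0<..<1::real} (\<lambda>t. 0)"
  proof (rule dominated_convergence(2))
    show "?f N integrable_on {0<..<1}" for N
      using integrable by (simp add: integrable_on_open_interval_real)
    show "(\<lambda>t. C * norm (b - a)) integrable_on {0<..<1::real}"
      by (simp add: integrable_on_open_interval_real integrable_const_ivl)
    show "norm (?f N t) \<le> C * norm (b - a)" if "t \<in> {0<..<1}" for N t
    proof -
      have "norm (of_nat (Suc N) powr (linepath a b t)) \<le> 1"
        using neg[of t] that powr_mono[of "Re (linepath a b t)" 0 "real (Suc N)"]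
        by (subst norm_nat_powr) (simp_all del: of_nat_Suc)
      moreover have "norm (h (linepath a b t)) \<le> C" using C that by simp
      ultimately have "norm (h (linepath a b t)) * norm (of_nat (Suc N) powr (linepath a b t)) \<le> C * 1"
        by (intro mult_mono) (auto intro: order_trans[OF norm_ge_zero])
      then show ?thesis unfolding norm_mult by (intro mult_right_mono) auto
    qed
    show "(\<lambda>N. ?f N t) \<longlonglongrightarrow> 0" if "t \<in> {0<..<1}" for t
    proof -
      have "(\<lambda>N. real (Suc N) powr Re (linepath a b t)) \<longlonglongrightarrow> 0"
        using that neg[of t]
        by (intro tendsto_neg_powr filterlim_compose[OF filterlim_real_sequentially filterlim_Suc]) auto
      then have "(\<lambda>N. norm (complex_of_nat (Suc N) powr (linepath a b t))) \<longlonglongrightarrow> 0"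
        by (subst norm_nat_powr) auto
      then have "(\<lambda>N. complex_of_nat (Suc N) powr (linepath a b t)) \<longlonglongrightarrow> 0"
        by (rule tendsto_norm_zero_cancel)
      then have "(\<lambda>N. ?f N t) \<longlonglongrightarrow> h (linepath a b t) * 0 * (b - a)"
        by (intro tendsto_intros)
      then show ?thesis by simp
    qed
  qed
  moreover have "contour_integral (linepath a b) (\<lambda>z. h z * of_nat (Suc N) powr z) = integral {0<..<1} (?f N)" for N
    by (simp add: contour_integral_integral integral_open_interval_real)
  ultimately show ?thesis by simp
qed

lemma has_contour_integral_part_circlepath_combine:
  assumes "a < b" "b < c"
    "(f has_contour_integral I) (part_circlepath z r a b)"
    "(f has_contour_integral J) (part_circlepath z r b c)"
  shows "(f has_contour_integral (I + J)) (part_circlepath z r a c)"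
proof -
  have "a < c" "a \<le> b" "b \<le> c" using assms by auto
  then show ?thesis
    using assms has_integral_combine[of a b c _ I J]
    by (simp add: has_contour_integral_part_circlepath_iff)
qed

text \<open>On the circle R^2 is \<open>z * cnj z\<close>, so the kernel equals 2 Re z / R^2. Its
  factor Re z cancels the 1 / |Re z| in the two estimates that follow.\<close>

lemma norm_newman_kernel:
  assumes "norm z = R" "R > 0"
  shows "norm ((1 + z\<^sup>2 / of_real R ^ 2) / z) = 2 * \<bar>Re z\<bar> / R\<^sup>2"
proof -
  have z: "z \<noteq> 0" using assms by auto
  have "of_real R ^ 2 = z * cnj z" using assms complex_norm_square[of z] by simp
  then have "(1 + z\<^sup>2 / of_real R ^ 2) / z = (cnj z + z) / of_real R ^ 2"
    using z by (simp add: power2_eq_square field_simps)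
  also have "cnj z + z = of_real (2 * Re z)" by (simp add: complex_eq_iff)
  finally show ?thesis using assms by (simp add: norm_divide norm_power)
qed

lemma norm_dirichlet_tail_le:
  fixes a :: "nat \<Rightarrow> complex"
  assumes a: "\<And>n. norm (a n) \<le> 1" and z: "Re z > 0" and N: "N > 0"
    and F: "((\<lambda>n. a n * of_nat n powr - (1 + z)) has_sum F) {1..}"
  shows "norm (F - (\<Sum>n=1..N. a n * of_nat n powr - (1 + z))) \<le> real N powr - Re z / Re z"
proof -
  let ?S = "\<lambda>M. \<Sum>n=1..M. a n * of_nat n powr - (1 + z)"
  \<comment> \<open>Scaling by \<open>Re z\<close> and keeping the subtracted power make the
    induction step exactly \<open>powr_diff_Suc_ge\<close>.\<close>
  have bound: "Re z * norm (?S (N + k) - ?S N) \<le> real N powr - Re z - real (N + k) powr - Re z" for k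
  proof (induction k)
    case (Suc k)
    have "?S (N + Suc k) - ?S N = (?S (N + k) - ?S N) + a (Suc (N + k)) * of_nat (Suc (N + k)) powr - (1 + z)"
      by simp
    then have "norm (?S (N + Suc k) - ?S N) \<le> norm (?S (N + k) - ?S N)
       + norm (a (Suc (N + k)) * of_nat (Suc (N + k)) powr - (1 + z))"
      by (simp only: norm_triangle_ineq)
    also have "norm (a (Suc (N + k)) * of_nat (Suc (N + k)) powr - (1 + z)) \<le> 1 * real (Suc (N + k)) powr (- 1 - Re z)"
      unfolding norm_mult using a by (intro mult_mono) (auto simp: norm_nat_powr simp del: of_nat_Suc)
    finally have "Re z * norm (?S (N + Suc k) - ?S N) \<le> Re z * norm (?S (N + k) - ?S N)
        + Re z * real (Suc (N + k)) powr (- 1 - Re z)"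
      using z by (simp add: distrib_left[symmetric] mult_left_mono)
    then show ?case using Suc powr_diff_Suc_ge[of "Re z" "N + k"] z N by simp
  qed simp
  have "(\<lambda>n. a (Suc n) * of_nat (Suc n) powr - (1 + z)) sums F"
    by (rule has_sum_imp_sums_Suc[OF F])
  then have "(\<lambda>M. \<Sum>n<M. a (Suc n) * of_nat (Suc n) powr - (1 + z)) \<longlonglongrightarrow> F"
    by (simp add: sums_def)
  also have "(\<lambda>M. \<Sum>n<M. a (Suc n) * of_nat (Suc n) powr - (1 + z)) = ?S"
    by (intro ext sum.reindex_bij_witness[of _ "\<lambda>n. n - 1" Suc]) auto
  finally have "(\<lambda>k. ?S (k + N)) \<longlonglongrightarrow> F" by (rule LIMSEQ_ignore_initial_segment)
  then have "(\<lambda>k. ?S (N + k) - ?S N) \<longlonglongrightarrow> F - ?S N"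
    by (intro tendsto_diff tendsto_const) (simp add: add.commute)
  then show ?thesis
  proof (rule Lim_norm_ubound[rotated])
    show "\<forall>\<^sub>F k in sequentially. norm (?S (N + k) - ?S N) \<le> real N powr - Re z / Re z"
    proof (intro always_eventually allI)
      fix k
      have "Re z * norm (?S (N + k) - ?S N) \<le> real N powr - Re z"
        using bound[of k] by (smt (verit) powr_ge_zero)
      then show "norm (?S (N + k) - ?S N) \<le> real N powr - Re z / Re z"
        using z by (simp add: field_simps)
    qed
  qed simp
qed

text \<open>The estimate for the left half circle, where only the partial sum, an entire function,
  is available.\<close>

lemma norm_dirichlet_partial_sum_le:
  fixes a :: "nat \<Rightarrow> complex"
  assumes a: "\<And>n. norm (a n) \<le> 1" and z: "Re z < 0" and N: "N > 0"
  shows "norm (\<Sum>n=1..N. a n * of_nat n powr - (1 + z))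
    \<le> real N powr - Re z * (1 / real N + 1 / \<bar>Re z\<bar>)"
proof -
  have "norm (\<Sum>n=1..N. a n * of_nat n powr - (1 + z)) \<le> (\<Sum>n=1..N. real n powr (- Re z - 1))"
  proof (rule sum_norm_le)
    fix n assume n: "n \<in> {1..N}"
    have "norm (of_nat n powr - (1 + z) :: complex) = real n powr Re (- (1 + z))"
      using n by (intro norm_nat_powr) auto
    moreover have "Re (- (1 + z)) = - Re z - 1" by simp
    ultimately have "norm (of_nat n powr - (1 + z) :: complex) = real n powr (- Re z - 1)"
      by (simp only:)
    then have "norm (a n * of_nat n powr - (1 + z)) \<le> 1 * real n powr (- Re z - 1)"
      unfolding norm_mult using a by (intro mult_mono) auto
    then show "norm (a n * of_nat n powr - (1 + z)) \<le> real n powr (- Re z - 1)" by simp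
  qed
  also have "\<dots> \<le> real N powr (- Re z - 1) + real N powr - Re z / - Re z"
    using z N by (intro sum_powr_le) auto
  also have "\<dots> = real N powr - Re z * (1 / real N + 1 / \<bar>Re z\<bar>)"
    using z N by (simp add: powr_diff distrib_left right_diff_distrib)
  finally show ?thesis .
qed

text \<open>
  The full series is integrated over the right half circle of radius \<open>R\<close>, closed up by three
  segments on which \<open>Re z < 0\<close>; the factor \<open>z\<close> in \<open>z * G z\<close> cancels the pole of Newman's kernel at
  \<open>0\<close>, so this integral vanishes. The partial sum is integrated over the whole circle.
\<close>

lemma newman_partial_sum_bound:
  fixes a :: "nat \<Rightarrow> complex" and G :: "complex \<Rightarrow> complex"
  assumes a: "\<And>n. norm (a n) \<le> 1"
    and U: "open U" "{z. Re z \<ge> 0} \<subseteq> U" and G: "G holomorphic_on U"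
    and F: "\<And>z. Re z > 0 \<Longrightarrow> ((\<lambda>n. a n * of_nat n powr - (1 + z)) has_sum z * G z) {1..}"
    and R: "R > 0"
  obtains E :: "nat \<Rightarrow> complex" where "E \<longlonglongrightarrow> 0"
    "\<And>N. norm (\<Sum>n=1..Suc N. a n / of_nat n) \<le> 2 / R + 1 / real (Suc N) + norm (E N)"
proof -
  \<comment> \<open>By compactness \<open>U\<close> contains a neighbourhood of uniform width around
    the part of the right half-plane that matters; this gives room to the left of the imaginary
    axis.\<close>
  obtain \<epsilon> where \<epsilon>: "\<epsilon> > 0" "(\<Union>x\<in>cbox (Complex 0 (- (R + 1))) (Complex (R + 1) (R + 1)). ball x \<epsilon>) \<subseteq> U"
  proof (rule compact_subset_open_imp_ball_epsilon_subset)
    show "cbox (Complex 0 (- (R + 1))) (Complex (R + 1) (R + 1)) \<subseteq> U"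
      using U(2) by (auto simp: in_cbox_complex_iff)
  qed (use U in auto)
  \<comment> \<open>An intersection of two convex sets that holds the whole contour, so that
    Cauchy's theorem applies in its convex form.\<close>
  define V where "V = {z. Re z > - \<epsilon>} \<inter> ball 0 (R + 1)"
  have V: "convex V" "open V"
    by (auto simp: V_def open_halfspace_Re_gt convex_halfspace_Re_gt intro!: convex_Int)
  have VU: "V \<subseteq> U"
  proof
    fix z assume z: "z \<in> V"
    have "\<bar>Re z\<bar> < R + 1" "\<bar>Im z\<bar> < R + 1"
      using z abs_Re_le_cmod[of z] abs_Im_le_cmod[of z] by (auto simp: V_def)
    show "z \<in> U"
    proof (cases "Re z \<ge> 0")
      case True
      then show ?thesis using U by auto
    next
      case False
      have "z - Complex 0 (Im z) = of_real (Re z)" by (simp add: complex_eq_iff)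
      then have "dist (Complex 0 (Im z)) z = \<bar>Re z\<bar>" by (simp add: dist_norm norm_minus_commute)
      also have "\<dots> < \<epsilon>" using z False by (auto simp: V_def)
      finally have "z \<in> ball (Complex 0 (Im z)) \<epsilon>" by simp
      moreover have "Complex 0 (Im z) \<in> cbox (Complex 0 (- (R + 1))) (Complex (R + 1) (R + 1))"
        using \<open>\<bar>Im z\<bar> < R + 1\<close> R by (auto simp: in_cbox_complex_iff)
      ultimately show ?thesis using \<epsilon>(2) by blast
    qed
  qed
  \<comment> \<open>Below \<open>\<epsilon>\<close> to keep \<open>p2\<close> and \<open>p3\<close>
    in the strip, below 1 to keep them in the disc of radius \<open>R + 1\<close>.\<close>
  define \<delta> where "\<delta> = min \<epsilon> 1 / 2"
  have \<delta>: "\<delta> > 0" "\<delta> < \<epsilon>" "\<delta> < 1" using \<epsilon>(1) by (auto simp: \<delta>_def)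
  define p1 p2 p3 p4 where "p1 = Complex 0 R" and "p2 = Complex (- \<delta>) R"
    and "p3 = Complex (- \<delta>) (- R)" and "p4 = Complex 0 (- R)"
  have n2: "norm (Complex x y) < R + 1" if "\<bar>x\<bar> < 1" "\<bar>y\<bar> = R" for x y
    using cmod_le[of "Complex x y"] that by simp
  have pV: "p1 \<in> V" "p2 \<in> V" "p3 \<in> V" "p4 \<in> V"
    using \<delta> \<epsilon>(1) R by (auto simp: V_def p1_def p2_def p3_def p4_def intro!: n2)
  define h where "h = (\<lambda>z. G z * (1 + z\<^sup>2 / of_real R ^ 2))"
  have hol_h: "h holomorphic_on V"
    unfolding h_def using holomorphic_on_subset[OF G VU] R by (intro holomorphic_intros) auto
  define k where "k = (\<lambda>N z. (1 + z\<^sup>2 / of_real R ^ 2) * (of_nat (Suc N) :: complex) powr z)"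
  define S where "S = (\<lambda>N z. \<Sum>n=1..Suc N. a n * (of_nat n :: complex) powr - (1 + z))"
  let ?I1 = "\<lambda>N. contour_integral (linepath p1 p2) (\<lambda>z. h z * of_nat (Suc N) powr z)"
  let ?I2 = "\<lambda>N. contour_integral (linepath p2 p3) (\<lambda>z. h z * of_nat (Suc N) powr z)"
  let ?I3 = "\<lambda>N. contour_integral (linepath p3 p4) (\<lambda>z. h z * of_nat (Suc N) powr z)"
  \<comment> \<open>The contribution of the three segments after division by 2 pi; the size of
    \<open>G\<close> enters the final bound only here.\<close>
  define E where "E = (\<lambda>N. (?I1 N + ?I2 N + ?I3 N) / (2 * of_real pi))"
  have seg: "closed_segment x y \<subseteq> V" if "x \<in> V" "y \<in> V" for x y
    using that V(1) closed_segment_subset by blast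
  have cont_h: "continuous_on (closed_segment x y) h" if "x \<in> V" "y \<in> V" for x y
    using continuous_on_subset[OF holomorphic_on_imp_continuous_on[OF hol_h] seg[OF that]] .
  have neg: "Re (linepath p1 p2 t) < 0" "Re (linepath p2 p3 t) < 0" "Re (linepath p3 p4 t) < 0"
    if "0 < t" "t < 1" for t
    using that \<delta> by (auto simp: linepath_def p1_def p2_def p3_def p4_def algebra_simps)
  have "E \<longlonglongrightarrow> (0 + 0 + 0) / (2 * of_real pi)"
    unfolding E_def
    by (intro tendsto_intros contour_integral_linepath_powr_tendsto_0 cont_h pV neg) auto
  then have E0: "E \<longlonglongrightarrow> 0" by simp
  moreover have "norm (\<Sum>n=1..Suc N. a n / of_nat n) \<le> 2 / R + 1 / real (Suc N) + norm (E N)" for N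
  proof -
    let ?A1 = "part_circlepath 0 R (3 * pi / 2) (2 * pi)" and ?A2 = "part_circlepath 0 R 0 (pi / 2)"
    let ?A' = "part_circlepath 0 R (pi / 2) (3 * pi / 2)"
    let ?hN = "\<lambda>z. h z * of_nat (Suc N) powr z"
    let ?sN = "\<lambda>z. S N z * k N z / z"
    have norm_arc: "norm z = R" if "z \<in> path_image (part_circlepath 0 R s t)" "s \<le> t" for z s t
      using in_path_image_part_circlepath[OF that(1) that(2)] R by simp
    have re_arc: "\<exists>x. s \<le> x \<and> x \<le> t \<and> Re z = R * cos x" if "z \<in> path_image (part_circlepath 0 R s t)" "s \<le> t" for z s t
      using that by (auto simp: path_image_part_circlepath cis_conv_exp[symmetric])
    have reA1: "Re z \<ge> 0" if z: "z \<in> path_image ?A1" for z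
    proof -
      obtain x where x: "3 * pi / 2 \<le> x" "x \<le> 2 * pi" "Re z = R * cos x" using re_arc[OF z] by auto
      have "cos x = cos (2 * pi - x)" by (simp add: cos_diff)
      also have "\<dots> \<ge> 0" using x by (intro cos_ge_zero) auto
      finally show ?thesis using x R by simp
    qed
    have reA2: "Re z \<ge> 0" if z: "z \<in> path_image ?A2" for z
    proof -
      obtain x where x: "0 \<le> x" "x \<le> pi / 2" "Re z = R * cos x" using re_arc[OF z] by auto
      have "cos x \<ge> 0" using x by (intro cos_ge_zero) auto
      then show ?thesis using x R by simp
    qed
    have reA': "Re z \<le> 0" if z: "z \<in> path_image ?A'" for z
    proof -
      obtain x where x: "pi / 2 \<le> x" "x \<le> 3 * pi / 2" "Re z = R * cos x" using re_arc[OF z] by auto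
      have "cos x = - cos (x - pi)" by (simp add: cos_diff)
      also have "\<dots> \<le> 0" using x cos_ge_zero[of "x - pi"] by auto
      finally show ?thesis using x R by (simp add: mult_nonneg_nonpos)
    qed
    have inA: "z = p1 \<or> z = p4" if "norm z = R" "Re z = 0" for z
      using that by (auto simp: p1_def p4_def complex_eq_iff cmod_eq_Im abs_if split: if_splits)
    have arcV: "path_image ?A1 \<subseteq> V" "path_image ?A2 \<subseteq> V"
      using reA1 reA2 norm_arc[of _ "3 * pi / 2" "2 * pi"] norm_arc[of _ 0 "pi / 2"] \<epsilon>(1)
      by (force simp: V_def)+
    have hol_hN: "?hN holomorphic_on V"
      using hol_h by (intro holomorphic_intros) (auto simp del: of_nat_Suc)
    have ends: "pathstart ?A1 = p4" "pathfinish ?A1 = pathstart ?A2" "pathfinish ?A2 = p1"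
    proof -
      have e: "exp (\<i> * of_real x) = Complex (cos x) (sin x)" for x
        by (simp add: cis_conv_exp[symmetric] complex_eq_iff)
      have "3 * pi / 2 = 3 / 2 * pi" by simp
      then have "cos (3 * pi / 2) = 0" "sin (3 * pi / 2) = - 1"
        using cos_3over2_pi sin_3over2_pi by simp_all
      then show "pathstart ?A1 = p4" "pathfinish ?A1 = pathstart ?A2" "pathfinish ?A2 = p1"
        unfolding pathstart_part_circlepath pathfinish_part_circlepath e
        by (simp_all add: p1_def p4_def complex_eq_iff)
    qed
    let ?\<Gamma> = "?A1 +++ ?A2 +++ linepath p1 p2 +++ linepath p2 p3 +++ linepath p3 p4"
    have cauchy: "(?hN has_contour_integral 0) ?\<Gamma>"
      by (rule Cauchy_theorem_convex_simple[OF hol_hN V(1)])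
         (use ends arcV seg pV in \<open>auto simp: path_image_join intro!: valid_path_join\<close>)
    have ciV: "?hN contour_integrable_on g" if "valid_path g" "path_image g \<subseteq> V" for g
      by (rule contour_integrable_holomorphic_simple[OF hol_hN V(2) that])
    have joined: "(?hN has_contour_integral
       contour_integral ?A1 ?hN + (contour_integral ?A2 ?hN + (?I1 N + (?I2 N + ?I3 N)))) ?\<Gamma>"
      using ends arcV seg pV
      by (intro has_contour_integral_join has_contour_integral_integral ciV valid_path_join) auto
    have I0: "contour_integral ?A1 ?hN + contour_integral ?A2 ?hN + (?I1 N + ?I2 N + ?I3 N) = 0"
      using has_contour_integral_unique[OF joined cauchy] by (simp only: add.assoc)
    have hol_S: "(\<lambda>z. S N z * k N z) holomorphic_on UNIV"
      unfolding S_def k_def using R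
      by (intro holomorphic_intros) (auto simp del: of_nat_Suc)
    have circ: "(?sN has_contour_integral 2 * of_real pi * \<i> * (S N 0 * k N 0)) (circlepath 0 R)"
      using Cauchy_integral_circlepath_simple[OF holomorphic_on_subset[OF hol_S], of 0 R 0] R by simp
    have ciS: "?sN contour_integrable_on part_circlepath 0 R s t" if "s \<le> t" for s t
    proof (rule contour_integrable_continuous_part_circlepath)
      have "continuous_on UNIV (\<lambda>z. S N z * k N z)" using hol_S by (rule holomorphic_on_imp_continuous_on)
      then have "continuous_on (path_image (part_circlepath 0 R s t)) (\<lambda>z. S N z * k N z)"
        by (rule continuous_on_subset) simp
      moreover have "z \<noteq> 0" if "z \<in> path_image (part_circlepath 0 R s t)" for z
        using norm_arc[OF that \<open>s \<le> t\<close>] R by auto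
      ultimately show "continuous_on (path_image (part_circlepath 0 R s t)) ?sN"
        by (intro continuous_on_divide continuous_on_id) auto
    qed
    have "(?sN has_contour_integral contour_integral ?A2 ?sN + contour_integral ?A' ?sN + contour_integral ?A1 ?sN)
       (part_circlepath 0 R 0 (2 * pi))"
      using pi_gt_zero
      by (intro has_contour_integral_part_circlepath_combine[of _ "3 * pi / 2"]
            has_contour_integral_part_circlepath_combine[of _ "pi / 2"] has_contour_integral_integral ciS) auto
    then have circ': "2 * of_real pi * \<i> * (S N 0 * k N 0)
       = contour_integral ?A2 ?sN + contour_integral ?A' ?sN + contour_integral ?A1 ?sN"
      using circ unfolding circlepath_def by (rule has_contour_integral_unique[rotated])
    have k0: "k N 0 = 1" by (simp add: k_def del: of_nat_Suc)
    have rearrange: "w = c - (x - d) - (y - b) - i" if "w = b + c + d" "x + y + i = 0"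
      for w b c d x y i :: complex
    proof -
      have "c - (x - d) - (y - b) - i = b + c + d - (x + y + i)" by (simp add: algebra_simps)
      then show ?thesis by (simp only: that diff_zero)
    qed
    \<comment> \<open>On the right arcs the partial sum is compared with the full series, whose
      integral over the closed contour is 0. Only tails on the right, the partial sum on the left
      and the three segments remain to be estimated.\<close>
    have main: "2 * of_real pi * \<i> * S N 0 = contour_integral ?A' ?sN
       - (contour_integral ?A1 ?hN - contour_integral ?A1 ?sN)
       - (contour_integral ?A2 ?hN - contour_integral ?A2 ?sN) - (?I1 N + ?I2 N + ?I3 N)"
      by (rule rearrange[OF circ'[unfolded k0 mult_1_right] I0])
    have kernel: "norm (k N z / z) = 2 * \<bar>Re z\<bar> / R\<^sup>2 * real (Suc N) powr Re z" if "norm z = R" for z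
    proof -
      have "k N z / z = (1 + z\<^sup>2 / of_real R ^ 2) / z * of_nat (Suc N) powr z"
        by (simp add: k_def)
      then show ?thesis
        using norm_newman_kernel[OF that R] norm_nat_powr[of "Suc N" z] by (simp only: norm_mult zero_less_Suc)
    qed
    have right: "norm (?hN z - ?sN z) \<le> 2 / R\<^sup>2" if z: "norm z = R" "Re z > 0" for z
    proof -
      have "z \<noteq> 0" using z by auto
      have "?hN z - ?sN z = G z * k N z - S N z * k N z / z"
        by (simp add: h_def k_def mult.assoc)
      also have "\<dots> = (z * G z - S N z) * (k N z / z)"
        using \<open>z \<noteq> 0\<close> by (simp add: field_simps)
      finally have "norm (?hN z - ?sN z) = norm (z * G z - S N z) * norm (k N z / z)"
        by (simp only: norm_mult)
      also have "\<dots> \<le> (real (Suc N) powr - Re z / Re z) * (2 * \<bar>Re z\<bar> / R\<^sup>2 * real (Suc N) powr Re z)"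
        unfolding kernel[OF z(1)] S_def
        by (intro mult_right_mono norm_dirichlet_tail_le a F z) auto
      also have "\<dots> = 2 / R\<^sup>2"
        using z by (simp add: powr_minus field_simps)
      finally show ?thesis .
    qed
    have left: "norm (?sN z) \<le> 2 / R\<^sup>2 * (1 + R / real (Suc N))" if z: "norm z = R" "Re z < 0" for z
    proof -
      have "norm (?sN z) = norm (S N z) * norm (k N z / z)"
        by (simp add: norm_mult norm_divide)
      also have "\<dots> \<le> (real (Suc N) powr - Re z * (1 / real (Suc N) + 1 / \<bar>Re z\<bar>))
          * (2 * \<bar>Re z\<bar> / R\<^sup>2 * real (Suc N) powr Re z)"
        unfolding kernel[OF z(1)] S_def
        by (intro mult_right_mono norm_dirichlet_partial_sum_le a z) auto
      also have "\<dots> = 2 / R\<^sup>2 * (1 + \<bar>Re z\<bar> / real (Suc N))"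
      proof -
        have cancel: "(inverse P * (1 / M + 1 / x)) * (2 * x / R\<^sup>2 * P) = 2 / R\<^sup>2 * (1 + x / M)"
          if "P \<noteq> 0" "M \<noteq> 0" "x \<noteq> 0" for P M x :: real
          using that R by (simp add: field_simps)
        show ?thesis unfolding powr_minus by (rule cancel) (use z in auto)
      qed
      also have "\<dots> \<le> 2 / R\<^sup>2 * (1 + R / real (Suc N))"
        using z abs_Re_le_cmod[of z] by (intro mult_left_mono add_left_mono divide_right_mono) auto
      finally show ?thesis .
    qed
    have bA: "norm (contour_integral (part_circlepath 0 R s t) ?hN - contour_integral (part_circlepath 0 R s t) ?sN)
        \<le> 2 / R\<^sup>2 * R * (t - s)"
      if st: "s < t" "\<And>z. z \<in> path_image (part_circlepath 0 R s t) \<Longrightarrow> Re z \<ge> 0"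
        "path_image (part_circlepath 0 R s t) \<subseteq> V" for s t
    proof (rule has_contour_integral_bound_part_circlepath_strong[where k = "{p1, p4}"])
      show "((\<lambda>z. ?hN z - ?sN z) has_contour_integral
         contour_integral (part_circlepath 0 R s t) ?hN - contour_integral (part_circlepath 0 R s t) ?sN)
         (part_circlepath 0 R s t)"
        using st by (intro has_contour_integral_diff has_contour_integral_integral ciV ciS) auto
      show "norm (?hN z - ?sN z) \<le> 2 / R\<^sup>2" if "z \<in> path_image (part_circlepath 0 R s t) - {p1, p4}" for z
        using that st norm_arc[of z s t] inA[of z] right[of z] by force
    qed (use st R in auto)
    have bA': "norm (contour_integral ?A' ?sN) \<le> 2 / R\<^sup>2 * (1 + R / real (Suc N)) * R * (3 * pi / 2 - pi / 2)"
    proof (rule has_contour_integral_bound_part_circlepath_strong[where k = "{p1, p4}"])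
      show "(?sN has_contour_integral contour_integral ?A' ?sN) ?A'"
        by (intro has_contour_integral_integral ciS) auto
      show "norm (?sN z) \<le> 2 / R\<^sup>2 * (1 + R / real (Suc N))" if "z \<in> path_image ?A' - {p1, p4}" for z
        using that reA'[of z] norm_arc[of z "pi / 2" "3 * pi / 2"] inA[of z] left[of z] by force
    qed (use R in auto)
    have "2 * pi * norm (S N 0) = norm (2 * of_real pi * \<i> * S N 0)"
      by (simp add: norm_mult)
    also have "\<dots> \<le> norm (contour_integral ?A' ?sN)
       + norm (contour_integral ?A1 ?hN - contour_integral ?A1 ?sN)
       + norm (contour_integral ?A2 ?hN - contour_integral ?A2 ?sN) + norm (?I1 N + ?I2 N + ?I3 N)"
      unfolding main by (meson add_mono norm_triangle_ineq4 order_refl order_trans)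
    also have "\<dots> \<le> 2 / R\<^sup>2 * (1 + R / real (Suc N)) * R * (3 * pi / 2 - pi / 2)
       + 2 / R\<^sup>2 * R * (2 * pi - 3 * pi / 2) + 2 / R\<^sup>2 * R * (pi / 2 - 0) + norm (?I1 N + ?I2 N + ?I3 N)"
      using pi_gt_zero by (intro add_mono bA' bA reA1 reA2 arcV order_refl) auto
    \<comment> \<open>After division by 2 pi, the right arcs, of total angle pi, give
      \<open>1 / R\<close>; the left arc, of the same angle, gives
      \<open>1 / R + 1 / real (Suc N)\<close>.\<close>
    also have "\<dots> = 2 * pi * (2 / R + 1 / real (Suc N) + norm (E N))"
      using R by (simp add: E_def norm_divide norm_mult power2_eq_square field_simps del: of_nat_Suc)
    finally have "norm (S N 0) \<le> 2 / R + 1 / real (Suc N) + norm (E N)"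
      using pi_gt_zero by (simp only: mult_le_cancel_left_pos mult_pos_pos zero_less_numeral)
    moreover have "S N 0 = (\<Sum>n=1..Suc N. a n / of_nat n)"
      unfolding S_def by (intro sum.cong) (auto simp: powr_minus divide_inverse)
    ultimately show ?thesis by simp
  qed
  ultimately show ?thesis using that by blast
qed

text \<open>For fixed \<open>R\<close> the partial sums have limsup at most \<open>2 / R\<close>,
  and \<open>R\<close> is arbitrary. Writing the series as \<open>z * G z\<close> encodes that its
  continuation vanishes at 0, which is why the limit is 0.\<close>

theorem newman_ingham_zero:
  fixes a :: "nat \<Rightarrow> complex" and G :: "complex \<Rightarrow> complex"
  assumes a: "\<And>n. norm (a n) \<le> 1"
    and U: "open U" "{z. Re z \<ge> 0} \<subseteq> U" and G: "G holomorphic_on U"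
    and F: "\<And>z. Re z > 0 \<Longrightarrow> ((\<lambda>n. a n * of_nat n powr - (1 + z)) has_sum z * G z) {1..}"
  shows "(\<lambda>N. \<Sum>n=1..N. a n / of_nat n) \<longlonglongrightarrow> 0"
proof -
  have "(\<lambda>N. \<Sum>n=1..Suc N. a n / of_nat n) \<longlonglongrightarrow> 0"
  proof (rule LIMSEQ_I)
    fix \<epsilon> :: real assume \<epsilon>: "\<epsilon> > 0"
    define R where "R = 4 / \<epsilon>"
    have R: "R > 0" "2 / R = \<epsilon> / 2" using \<epsilon> by (simp_all add: R_def)
    obtain E :: "nat \<Rightarrow> complex" where E: "E \<longlonglongrightarrow> 0"
      "\<And>N. norm (\<Sum>n=1..Suc N. a n / of_nat n) \<le> 2 / R + 1 / real (Suc N) + norm (E N)"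
      using newman_partial_sum_bound[OF a U G F R(1)] by metis
    have "(\<lambda>N. 1 / real (Suc N) + norm (E N)) \<longlonglongrightarrow> 0 + 0"
      using LIMSEQ_inverse_real_of_nat tendsto_norm_zero[OF E(1)]
      by (intro tendsto_add) (simp_all add: inverse_eq_divide)
    then have "\<forall>\<^sub>F N in sequentially. 1 / real (Suc N) + norm (E N) < \<epsilon> / 2"
      using \<epsilon> by (intro order_tendstoD(2)[of _ 0]) auto
    then obtain N0 where "\<And>N. N \<ge> N0 \<Longrightarrow> 1 / real (Suc N) + norm (E N) < \<epsilon> / 2"
      by (auto simp: eventually_sequentially)
    then show "\<exists>N0. \<forall>N\<ge>N0. norm ((\<Sum>n=1..Suc N. a n / of_nat n) - 0) < \<epsilon>"
      using E(2) R(2) by (intro exI[of _ N0]) (smt (verit) diff_zero field_sum_of_halves)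
  qed
  then show ?thesis by (rule LIMSEQ_imp_Suc)
qed

text \<open>Here \<open>G z = 1 / zeta_cont (1 + z)\<close>: the pole of zeta at 1 becomes the
  required zero of 1/zeta(1 + z) at 0, and \<open>zeta_cont_nonzero\<close> makes \<open>G\<close>
  holomorphic on a neighbourhood of the closed right half-plane.\<close>

theorem sum_moebius_mu_over_n_tendsto_0: "(\<lambda>N. \<Sum>n=1..N. moebius_mu n / of_nat n) \<longlonglongrightarrow> 0"
proof (rule newman_ingham_zero)
  let ?P = "{s. Re s > 0}"
  define U where "U = (\<lambda>z. 1 + z) -` (?P \<inter> zeta_cont -` (- {0}))"
  have "open (?P \<inter> zeta_cont -` (- {0}))"
    using holomorphic_on_imp_continuous_on[OF zeta_cont_holomorphic]
    by (rule continuous_open_preimage) (auto simp: open_halfspace_Re_gt)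
  then show "open U" unfolding U_def by (intro continuous_open_vimage) (auto intro!: continuous_intros)
  show "{z. Re z \<ge> 0} \<subseteq> U" by (auto simp: U_def zeta_cont_nonzero)
  have "(\<lambda>z. zeta_cont (1 + z)) holomorphic_on U"
  proof (rule holomorphic_on_compose_gen[OF _ zeta_cont_holomorphic, of "\<lambda>z. 1 + z" U, unfolded o_def])
    show "(\<lambda>z. 1 + z) ` U \<subseteq> ?P" by (auto simp: U_def)
  qed (intro holomorphic_intros)
  then show "(\<lambda>z. 1 / zeta_cont (1 + z)) holomorphic_on U"
    by (intro holomorphic_on_divide holomorphic_on_const) (auto simp: U_def)
  fix z :: complex assume z: "Re z > 0"
  then have s: "Re (1 + z) > 1" by simp
  have "z \<noteq> 0" using z by auto
  then have "(\<Sum>\<^sub>\<infinity>n\<in>{1..}. moebius_mu n * of_nat n powr - (1 + z)) = z * (1 / zeta_cont (1 + z))"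
    using zeta_sum_mult_moebius[OF s] zeta_sum_nonzero[OF s]
    by (simp add: zeta_cont_eq[OF s] field_simps)
  moreover have "(\<lambda>n. moebius_mu n * of_nat n powr - (1 + z)) summable_on {1..}"
    by (rule abs_summable_summable[OF abs_summable_bounded_powr[OF norm_moebius_mu_le s]])
  ultimately show "((\<lambda>n. moebius_mu n * of_nat n powr - (1 + z)) has_sum z * (1 / zeta_cont (1 + z))) {1..}"
    by (metis has_sum_infsum)
qed (rule norm_moebius_mu_le)

section \<open>Dirichlet convolutions with the Moebius function\<close>

lemma filterlim_div_at_top:
  fixes r :: nat
  assumes "r > 0"
  shows "filterlim (\<lambda>N. N div r) at_top sequentially"
  unfolding filterlim_at_top
proof
  fix Z show "\<forall>\<^sub>F N in sequentially. Z \<le> N div r"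
    using assms by (auto simp: eventually_sequentially less_eq_div_iff_mult_less_eq intro!: exI[of _ "Z * r"])
qed

text \<open>Unrolling expresses \<open>B N\<close> by the values
  \<open>A (N div r ^ j) / r ^ j\<close>. As \<open>1 / r \<le> 1 / 2\<close>, a bound for
  \<open>A\<close> gives twice that bound for \<open>B\<close>, and each further unrolling halves
  what exceeds the small part.\<close>

lemma tendsto_zero_scaled_recursion:
  fixes A B :: "nat \<Rightarrow> complex"
  assumes A: "A \<longlonglongrightarrow> 0" and r: "r \<ge> 2"
    and B: "\<And>N. B N = A N + B (N div r) / of_nat r" and B0: "B 0 = 0"
  shows "B \<longlonglongrightarrow> 0"
proof -
  obtain C where C: "\<And>N. norm (A N) \<le> C" "C > 0"
    using convergent_imp_Bseq[OF convergentI[OF A]] by (auto simp: Bseq_def)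
  have half: "norm (B (N div r) / of_nat r) \<le> x / 2" if "norm (B (N div r)) \<le> x" for N x
  proof -
    have "norm (B (N div r) / of_nat r) = norm (B (N div r)) / real r" by (simp add: norm_divide)
    also have "\<dots> \<le> x / 2" using that r by (intro frac_le) (auto intro: order_trans[OF norm_ge_zero])
    finally show ?thesis .
  qed
  have bounded: "norm (B N) \<le> 2 * C" for N
  proof (induction N rule: less_induct)
    case (less N)
    show ?case
    proof (cases "N = 0")
      case False
      then have "norm (B (N div r)) \<le> 2 * C" using less r by simp
      from half[OF this] show ?thesis
        using C(1)[of N] B[of N] norm_triangle_ineq[of "A N" "B (N div r) / of_nat r"] by simp
    qed (use B0 C in simp)
  qed
  show ?thesis
  proof (rule LIMSEQ_I)
    fix \<epsilon> :: real assume \<epsilon>: "\<epsilon> > 0"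
    have div_at_top: "filterlim (\<lambda>N. N div r) at_top sequentially"
      using r by (intro filterlim_div_at_top) auto
    \<comment> \<open>This bound reproduces itself: half of it plus \<open>\<epsilon> / 4\<close> is
      the bound for \<open>Suc j\<close>.\<close>
    have ev: "\<forall>\<^sub>F N in sequentially. norm (B N) \<le> \<epsilon> / 2 + 2 * C / 2 ^ j" for j
    proof (induction j)
      case 0
      show ?case using bounded \<epsilon> by (intro always_eventually allI) (simp add: add_increasing)
    next
      case (Suc j)
      have "\<forall>\<^sub>F N in sequentially. norm (A N) < \<epsilon> / 4"
        using tendsto_norm_zero[OF A] \<epsilon> by (intro order_tendstoD(2)[of _ 0]) auto
      with eventually_compose_filterlim[OF Suc div_at_top]
      show ?case
      proof eventually_elim
        case (elim N)
        have "norm (B N) \<le> norm (A N) + norm (B (N div r) / of_nat r)"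
          by (subst B) (rule norm_triangle_ineq)
        moreover have "(\<epsilon> / 2 + 2 * C / 2 ^ j) / 2 = \<epsilon> / 4 + 2 * C / 2 ^ Suc j" by simp
        ultimately have "norm (B N) \<le> norm (A N) + (\<epsilon> / 4 + 2 * C / 2 ^ Suc j)"
          using half[OF elim(1)] by (simp only:)
        then show ?case using elim(2) by linarith
      qed
    qed
    have lim: "(\<lambda>j. 2 * C / 2 ^ j) \<longlonglongrightarrow> 0"
      using LIMSEQ_divide_realpow_zero[of 2 "2 * C"] by simp
    obtain j where j: "2 * C / 2 ^ j < \<epsilon> / 2"
      using eventually_happens'[OF sequentially_bot order_tendstoD(2)[OF lim, of "\<epsilon> / 2"]] \<epsilon> by auto
    obtain N0 where N0: "\<And>N. N \<ge> N0 \<Longrightarrow> norm (B N) \<le> \<epsilon> / 2 + 2 * C / 2 ^ j"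
      using ev[of j] unfolding eventually_sequentially by blast
    have "norm (B N - 0) < \<epsilon>" if "N \<ge> N0" for N
      using N0[OF that] j by simp
    then show "\<exists>N0. \<forall>N\<ge>N0. norm (B N - 0) < \<epsilon>" by blast
  qed
qed

lemma sum_over_multiples:
  fixes F :: "nat \<Rightarrow> complex"
  assumes "r > 0"
  shows "(\<Sum>n | n \<in> {1..N} \<and> r dvd n. F n) = (\<Sum>k=1..N div r. F (r * k))"
proof (rule sum.reindex_bij_witness[of _ "\<lambda>k. r * k" "\<lambda>n. n div r"])
  show "n div r \<in> {1..N div r}" if "n \<in> {n \<in> {1..N}. r dvd n}" for n
    using that assms by (auto elim!: dvdE simp: div_le_mono Suc_le_eq)
  show "r * k \<in> {n \<in> {1..N}. r dvd n}" if "k \<in> {1..N div r}" for k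
    using that assms by (auto simp: less_eq_div_iff_mult_less_eq mult.commute Suc_le_eq)
qed (use assms in \<open>auto elim!: dvdE\<close>)

text \<open>The primes of \<open>D\<close> are removed one at a time. In passing from
  \<open>D'\<close> to \<open>D\<close>, the terms n = r j are dropped; they vanish if
  \<open>r\<close> divides j, and otherwise mu(r j) = - mu(j). So they form again a sum for
  \<open>D\<close>, up to \<open>N div r\<close>, which is the recursion of
  \<open>tendsto_zero_scaled_recursion\<close>.\<close>

lemma sum_moebius_mu_coprime_tendsto_0:
  assumes "D > 0"
  shows "(\<lambda>N. \<Sum>n=1..N. (if coprime n D then moebius_mu n else 0) / of_nat n) \<longlonglongrightarrow> 0"
  using assms
proof (induction D rule: less_induct)
  case (less D)
  show ?case
  proof (cases "D = 1")
    case True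
    then show ?thesis using sum_moebius_mu_over_n_tendsto_0 by simp
  next
    case False
    then obtain r where r: "prime r" "r dvd D" using prime_factor_nat by blast
    define k where "k = multiplicity r D"
    obtain D' where D': "D = r ^ k * D'" "\<not> r dvd D'"
      unfolding k_def using less.prems r by (metis multiplicity_decompose' not_prime_unit not_gr0)
    have k: "k > 0" using r less.prems by (simp add: k_def prime_multiplicity_gt_zero_iff)
    have "D' > 0" using D' less.prems by (auto intro!: Nat.gr0I)
    have r2: "r \<ge> 2" using r(1) by (simp add: prime_ge_2_nat)
    have "r ^ k > 1" using r2 k by (intro one_less_power) auto
    then have "D' < D" using D'(1) \<open>D' > 0\<close> by simp
    have cop: "coprime n D \<longleftrightarrow> coprime n D' \<and> \<not> r dvd n" for n
    proof -
      have "coprime n r \<longleftrightarrow> \<not> r dvd n"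
        by (metis coprime_commute prime_imp_coprime coprime_absorb_left not_prime_unit r(1))
      then show ?thesis using D'(1) k by auto
    qed
    define A where "A = (\<lambda>N. \<Sum>n=1..N. (if coprime n D' then moebius_mu n else 0) / of_nat n)"
    define B where "B = (\<lambda>N. \<Sum>n=1..N. (if coprime n D then moebius_mu n else 0) / of_nat n)"
    have A0: "A \<longlonglongrightarrow> 0" unfolding A_def by (rule less.IH[OF \<open>D' < D\<close> \<open>D' > 0\<close>])
    have "B N = A N + B (N div r) / of_nat r" for N
    proof -
      have "A N - B N = (\<Sum>n=1..N. if r dvd n then (if coprime n D' then moebius_mu n else 0) / of_nat n else 0)"
        unfolding A_def B_def sum_subtractf[symmetric] by (intro sum.cong) (auto simp: cop)
      also have "\<dots> = (\<Sum>n | n \<in> {1..N} \<and> r dvd n. (if coprime n D' then moebius_mu n else 0) / of_nat n)"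
        by (rule sum.inter_filter[symmetric]) simp
      also have "\<dots> = (\<Sum>k=1..N div r. (if coprime (r * k) D' then moebius_mu (r * k) else 0) / of_nat (r * k))"
        using r2 by (intro sum_over_multiples) auto
      also have "\<dots> = (\<Sum>k=1..N div r. - ((if coprime k D then moebius_mu k else 0) / of_nat k) / of_nat r)"
      proof (intro sum.cong refl)
        fix k
        have "coprime r D'" using D'(2) r(1) by (simp add: prime_imp_coprime)
        then have c: "coprime (r * k) D' \<longleftrightarrow> coprime k D'" by simp
        show "(if coprime (r * k) D' then moebius_mu (r * k) else 0) / of_nat (r * k)
            = - ((if coprime k D then moebius_mu k else 0) / of_nat k) / of_nat r"
        proof (cases "r dvd k")
          case True
          then have "r\<^sup>2 dvd r * k" by (simp add: power2_eq_square)
          then have "moebius_mu (r * k) = 0"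
            using r(1) not_squarefreeI[of r "r * k"] not_prime_unit by (auto simp: moebius_mu_def)
          then show ?thesis using True by (simp add: cop)
        next
          case False
          then show ?thesis
            using r(1) unfolding c by (simp add: cop moebius_mu_mult_coprime prime_imp_coprime moebius_mu_prime)
        qed
      qed
      also have "\<dots> = - (B (N div r) / of_nat r)"
        by (simp add: B_def sum_negf sum_divide_distrib)
      finally show ?thesis by (simp add: algebra_simps)
    qed
    moreover have "B 0 = 0" by (simp add: B_def)
    ultimately have "B \<longlonglongrightarrow> 0" by (rule tendsto_zero_scaled_recursion[OF A0 r2])
    then show ?thesis unfolding B_def .
  qed
qed

text \<open>Both sides run over \<open>t * s \<le> x\<close> with \<open>t > T\<close>; the smallest
  \<open>t\<close> is \<open>Suc T\<close>, whence the range of \<open>s\<close>.\<close>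

lemma sum_hyperbola_swap:
  fixes F :: "nat \<Rightarrow> nat \<Rightarrow> complex"
  shows "(\<Sum>t=Suc T..x. \<Sum>s=1..x div t. F t s) = (\<Sum>s=1..x div Suc T. \<Sum>t=Suc T..x div s. F t s)"
proof -
  have "(\<Sum>t=Suc T..x. \<Sum>s=1..x div t. F t s)
      = (\<Sum>t=Suc T..x. \<Sum>s | s \<in> {1..x div Suc T} \<and> t * s \<le> x. F t s)"
  proof (intro sum.cong refl)
    fix t assume t: "t \<in> {Suc T..x}"
    have "s \<le> x div Suc T" if "t * s \<le> x" for s
    proof -
      have "Suc T * s \<le> t * s" using t by (intro mult_le_mono1) simp
      then have "s * Suc T \<le> t * s" by (simp only: mult.commute)
      then show ?thesis using that by (simp add: less_eq_div_iff_mult_less_eq)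
    qed
    then show "{1..x div t} = {s. s \<in> {1..x div Suc T} \<and> t * s \<le> x}"
      using t by (auto simp: less_eq_div_iff_mult_less_eq mult.commute)
  qed
  also have "\<dots> = (\<Sum>s=1..x div Suc T. \<Sum>t | t \<in> {Suc T..x} \<and> t * s \<le> x. F t s)"
    by (rule sum.swap_restrict) auto
  also have "\<dots> = (\<Sum>s=1..x div Suc T. \<Sum>t=Suc T..x div s. F t s)"
  proof (intro sum.cong refl)
    fix s assume s: "s \<in> {1..x div Suc T}"
    have "t \<le> x" if "t * s \<le> x" for t
      using that s by (metis atLeastAtMost_iff dual_order.trans le_square mult_le_mono2 nat_mult_1_right)
    then show "{t. t \<in> {Suc T..x} \<and> t * s \<le> x} = {Suc T..x div s}"
      using s by (auto simp: less_eq_div_iff_mult_less_eq)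
  qed
  finally show ?thesis .
qed

lemma sum_divisors_swap:
  fixes F :: "nat \<Rightarrow> nat \<Rightarrow> complex"
  shows "(\<Sum>n=1..x. \<Sum>d | d dvd n. F d (n div d)) = (\<Sum>d=1..x. \<Sum>m=1..x div d. F d m)"
proof -
  have "(\<Sum>n=1..x. \<Sum>d | d dvd n. F d (n div d)) = (\<Sum>(n, d)\<in>(SIGMA n:{1..x}. {d. d dvd n}). F d (n div d))"
    by (rule sum.Sigma) auto
  also have "\<dots> = (\<Sum>(d, m)\<in>(SIGMA d:{1..x}. {1..x div d}). F d m)"
  proof (rule sum.reindex_bij_witness[of _ "\<lambda>(d, m). (d * m, d)" "\<lambda>(n, d). (d, n div d)"])
    show "(case a of (n, d) \<Rightarrow> (d, n div d)) \<in> (SIGMA d:{1..x}. {1..x div d})"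
      if "a \<in> (SIGMA n:{1..x}. {d. d dvd n})" for a
      using that by (auto elim!: dvdE simp: Suc_le_eq less_eq_div_iff_mult_less_eq mult.commute)
        (metis dual_order.trans mult_le_mono2 nat_mult_1_right Suc_leI One_nat_def)
    show "(case b of (d, m) \<Rightarrow> (d * m, d)) \<in> (SIGMA n:{1..x}. {d. d dvd n})"
      if "b \<in> (SIGMA d:{1..x}. {1..x div d})" for b
      using that by (auto simp: less_eq_div_iff_mult_less_eq mult.commute Suc_le_eq)
  qed (auto elim!: dvdE)
  also have "\<dots> = (\<Sum>d=1..x. \<Sum>m=1..x div d. F d m)"
    by (rule sum.Sigma[symmetric]) auto
  finally show ?thesis .
qed

lemma norm_sum_over_n_le:
  fixes u :: "nat \<Rightarrow> complex"
  assumes B: "\<And>y. norm (\<Sum>t=1..y. u t) \<le> B"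
  shows "norm (\<Sum>t=Suc T..y. u t / of_nat t) \<le> 2 * B / real (Suc T)"
proof (cases "T \<le> y")
  case True
  let ?U = "\<lambda>y. \<Sum>t=1..y. u t"
  have B0: "B \<ge> 0" using B[of 0] by simp
  \<comment> \<open>Subtracting the boundary term turns Abel summation into an induction on
    \<open>y\<close>: each step adds \<open>?U (Suc y)\<close> times a difference of reciprocals,
    and these differences telescope.\<close>
  have "norm ((\<Sum>t=Suc T..y. u t / of_nat t) - ?U y / of_nat (Suc y))
     \<le> B / real (Suc T) + B * (1 / real (Suc T) - 1 / real (Suc y))"
    using True
  proof (induction y rule: dec_induct)
    case base
    have "norm (?U T) / real (Suc T) \<le> B / real (Suc T)"
      by (intro divide_right_mono B) auto
    then show ?case by (simp add: norm_divide del: of_nat_Suc)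
  next
    case (step y)
    have "(\<Sum>t=Suc T..Suc y. u t / of_nat t) - ?U (Suc y) / of_nat (Suc (Suc y))
       = ((\<Sum>t=Suc T..y. u t / of_nat t) - ?U y / of_nat (Suc y))
         + ?U (Suc y) * of_real (1 / real (Suc y) - 1 / real (Suc (Suc y)))"
      using step by (simp add: algebra_simps add_divide_distrib del: of_nat_Suc)
    also have "norm \<dots> \<le> (B / real (Suc T) + B * (1 / real (Suc T) - 1 / real (Suc y)))
         + B * (1 / real (Suc y) - 1 / real (Suc (Suc y)))"
    proof (rule norm_triangle_mono[OF step.IH])
      have "1 / real (Suc y) - 1 / real (Suc (Suc y)) \<ge> 0" by (simp add: field_simps)
      then show "norm (?U (Suc y) * of_real (1 / real (Suc y) - 1 / real (Suc (Suc y))))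
          \<le> B * (1 / real (Suc y) - 1 / real (Suc (Suc y)))"
        unfolding norm_mult norm_of_real using B[of "Suc y"] B0 by (intro mult_mono) auto
    qed
    finally show ?case by (simp add: algebra_simps del: of_nat_Suc)
  qed
  moreover have "norm (?U y / of_nat (Suc y)) \<le> B / real (Suc y)"
    unfolding norm_divide using B by (simp add: divide_right_mono del: of_nat_Suc)
  ultimately have "norm (\<Sum>t=Suc T..y. u t / of_nat t)
      \<le> B / real (Suc T) + B * (1 / real (Suc T) - 1 / real (Suc y)) + B / real (Suc y)"
    using norm_triangle_sub[of "\<Sum>t=Suc T..y. u t / of_nat t" "?U y / of_nat (Suc y)"] by linarith
  then show ?thesis by (simp add: algebra_simps del: of_nat_Suc)
next
  case False
  then show ?thesis using B[of 0] by simp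
qed

text \<open>The hyperbola method, cut at \<open>T\<close>. For \<open>t > T\<close> the inner sum
  over \<open>t\<close> is a difference \<open>R T - R (x div s)\<close> of remainders of the series
  of \<open>u t / t\<close>, and \<open>R y\<close> is of order \<open>B / y\<close>. The first
  remainder is summed against \<open>v s / s\<close> with the bound \<open>K\<close>, the second
  term by term.\<close>

lemma norm_sum_dirichlet_convolution_le:
  fixes u v :: "nat \<Rightarrow> complex"
  assumes u: "\<And>y. norm (\<Sum>t=1..y. u t) \<le> B" and v: "\<And>s. norm (v s) \<le> 1"
    and K: "\<And>y. norm (\<Sum>s=1..y. v s / of_nat s) \<le> K"
  shows "norm (\<Sum>n=1..x. (\<Sum>t | t dvd n. u t * v (n div t)) / of_nat n)
    \<le> (\<Sum>t=1..T. norm (u t / of_nat t) * norm (\<Sum>s=1..x div t. v s / of_nat s)) + 2 * B * (K + 1) / real (Suc T)"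
proof -
  let ?u = "\<lambda>t. u t / of_nat t" and ?v = "\<lambda>s. v s / of_nat s"
  let ?P = "\<lambda>y. \<Sum>t=1..y. ?u t" and ?N = "\<lambda>y. \<Sum>s=1..y. ?v s"
  have B0: "B \<ge> 0" and K0: "K \<ge> 0" using u[of 0] K[of 0] by auto
  have tail: "norm (?P z - ?P y) \<le> 2 * B / real (Suc y)" if "y \<le> z" for y z
  proof -
    have "?P z = ?P y + (\<Sum>t=Suc y..z. ?u t)"
      using that sum.ub_add_nat[of 1 y ?u "z - y"] by simp
    then show ?thesis using norm_sum_over_n_le[OF u, of y z] by simp
  qed
  have "Cauchy ?P"
  proof (rule metric_CauchyI)
    fix e :: real assume e: "e > 0"
    obtain M where M: "2 * B / e < real M" using reals_Archimedean2 by blast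
    have *: "dist (?P m) (?P n) < e" if "M \<le> m" "m \<le> n" for m n
    proof -
      have "2 * B / real (Suc m) < e"
        using M that e by (simp add: field_simps) (smt (verit) mult_left_mono of_nat_mono)
      then show ?thesis
        using tail[OF that(2)] by (simp add: dist_norm norm_minus_commute del: of_nat_Suc)
    qed
    then show "\<exists>M. \<forall>m\<ge>M. \<forall>n\<ge>M. dist (?P m) (?P n) < e"
      by (metis dist_commute nat_le_linear)
  qed
  then obtain L where L: "?P \<longlonglongrightarrow> L" using Cauchy_convergent convergent_def by blast
  define R where "R = (\<lambda>y. L - ?P y)"
  have R: "norm (R y) \<le> 2 * B / real (Suc y)" for y
  proof -
    have "(\<lambda>z. ?P z - ?P y) \<longlonglongrightarrow> R y" unfolding R_def by (intro tendsto_diff L tendsto_const)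
    then show ?thesis
      by (rule Lim_norm_ubound[rotated])
         (use tail in \<open>auto simp: eventually_sequentially simp del: of_nat_Suc intro!: exI[of _ y]\<close>)
  qed
  have "(\<Sum>n=1..x. (\<Sum>t | t dvd n. u t * v (n div t)) / of_nat n)
      = (\<Sum>n=1..x. \<Sum>t | t dvd n. ?u t * ?v (n div t))"
    unfolding sum_divide_distrib
    by (intro sum.cong refl) (auto elim!: dvdE simp: field_simps)
  also have "\<dots> = (\<Sum>t=1..x. \<Sum>s=1..x div t. ?u t * ?v s)"
    by (rule sum_divisors_swap)
  also have "\<dots> = (\<Sum>t=1..T. \<Sum>s=1..x div t. ?u t * ?v s) + (\<Sum>t=Suc T..x. \<Sum>s=1..x div t. ?u t * ?v s)"
  proof (cases "T \<le> x")
    case True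
    then show ?thesis using sum.ub_add_nat[of 1 T _ "x - T"] by simp
  next
    case False
    have "(\<Sum>t=1..x. \<Sum>s=1..x div t. ?u t * ?v s) = (\<Sum>t=1..T. \<Sum>s=1..x div t. ?u t * ?v s)"
      using False by (intro sum.mono_neutral_left) auto
    then show ?thesis using False by simp
  qed
  also have "(\<Sum>t=Suc T..x. \<Sum>s=1..x div t. ?u t * ?v s) = (\<Sum>s=1..x div Suc T. \<Sum>t=Suc T..x div s. ?u t * ?v s)"
    by (rule sum_hyperbola_swap)
  also have "\<dots> = (\<Sum>s=1..x div Suc T. ?v s * (R T - R (x div s)))"
  proof (intro sum.cong refl)
    fix s assume "s \<in> {1..x div Suc T}"
    then have "Suc T \<le> x div s" by (auto simp: less_eq_div_iff_mult_less_eq mult.commute)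
    then have "?P (x div s) = ?P T + (\<Sum>t=Suc T..x div s. ?u t)"
      using sum.ub_add_nat[of 1 T ?u "x div s - T"] by simp
    then have "(\<Sum>t=Suc T..x div s. ?u t) = R T - R (x div s)" by (simp add: R_def)
    then show "(\<Sum>t=Suc T..x div s. ?u t * ?v s) = ?v s * (R T - R (x div s))"
      by (simp only: sum_distrib_right[symmetric] mult.commute)
  qed
  also have "\<dots> = R T * ?N (x div Suc T) - (\<Sum>s=1..x div Suc T. ?v s * R (x div s))"
    by (simp add: right_diff_distrib sum_subtractf sum_distrib_left mult.commute)
  finally have eq: "(\<Sum>n=1..x. (\<Sum>t | t dvd n. u t * v (n div t)) / of_nat n)
    = (\<Sum>t=1..T. \<Sum>s=1..x div t. ?u t * ?v s) + (R T * ?N (x div Suc T) - (\<Sum>s=1..x div Suc T. ?v s * R (x div s)))" .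
  have "norm (\<Sum>t=1..T. \<Sum>s=1..x div t. ?u t * ?v s) \<le> (\<Sum>t=1..T. norm (?u t) * norm (?N (x div t)))"
    by (rule sum_norm_le) (simp only: sum_distrib_left[symmetric] norm_mult order_refl)
  moreover have "norm (R T * ?N (x div Suc T)) \<le> 2 * B / real (Suc T) * K"
    unfolding norm_mult using R[of T] K B0 by (intro mult_mono) auto
  moreover have "norm (\<Sum>s=1..x div Suc T. ?v s * R (x div s)) \<le> 2 * B / real (Suc T)"
  proof -
    \<comment> \<open>Since \<open>s * Suc (x div s) > x\<close>, every term is at most
      \<open>2 * B / x\<close>, and there are \<open>x div Suc T\<close> terms.\<close>
    have "norm (\<Sum>s=1..x div Suc T. ?v s * R (x div s)) \<le> (\<Sum>s=1..x div Suc T. 2 * B / real x)"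
    proof (rule sum_norm_le)
      fix s assume s: "s \<in> {1..x div Suc T}"
      then have s0: "s > 0" "x > 0" by (auto intro!: Nat.gr0I)
      have "x < s * Suc (x div s)" using s0 by (simp add: dividend_less_times_div)
      then have xs: "real x \<le> real s * real (Suc (x div s))"
        by (metis less_imp_le of_nat_le_iff of_nat_mult)
      have "norm (?v s * R (x div s)) \<le> (1 / real s) * (2 * B / real (Suc (x div s)))"
        unfolding norm_mult norm_divide using v[of s] R[of "x div s"] s0
        by (intro mult_mono) (auto simp: divide_right_mono simp del: of_nat_Suc)
      also have "\<dots> = 2 * B / (real s * real (Suc (x div s)))" by simp
      also have "\<dots> \<le> 2 * B / real x"
        using xs s0 B0 by (intro divide_left_mono) auto
      finally show "norm (?v s * R (x div s)) \<le> 2 * B / real x" .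
    qed
    also have "\<dots> = real (x div Suc T) * (2 * B / real x)" by simp
    also have "\<dots> \<le> 2 * B / real (Suc T)"
    proof (cases "x = 0")
      case False
      have "real (x div Suc T) * real (Suc T) \<le> real x"
        by (metis div_times_less_eq_dividend of_nat_le_iff of_nat_mult)
      then have "real (x div Suc T) \<le> real x / real (Suc T)"
        by (simp add: pos_le_divide_eq del: of_nat_Suc)
      then have "real (x div Suc T) * (2 * B / real x) \<le> real x / real (Suc T) * (2 * B / real x)"
        using B0 by (intro mult_right_mono) auto
      then show ?thesis using False by simp
    qed (use B0 in simp)
    finally show ?thesis .
  qed
  moreover have "2 * B * (K + 1) / real (Suc T) = 2 * B / real (Suc T) * K + 2 * B / real (Suc T)"
    by (simp add: field_simps del: of_nat_Suc)
  ultimately show ?thesis unfolding eq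
    using norm_triangle_ineq[of "\<Sum>t=1..T. \<Sum>s=1..x div t. ?u t * ?v s" "R T * ?N (x div Suc T) - (\<Sum>s=1..x div Suc T. ?v s * R (x div s))"]
      norm_triangle_ineq4[of "R T * ?N (x div Suc T)" "\<Sum>s=1..x div Suc T. ?v s * R (x div s)"]
    by linarith
qed

text \<open>\<open>T\<close> is fixed first, to make the second part of the bound small; then the
  first part, a sum of \<open>T\<close> terms, tends to 0, because \<open>x div t\<close> grows for
  each \<open>t\<close>.\<close>

lemma sum_dirichlet_convolution_tendsto_0:
  fixes u v :: "nat \<Rightarrow> complex"
  assumes u: "\<And>y. norm (\<Sum>t=1..y. u t) \<le> B" and v: "\<And>s. norm (v s) \<le> 1"
    and v0: "(\<lambda>y. \<Sum>s=1..y. v s / of_nat s) \<longlonglongrightarrow> 0"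
  shows "(\<lambda>x. \<Sum>n=1..x. (\<Sum>t | t dvd n. u t * v (n div t)) / of_nat n) \<longlonglongrightarrow> 0"
proof (rule LIMSEQ_I)
  fix \<epsilon> :: real assume \<epsilon>: "\<epsilon> > 0"
  obtain K where K: "\<And>y. norm (\<Sum>s=1..y. v s / of_nat s) \<le> K"
    using convergent_imp_Bseq[OF convergentI[OF v0]] by (auto simp: Bseq_def)
  obtain T where T: "4 * B * (K + 1) / \<epsilon> < real T" using reals_Archimedean2 by blast
  have T': "2 * B * (K + 1) / real (Suc T) < \<epsilon> / 2"
    using T \<epsilon> by (simp add: field_simps) 
  have div_at_top: "filterlim (\<lambda>x. x div t) at_top sequentially" if "t \<in> {1..T}" for t
    using that by (intro filterlim_div_at_top) auto
  have "(\<lambda>x. \<Sum>t=1..T. norm (u t / of_nat t) * norm (\<Sum>s=1..x div t. v s / of_nat s))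
     \<longlonglongrightarrow> (\<Sum>t=1..T. norm (u t / of_nat t) * norm (0 :: complex))"
    by (intro tendsto_intros filterlim_compose[OF v0 div_at_top]) auto
  then have "\<forall>\<^sub>F x in sequentially. (\<Sum>t=1..T. norm (u t / of_nat t) * norm (\<Sum>s=1..x div t. v s / of_nat s)) < \<epsilon> / 2"
    using \<epsilon> by (intro order_tendstoD(2)) auto
  then show "\<exists>N0. \<forall>x\<ge>N0. norm ((\<Sum>n=1..x. (\<Sum>t | t dvd n. u t * v (n div t)) / of_nat n) - 0) < \<epsilon>"
    unfolding eventually_sequentially
  proof (elim exE, intro exI allI impI)
    fix N0 x assume "\<forall>x\<ge>N0. (\<Sum>t=1..T. norm (u t / of_nat t) * norm (\<Sum>s=1..x div t. v s / of_nat s)) < \<epsilon> / 2" "x \<ge> N0"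
    then have "(\<Sum>t=1..T. norm (u t / of_nat t) * norm (\<Sum>s=1..x div t. v s / of_nat s)) < \<epsilon> / 2" by blast
    then show "norm ((\<Sum>n=1..x. (\<Sum>t | t dvd n. u t * v (n div t)) / of_nat n) - 0) < \<epsilon>"
      using norm_sum_dirichlet_convolution_le[OF u v K, of x T] T' by simp
  qed
qed

section \<open>Square-full numbers and composition with the square-free kernel\<close>

definition squarefull :: "nat \<Rightarrow> bool" where
  "squarefull n \<longleftrightarrow> (\<forall>p. prime p \<longrightarrow> p dvd n \<longrightarrow> p\<^sup>2 dvd n)"

lemma squarefull_prime_power_mult_iff:
  assumes r: "prime r" and v: "\<not> r dvd v"
  shows "squarefull (r ^ j * v) \<longleftrightarrow> j \<noteq> 1 \<and> squarefull v"
proof (intro iffI conjI)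
  assume sf: "squarefull (r ^ j * v)"
  show "j \<noteq> 1"
  proof
    assume "j = 1"
    then have "r\<^sup>2 dvd r * v" using sf r by (auto simp: squarefull_def)
    then show False using v r by (auto simp: power2_eq_square)
  qed
  show "squarefull v"
    unfolding squarefull_def
  proof (intro allI impI)
    fix p assume p: "prime p" "p dvd v"
    then have "p\<^sup>2 dvd r ^ j * v" using sf by (auto simp: squarefull_def)
    moreover have "p \<noteq> r" using p v by auto
    then have "coprime (p\<^sup>2) (r ^ j)" using p r by (simp add: primes_coprime)
    ultimately show "p\<^sup>2 dvd v" by (simp add: coprime_dvd_mult_right_iff)
  qed
next
  assume "j \<noteq> 1 \<and> squarefull v"
  then have j: "j \<noteq> 1" and sf: "squarefull v" by auto
  show "squarefull (r ^ j * v)"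
    unfolding squarefull_def
  proof (intro allI impI)
    fix p assume p: "prime p" "p dvd r ^ j * v"
    show "p\<^sup>2 dvd r ^ j * v"
    proof (cases "p dvd v")
      case True
      then show ?thesis using sf p by (auto simp: squarefull_def)
    next
      case False
      then have "p dvd r ^ j" using p by (simp add: prime_dvd_mult_iff)
      then have "p dvd r" using p(1) prime_dvd_power by blast
      then have "p = r" using p(1) r primes_dvd_imp_eq by blast
      have "j > 0" using \<open>p dvd r ^ j\<close> p(1) not_prime_unit by (auto intro!: Nat.gr0I)
      then show ?thesis using j \<open>p = r\<close> by (simp add: le_imp_power_dvd)
    qed
  qed
qed

text \<open>\<open>j\<close> is the exponent of \<open>r\<close> in the divisor; 1 is the one
  exponent that a square-full number cannot have.\<close>

lemma sum_squarefull_divisors: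
  fixes F :: "nat \<Rightarrow> complex"
  assumes r: "prime r" and n': "\<not> r dvd n'" "n' > 0"
  shows "(\<Sum>v | v dvd r ^ a * n' \<and> squarefull v. F v)
    = (\<Sum>j\<in>{..a} - {1}. \<Sum>v | v dvd n' \<and> squarefull v. F (r ^ j * v))"
proof -
  let ?V = "{v. v dvd n' \<and> squarefull v}" and ?f = "\<lambda>(j, v). r ^ j * v"
  have nr: "\<not> r dvd v" if "v \<in> ?V" for v using that n'(1) dvd_trans by blast
  have mult: "multiplicity r (r ^ j * v) = j" if "\<not> r dvd v" for j v
    using that r by (metis multiplicity_prime_elem_times_other multiplicity_same_power not_dvd_imp_multiplicity_0
        not_prime_unit prime_elem_multiplicity_mult_distrib dvd_0_right add.right_neutral power_not_zero prime_imp_prime_elem not_prime_0)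
  have inj: "inj_on ?f (({..a} - {1}) \<times> ?V)"
  proof (rule inj_onI)
    fix x y assume xy: "x \<in> ({..a} - {1}) \<times> ?V" "y \<in> ({..a} - {1}) \<times> ?V" "?f x = ?f y"
    obtain j v k w where jv: "x = (j, v)" "y = (k, w)" by fastforce
    have eq: "r ^ j * v = r ^ k * w" using xy jv by simp
    have "j = k" using mult[of v j] mult[of w k] nr[of v] nr[of w] xy jv by auto
    then show "x = y" using eq r jv by auto
  qed
  have "?f ` (({..a} - {1}) \<times> ?V) = {v. v dvd r ^ a * n' \<and> squarefull v}"
  proof (intro equalityI subsetI)
    fix x assume "x \<in> ?f ` (({..a} - {1}) \<times> ?V)"
    then obtain j v where x: "x = r ^ j * v" "j \<le> a" "j \<noteq> 1" "v \<in> ?V" by auto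
    then show "x \<in> {v. v dvd r ^ a * n' \<and> squarefull v}"
      using nr[of v] r by (auto simp: squarefull_prime_power_mult_iff mult_dvd_mono le_imp_power_dvd)
  next
    fix x assume x: "x \<in> {v. v dvd r ^ a * n' \<and> squarefull v}"
    have "r ^ a * n' \<noteq> 0" using n'(2) r by auto
    then have "x \<noteq> 0" using x by (metis dvd_0_left_iff mem_Collect_eq)
    then obtain v where v: "x = r ^ multiplicity r x * v" "\<not> r dvd v"
      using r by (metis multiplicity_decompose' not_prime_unit)
    define j where "j = multiplicity r x"
    have xv: "x = r ^ j * v" using v by (simp add: j_def)
    have sf: "j \<noteq> 1" "squarefull v"
      using x squarefull_prime_power_mult_iff[OF r v(2), of j] by (auto simp: xv)
    have "coprime v (r ^ a)" using v(2) r by (simp add: prime_imp_coprime coprime_commute)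
    moreover have "v dvd r ^ a * n'" using x xv dvd_mult_right by auto
    ultimately have "v dvd n'" by (simp add: coprime_dvd_mult_right_iff)
    have "r ^ j dvd r ^ a * n'" using x xv dvd_mult_left by auto
    moreover have "coprime (r ^ j) n'" using n'(1) r by (simp add: prime_imp_coprime)
    ultimately have "r ^ j dvd r ^ a" by (simp add: coprime_dvd_mult_left_iff)
    then have "j \<le> a" using r by (metis power_dvd_imp_le prime_gt_1_nat)
    then show "x \<in> ?f ` (({..a} - {1}) \<times> ?V)" using xv sf \<open>v dvd n'\<close> by auto
  qed
  then have "(\<Sum>v | v dvd r ^ a * n' \<and> squarefull v. F v) = (\<Sum>x\<in>({..a} - {1}) \<times> ?V. F (?f x))"
    using sum.reindex[OF inj, of F] by (simp add: o_def)
  also have "\<dots> = (\<Sum>j\<in>{..a} - {1}. \<Sum>v | v dvd n' \<and> squarefull v. F (r ^ j * v))"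
    by (simp add: sum.cartesian_product case_prod_unfold)
  finally show ?thesis .
qed

text \<open>
  For completely multiplicative \<open>u\<close> the local factor of \<open>u \<circ> \<kappa>\<close> at a prime, with \<open>u\<close> also denoting the
  value there, is \<open>(1 - u x)\<^sup>-\<^sup>1 (1 + u (1 - u) x\<^sup>2 / (1 - x))\<close>, and the second factor is supported on
  square-full numbers. Read as a formal identity, this makes sense for every \<open>u\<close>.
\<close>

lemma kernel_eq_sum_squarefull:
  fixes u :: "nat \<Rightarrow> complex"
  assumes "n > 0"
  shows "u (sqfree_kernel n) = (\<Sum>v | v dvd n \<and> squarefull v. \<Sum>i | i dvd sqfree_kernel v.
     moebius_mu i * u (n div v * (sqfree_kernel v * i)))"
  using assms
proof (induction n arbitrary: u rule: less_induct)
  case (less n)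
  show ?case
  proof (cases "n = 1")
    case True
    have "{v::nat. v dvd Suc 0 \<and> squarefull v} = {Suc 0}" by (auto simp: squarefull_def)
    then show ?thesis using True by simp
  next
    case False
    then obtain r where r: "prime r" "r dvd n" using prime_factor_nat by blast
    define a where "a = multiplicity r n"
    obtain n' where n': "n = r ^ a * n'" "\<not> r dvd n'"
      unfolding a_def using less.prems r by (metis multiplicity_decompose' not_prime_unit not_gr0)
    have a: "a > 0" using r less.prems by (simp add: a_def prime_multiplicity_gt_zero_iff)
    have n'0: "n' > 0" using n' less.prems by (auto intro!: Nat.gr0I)
    have r1: "r > 1" using r(1) prime_gt_1_nat by blast
    have "n' < n" using n'(1) n'0 one_less_power[OF r1 a] by simp
    let ?V = "{v. v dvd n' \<and> squarefull v}"
    \<comment> \<open>The summand with the exponent of \<open>r\<close> changed to \<open>k\<close>;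
      the goal is \<open>U 1\<close>. The induction hypothesis is applied to
      \<open>u (r ^ k * x)\<close> as a function of \<open>x\<close>, hence \<open>u\<close> is
      arbitrary in the induction.\<close>
    define U where "U = (\<lambda>k. u (r ^ k * sqfree_kernel n'))"
    have U: "U k = (\<Sum>v\<in>?V. \<Sum>i | i dvd sqfree_kernel v. moebius_mu i * u (r ^ k * (n' div v * (sqfree_kernel v * i))))" for k
      unfolding U_def using less.IH[OF \<open>n' < n\<close> n'0, of "\<lambda>x. u (r ^ k * x)"] by simp
    define F where "F = (\<lambda>v. \<Sum>i | i dvd sqfree_kernel v. moebius_mu i * u (n div v * (sqfree_kernel v * i)))"
    have v: "v > 0" "\<not> r dvd v" "n div (r ^ j * v) = r ^ (a - j) * (n' div v)" if "v \<in> ?V" "j \<le> a" for v j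
    proof -
      show v0: "v > 0" using that n'0 by (auto intro!: Nat.gr0I)
      show "\<not> r dvd v" using that n'(2) dvd_trans by blast
      have "r ^ a = r ^ j * r ^ (a - j)" using that by (simp add: power_add[symmetric])
      then have "n = (r ^ j * v) * (r ^ (a - j) * (n' div v))" using n'(1) that by simp
      then show "n div (r ^ j * v) = r ^ (a - j) * (n' div v)" using v0 r1 by simp
    qed
    have F0: "(\<Sum>v\<in>?V. F (r ^ 0 * v)) = U a"
      unfolding U
    proof (rule sum.cong[OF refl])
      fix w assume "w \<in> ?V"
      from v(3)[OF this, of 0]
      show "F (r ^ 0 * w) = (\<Sum>i | i dvd sqfree_kernel w. moebius_mu i * u (r ^ a * (n' div w * (sqfree_kernel w * i))))"
        unfolding F_def by (simp add: mult.assoc)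
    qed
    \<comment> \<open>For \<open>j \<ge> 2\<close> the kernel of \<open>r ^ j * v\<close> gains a
      factor \<open>r\<close>, and pairing \<open>i\<close> with \<open>r * i\<close> leaves the
      exponents \<open>a - j + 1\<close> and \<open>a - j + 2\<close> of \<open>r\<close>, with
      opposite signs.\<close>
    have Fj: "(\<Sum>v\<in>?V. F (r ^ j * v)) = U (Suc a - j) - U (Suc a - (j - 1))" if j: "j \<in> {Suc 1..a}" for j
    proof -
      have "F (r ^ j * v) = (\<Sum>i | i dvd sqfree_kernel v. moebius_mu i * u (r ^ (Suc a - j) * (n' div v * (sqfree_kernel v * i))))
         - (\<Sum>i | i dvd sqfree_kernel v. moebius_mu i * u (r ^ (Suc a - (j - 1)) * (n' div v * (sqfree_kernel v * i))))"
        if vV: "v \<in> ?V" for v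
      proof -
        have ja: "j \<le> a" "j > 0" using j by auto
        note v = v[OF vV ja(1)]
        have cop: "coprime r v" using v r by (simp add: prime_imp_coprime)
        then have kr: "sqfree_kernel (r ^ j * v) = r * sqfree_kernel v"
          using v ja r r1 by (simp add: sqfree_kernel_mult_coprime sqfree_kernel_prime_power)
        have nrk: "\<not> r dvd sqfree_kernel v" using v r by (simp add: prime_dvd_sqfree_kernel_iff)
        have idx: "{i. i dvd r * sqfree_kernel v \<and> \<not> r dvd i} = {i. i dvd sqfree_kernel v}"
        proof (intro Collect_cong iffI conjI)
          fix i assume "i dvd r * sqfree_kernel v \<and> \<not> r dvd i"
          moreover then have "coprime i r"
            using r(1) prime_imp_coprime coprime_commute by blast
          ultimately show "i dvd sqfree_kernel v" by (simp add: coprime_dvd_mult_right_iff)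
        qed (use nrk dvd_trans in auto)
        have e: "r ^ (a - j) * r = r ^ (Suc a - j)" "r ^ (a - j) * r * r = r ^ (Suc a - (j - 1))"
        proof -
          have "Suc a - j = Suc (a - j)" "Suc a - (j - 1) = Suc (Suc (a - j))" using ja by auto
          then show "r ^ (a - j) * r = r ^ (Suc a - j)" "r ^ (a - j) * r * r = r ^ (Suc a - (j - 1))"
            by (simp_all add: mult_ac)
        qed
        have "F (r ^ j * v) = (\<Sum>i | i dvd r * sqfree_kernel v. moebius_mu i * u (r ^ (a - j) * (n' div v) * (r * sqfree_kernel v * i)))"
          by (simp add: F_def kr v)
        also have "\<dots> = (\<Sum>i | i dvd r * sqfree_kernel v \<and> \<not> r dvd i. moebius_mu i *
           (u (r ^ (a - j) * (n' div v) * (r * sqfree_kernel v * i)) - u (r ^ (a - j) * (n' div v) * (r * sqfree_kernel v * (r * i)))))"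
          using r(1) r1 by (intro sum_moebius_mu_prime_split) auto
        also have "\<dots> = (\<Sum>i | i dvd sqfree_kernel v. moebius_mu i *
           (u (r ^ (Suc a - j) * (n' div v * (sqfree_kernel v * i))) - u (r ^ (Suc a - (j - 1)) * (n' div v * (sqfree_kernel v * i)))))"
          unfolding idx e[symmetric] by (simp only: mult_ac)
        finally show ?thesis by (simp only: right_diff_distrib sum_subtractf)
      qed
      then show ?thesis unfolding U by (simp only: sum_subtractf[symmetric] cong: sum.cong)
    qed
    have "(\<Sum>v | v dvd n \<and> squarefull v. F v) = (\<Sum>j\<in>{..a} - {1}. \<Sum>v\<in>?V. F (r ^ j * v))"
      unfolding n'(1) by (rule sum_squarefull_divisors[OF r(1) n'(2) n'0])
    also have "{..a} - {1} = insert 0 {Suc 1..a}" by auto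
    also have "(\<Sum>j\<in>insert 0 {Suc 1..a}. \<Sum>v\<in>?V. F (r ^ j * v))
       = (\<Sum>v\<in>?V. F (r ^ 0 * v)) + (\<Sum>j=Suc 1..a. \<Sum>v\<in>?V. F (r ^ j * v))"
      by (rule sum.insert) auto
    also have "\<dots> = U a + (\<Sum>j=Suc 1..a. U (Suc a - j) - U (Suc a - (j - 1)))"
      by (simp only: F0 Fj cong: sum.cong)
    \<comment> \<open>The sum telescopes to \<open>U 1 - U a\<close>, and \<open>U a\<close> cancels
      against the term \<open>j = 0\<close>.\<close>
    also have "(\<Sum>j=Suc 1..a. U (Suc a - j) - U (Suc a - (j - 1))) = U (Suc a - a) - U (Suc a - 1)"
      using a by (intro sum_telescope'') auto
    also have "U a + (U (Suc a - a) - U (Suc a - 1)) = U 1" by simp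
    also have "U 1 = u (sqfree_kernel n)"
    proof -
      have "coprime (r ^ a) n'" using n'(2) r by (simp add: prime_imp_coprime)
      then show ?thesis
        using n'(1) n'0 a r r1 by (simp add: U_def sqfree_kernel_mult_coprime sqfree_kernel_prime_power)
    qed
    finally show ?thesis by (simp add: F_def)
  qed
qed

lemma squarefree_dvdI:
  fixes n m :: nat
  assumes n: "squarefree n" and m: "m > 0" and p: "\<And>p. prime p \<Longrightarrow> p dvd n \<Longrightarrow> p dvd m"
  shows "n dvd m"
proof (rule multiplicity_le_imp_dvd)
  show "n \<noteq> 0" using n not_squarefree_0 by metis
  fix q :: nat assume q: "prime q"
  have "multiplicity q n \<le> 1" using n q \<open>n \<noteq> 0\<close> by (simp add: squarefree_factorial_semiring'')
  moreover have "multiplicity q m > 0" if "multiplicity q n > 0"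
  proof -
    have "q dvd n" using that not_dvd_imp_multiplicity_0[of q n] by linarith
    then show ?thesis using p[OF q] m q by (simp add: prime_multiplicity_gt_zero_iff)
  qed
  ultimately show "multiplicity q n \<le> multiplicity q m" by linarith
qed

text \<open>Of two complementary divisors, one is at most the square root.\<close>

lemma card_divisors_le:
  assumes "m > 0" shows "real (card {i. i dvd m}) \<le> 2 * sqrt (real m)"
proof -
  define s where "s = nat \<lfloor>sqrt (real m)\<rfloor>"
  have sub: "{i. i dvd m} \<subseteq> {1..s} \<union> (\<lambda>i. m div i) ` {1..s}"
  proof
    fix i assume "i \<in> {i. i dvd m}"
    then obtain k where k: "m = i * k" by blast
    have pos: "i > 0" "k > 0" using k assms by auto
    have "real i \<le> sqrt (real m) \<or> real k \<le> sqrt (real m)"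
    proof (rule ccontr)
      assume "\<not> ?thesis"
      then have "sqrt (real m) * sqrt (real m) < real i * real k"
        using pos by (intro mult_strict_mono) auto
      then show False by (simp add: k)
    qed
    then have "i \<le> s \<or> k \<le> s" by (auto simp: s_def le_nat_floor)
    then show "i \<in> {1..s} \<union> (\<lambda>i. m div i) ` {1..s}"
    proof
      assume "k \<le> s"
      moreover have "i = m div k" using k pos by simp
      ultimately show ?thesis using pos by auto
    qed (use pos in auto)
  qed
  have "card {i. i dvd m} \<le> card ({1..s} \<union> (\<lambda>i. m div i) ` {1..s})"
    by (rule card_mono[OF _ sub]) simp
  also have "\<dots> \<le> s + s"
    by (rule order_trans[OF card_Un_le]) (use card_image_le[of "{1..s}" "\<lambda>i. m div i"] in simp)
  finally have "real (card {i. i dvd m}) \<le> 2 * real s" by simp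
  also have "real s \<le> sqrt (real m)" by (simp add: s_def)
  finally show ?thesis by simp
qed

text \<open>A positive square-full \<open>v\<close> is a^2 b^3 with \<open>b\<close> its square-free
  part, and its kernel is at most \<open>a * b\<close>. By \<open>card_divisors_le\<close> the
  weight is at most 2 a^(-3/2) b^(-5/2), which is summable over all pairs.\<close>

lemma summable_squarefull_weight:
  "summable (\<lambda>v. if v > 0 \<and> squarefull v then real (card {i. i dvd sqfree_kernel v}) / real v else 0)"
proof -
  \<comment> \<open>0 satisfies \<open>squarefull\<close>, so positivity is asked for
    separately.\<close>
  let ?S = "{v. v > 0 \<and> squarefull v}"
  let ?W = "\<lambda>v. real (card {i. i dvd sqfree_kernel v}) / real v"
  let ?h = "\<lambda>(a, b). 2 * (real a powr - (3/2) * real b powr - (5/2))"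
  define g where "g = (\<lambda>v. (square_part v div squarefree_part v, squarefree_part v :: nat))"
  have g: "snd (g v) > 0" "fst (g v) > 0" "v = fst (g v) ^ 2 * snd (g v) ^ 3"
    "square_part v = fst (g v) * snd (g v)" if "v \<in> ?S" for v
  proof -
    have prime_sq: "p dvd square_part v" if "prime p" "p dvd v" for p
      using that \<open>v \<in> ?S\<close> by (simp add: squarefull_def dvd_square_part_iff)
    have c0: "square_part v > 0" using that by (auto intro!: Nat.gr0I)
    \<comment> \<open>Every prime of \<open>v\<close> occurs squared and so divides
      \<open>square_part v\<close>; this makes the division in \<open>g\<close> exact.\<close>
    have "squarefree_part v dvd square_part v"
    proof (rule squarefree_dvdI[OF squarefree_squarefree_part c0])
      fix p :: nat assume "prime p" "p dvd squarefree_part v"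
      then show "p dvd square_part v"
        using prime_sq squarefree_decompose[of v] by (metis dvd_mult2)
    qed
    then show eq: "square_part v = fst (g v) * snd (g v)" by (simp add: g_def)
    show "snd (g v) > 0"
      using squarefree_part_nonzero[of v] unfolding g_def by (metis snd_conv not_gr0)
    show "fst (g v) > 0" using eq c0 by (auto intro!: Nat.gr0I)
    have "v = snd (g v) * (fst (g v) * snd (g v)) ^ 2"
      using squarefree_decompose[of v] unfolding eq[symmetric] by (simp add: g_def)
    then show "v = fst (g v) ^ 2 * snd (g v) ^ 3"
      by (simp add: power2_eq_square power3_eq_cube mult_ac)
  qed
  have kle: "sqfree_kernel v \<le> square_part v" if "v \<in> ?S" for v
  proof (rule dvd_imp_le)
    show "square_part v > 0" using that by (auto intro!: Nat.gr0I)
    then show "sqfree_kernel v dvd square_part v"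
    proof (rule squarefree_dvdI[OF squarefree_sqfree_kernel])
      fix p assume "prime p" "p dvd sqfree_kernel v"
      then show "p dvd square_part v"
        using that by (simp add: prime_dvd_sqfree_kernel_iff squarefull_def dvd_square_part_iff)
    qed
  qed
  have inj: "inj_on g ?S"
  proof (rule inj_onI)
    fix v w assume vw: "v \<in> ?S" "w \<in> ?S" "g v = g w"
    have "v = fst (g v) ^ 2 * snd (g v) ^ 3" by (rule g(3)[OF vw(1)])
    also have "\<dots> = w" unfolding vw(3) by (rule g(3)[OF vw(2), symmetric])
    finally show "v = w" .
  qed
  have hs: "?h summable_on {1..} \<times> {1..}"
  proof -
    have s: "(\<lambda>a. real a powr - (3/2)) summable_on {1..}" "(\<lambda>b. real b powr - (5/2)) summable_on {1..}"
      using summable_on_nat_powr[of "3/2"] summable_on_nat_powr[of "5/2"] by simp_all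
    have "(\<lambda>(a, b). real a powr - (3/2) * real b powr - (5/2)) summable_on {1..} \<times> {1..}"
      by (rule summable_on_SigmaI[where g = "\<lambda>a. real a powr - (3/2) * (\<Sum>\<^sub>\<infinity>b\<in>{1..}. real b powr - (5/2))"])
         (use s in \<open>auto intro!: has_sum_cmult_right has_sum_infsum summable_on_cmult_left\<close>)
    from summable_on_cmult_right[OF this, of 2] show ?thesis
      by (simp add: case_prod_unfold)
  qed
  have "(?h \<circ> g) summable_on ?S"
  proof -
    have "g ` ?S \<subseteq> {1..} \<times> {1..}"
    proof (rule image_subsetI)
      fix v assume v: "v \<in> ?S"
      show "g v \<in> {1..} \<times> {1..}"
        using g(1,2)[OF v] unfolding mem_Times_iff by simp
    qed
    from summable_on_subset_banach[OF hs this] show ?thesis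
      using summable_on_reindex[OF inj] by blast
  qed
  then have "(\<lambda>v. norm (?W v)) summable_on ?S"
  proof (rule Infinite_Sum.abs_summable_on_comparison_test')
    fix v assume v: "v \<in> ?S"
    define a b where "a = fst (g v)" and "b = snd (g v)"
    have ab: "a > 0" "b > 0" "real v = real a ^ 2 * real b ^ 3" "sqrt (real (square_part v)) = sqrt (real a) * sqrt (real b)"
    proof -
      show "a > 0" "b > 0" using g(1,2)[OF v] by (simp_all add: a_def b_def)
      have "v = a ^ 2 * b ^ 3" using g(3)[OF v] by (simp only: a_def b_def)
      then show "real v = real a ^ 2 * real b ^ 3" by (metis of_nat_mult of_nat_power)
      show "sqrt (real (square_part v)) = sqrt (real a) * sqrt (real b)"
        unfolding g(4)[OF v] by (simp add: a_def b_def real_sqrt_mult)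
    qed
    have "real (card {i. i dvd sqfree_kernel v}) \<le> 2 * sqrt (real (sqfree_kernel v))"
      by (rule card_divisors_le) simp
    also have "\<dots> \<le> 2 * (sqrt (real a) * sqrt (real b))"
      using kle[OF v] ab(4) by (metis mult_le_cancel_left_pos of_nat_le_iff real_sqrt_le_iff zero_less_numeral)
    finally have "?W v \<le> 2 * (sqrt (real a) * sqrt (real b)) / real v"
      by (intro divide_right_mono) auto
    also have "\<dots> = 2 * ((real a powr (1/2) / real a powr 2) * (real b powr (1/2) / real b powr 3))"
      using ab by (simp add: powr_half_sqrt)
    also have "\<dots> = (?h \<circ> g) v"
    proof -
      have "(1/2 - 2 :: real) = - (3/2)" "(1/2 - 3 :: real) = - (5/2)" by simp_all
      then show ?thesis
        unfolding powr_diff[symmetric] by (simp only: a_def b_def case_prod_unfold o_apply)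
    qed
    finally show "norm (?W v) \<le> (?h \<circ> g) v" by simp
  qed
  then have "?W summable_on ?S" by simp
  then have "(\<lambda>v. if v > 0 \<and> squarefull v then ?W v else 0) summable_on UNIV"
    by (subst summable_on_cong_neutral[where T = ?S and g = ?W]) auto
  then show ?thesis
    by (subst (asm) summable_on_UNIV_nonneg_real_iff) auto
qed

lemma sum_divisor_chains:
  fixes F :: "nat \<Rightarrow> nat \<Rightarrow> complex"
  assumes n: "n > 0"
  shows "(\<Sum>t | t dvd n. \<Sum>w | w dvd t \<and> P w. F w (t div w))
    = (\<Sum>w | w dvd n \<and> P w. \<Sum>t | t dvd n div w. F w t)"
proof -
  have fin: "finite {w. w dvd t \<and> P w}" if "t > 0" for t
    using finite_divisors_nat[OF that] by (rule rev_finite_subset) auto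
  have "(\<Sum>t | t dvd n. \<Sum>w | w dvd t \<and> P w. F w (t div w))
      = (\<Sum>(t, w)\<in>(SIGMA t:{t. t dvd n}. {w. w dvd t \<and> P w}). F w (t div w))"
    using n by (intro sum.Sigma) (auto intro!: fin dest: dvd_pos_nat)
  also have "\<dots> = (\<Sum>(w, t)\<in>(SIGMA w:{w. w dvd n \<and> P w}. {t. t dvd n div w}). F w t)"
  proof (rule sum.reindex_bij_witness[of _ "\<lambda>(w, t). (w * t, w)" "\<lambda>(t, w). (w, t div w)"])
    show "(case b of (w, t) \<Rightarrow> (w * t, w)) \<in> (SIGMA t:{t. t dvd n}. {w. w dvd t \<and> P w})"
      if "b \<in> (SIGMA w:{w. w dvd n \<and> P w}. {t. t dvd n div w})" for b
      using that n by (auto elim!: dvdE)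
    show "(case a of (t, w) \<Rightarrow> (w, t div w)) \<in> (SIGMA w:{w. w dvd n \<and> P w}. {t. t dvd n div w})"
      if "a \<in> (SIGMA t:{t. t dvd n}. {w. w dvd t \<and> P w})" for a
      using that n by (auto elim!: dvdE)
    show "(case (case b of (w, t) \<Rightarrow> (w * t, w)) of (t, w) \<Rightarrow> (w, t div w)) = b"
      if "b \<in> (SIGMA w:{w. w dvd n \<and> P w}. {t. t dvd n div w})" for b
      using that n by (auto elim!: dvdE)
  qed auto
  also have "\<dots> = (\<Sum>w | w dvd n \<and> P w. \<Sum>t | t dvd n div w. F w t)"
  proof (rule sum.Sigma[of "{w. w dvd n \<and> P w}" "\<lambda>w. {t. t dvd n div w}" F, symmetric])
    show "\<forall>w\<in>{w. w dvd n \<and> P w}. finite {t. t dvd n div w}"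
      using n by (auto intro!: finite_divisors_nat elim!: dvdE)
  qed (rule fin[OF n])
  finally show ?thesis .
qed

text \<open>Expanding \<open>u (sqfree_kernel t)\<close> over square-full \<open>w\<close> leaves
  plain convolutions \<open>A c\<close> at height \<open>x div w\<close>, with
  \<open>c = sqfree_kernel w * i\<close>. Each tends to 0 and all share one bound, so Tannery's
  theorem applies with the weights of \<open>summable_squarefull_weight\<close>.\<close>

theorem sum_kernel_convolution_tendsto_0:
  fixes u v :: "nat \<Rightarrow> complex"
  assumes u: "\<And>c y. norm (\<Sum>t=1..y. u (t * c)) \<le> B" and v: "\<And>s. norm (v s) \<le> 1"
    and v0: "(\<lambda>y. \<Sum>s=1..y. v s / of_nat s) \<longlonglongrightarrow> 0"
  shows "(\<lambda>x. \<Sum>n=1..x. (\<Sum>t | t dvd n. u (sqfree_kernel t) * v (n div t)) / of_nat n) \<longlonglongrightarrow> 0"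
proof -
  let ?k = sqfree_kernel
  define A where "A = (\<lambda>c x. \<Sum>n=1..x. (\<Sum>t | t dvd n. u (t * c) * v (n div t)) / of_nat n)"
  have A0: "A c \<longlonglongrightarrow> 0" for c
    unfolding A_def by (rule sum_dirichlet_convolution_tendsto_0[OF u v v0])
  obtain K where K: "\<And>y. norm (\<Sum>s=1..y. v s / of_nat s) \<le> K"
    using convergent_imp_Bseq[OF convergentI[OF v0]] by (auto simp: Bseq_def)
  define C where "C = 2 * B * (K + 1)"
  \<comment> \<open>\<open>T = 0\<close> in the hyperbola bound is uniform in \<open>c\<close>, as needed for dominated convergence.\<close>
  have AC: "norm (A c x) \<le> C" for c x
    using norm_sum_dirichlet_convolution_le[OF u v K, of c x 0] by (simp add: A_def C_def)
  define f where "f = (\<lambda>w x. if w > 0 \<and> squarefull w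
     then (\<Sum>i | i dvd ?k w. moebius_mu i * A (?k w * i) (x div w)) / of_nat w else 0)"
  have expand: "(\<Sum>t | t dvd n. u (?k t) * v (n div t)) = (\<Sum>w | w dvd n \<and> squarefull w. \<Sum>i | i dvd ?k w. moebius_mu i *
     (\<Sum>t | t dvd n div w. u (t * (?k w * i)) * v (n div w div t)))" if n: "n > 0" for n
  proof -
    have "(\<Sum>t | t dvd n. u (?k t) * v (n div t))
       = (\<Sum>t | t dvd n. \<Sum>w | w dvd t \<and> squarefull w. \<Sum>i | i dvd ?k w.
            moebius_mu i * u (t div w * (?k w * i)) * v (n div w div (t div w)))"
    proof (rule sum.cong[OF refl])
      fix t assume t: "t \<in> {t. t dvd n}"
      then have t0: "t > 0" using n by (auto intro!: Nat.gr0I)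
      have "n div w div (t div w) = n div t" if "w dvd t" for w
        using that t t0 by (auto elim!: dvdE)
      then show "u (?k t) * v (n div t) = (\<Sum>w | w dvd t \<and> squarefull w. \<Sum>i | i dvd ?k w.
            moebius_mu i * u (t div w * (?k w * i)) * v (n div w div (t div w)))"
        unfolding kernel_eq_sum_squarefull[OF t0] sum_distrib_right by (intro sum.cong refl) auto
    qed
    also have "\<dots> = (\<Sum>w | w dvd n \<and> squarefull w. \<Sum>t | t dvd n div w. \<Sum>i | i dvd ?k w.
            moebius_mu i * u (t * (?k w * i)) * v (n div w div t))"
      by (rule sum_divisor_chains[OF n])
    also have "\<dots> = (\<Sum>w | w dvd n \<and> squarefull w. \<Sum>i | i dvd ?k w. \<Sum>t | t dvd n div w.
            moebius_mu i * u (t * (?k w * i)) * v (n div w div t))"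
      by (rule sum.cong[OF refl]) (rule sum.swap)
    finally show ?thesis by (simp only: sum_distrib_left mult.assoc)
  qed
  have main: "(\<Sum>n=1..x. (\<Sum>t | t dvd n. u (?k t) * v (n div t)) / of_nat n) = (\<Sum>w. f w x)" for x
  proof -
    \<comment> \<open>Expressed through \<open>m = n div w\<close>, so that
      \<open>sum_divisors_swap\<close> can bring \<open>w\<close> outside.\<close>
    define H where "H = (\<lambda>w m. if squarefull w then (\<Sum>i | i dvd ?k w. moebius_mu i *
       (\<Sum>t | t dvd m. u (t * (?k w * i)) * v (m div t))) / of_nat m / of_nat w else 0)"
    have "(\<Sum>n=1..x. (\<Sum>t | t dvd n. u (?k t) * v (n div t)) / of_nat n)
       = (\<Sum>n=1..x. \<Sum>w | w dvd n. H w (n div w))"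
    proof (rule sum.cong[OF refl])
      fix n assume "n \<in> {1..x}"
      then have n: "n > 0" by simp
      have "(\<Sum>t | t dvd n. u (?k t) * v (n div t)) / of_nat n = (\<Sum>w | w dvd n \<and> squarefull w.
          (\<Sum>i | i dvd ?k w. moebius_mu i * (\<Sum>t | t dvd n div w. u (t * (?k w * i)) * v (n div w div t))) / of_nat n)"
        unfolding expand[OF n] by (rule sum_divide_distrib)
      also have "\<dots> = (\<Sum>w | w dvd n \<and> squarefull w. H w (n div w))"
        unfolding H_def
      proof (rule sum.cong[OF refl])
        fix w assume w: "w \<in> {w. w dvd n \<and> squarefull w}"
        then obtain m where "n = w * m" by blast
        then show "(\<Sum>i | i dvd ?k w. moebius_mu i * (\<Sum>t | t dvd n div w. u (t * (?k w * i)) * v (n div w div t))) / of_nat n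
          = (if squarefull w then (\<Sum>i | i dvd ?k w. moebius_mu i * (\<Sum>t | t dvd n div w. u (t * (?k w * i)) * v (n div w div t)))
              / of_nat (n div w) / of_nat w else 0)"
          using w n by (simp add: mult.commute)
      qed
      also have "\<dots> = (\<Sum>w | w dvd n. H w (n div w))"
        using n by (intro sum.mono_neutral_left) (auto simp: H_def)
      finally show "(\<Sum>t | t dvd n. u (?k t) * v (n div t)) / of_nat n = (\<Sum>w | w dvd n. H w (n div w))" .
    qed
    also have "\<dots> = (\<Sum>w=1..x. \<Sum>m=1..x div w. H w m)" by (rule sum_divisors_swap)
    also have "\<dots> = (\<Sum>w=1..x. f w x)"
    proof (rule sum.cong[OF refl])
      fix w assume "w \<in> {1..x}"
      then have w: "w > 0" by simp
      show "(\<Sum>m=1..x div w. H w m) = f w x"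
      proof (cases "squarefull w")
        case True
        have pull: "(\<Sum>i\<in>I. a i * b i) / c = (\<Sum>i\<in>I. a i * (b i / c))"
          for I :: "nat set" and a b :: "nat \<Rightarrow> complex" and c
          by (simp add: sum_divide_distrib)
        have "(\<Sum>m=1..x div w. H w m) = (\<Sum>m=1..x div w. (\<Sum>i | i dvd ?k w. moebius_mu i *
             ((\<Sum>t | t dvd m. u (t * (?k w * i)) * v (m div t)) / of_nat m)) / of_nat w)"
          by (simp only: H_def True if_True pull)
        also have "\<dots> = (\<Sum>m=1..x div w. \<Sum>i | i dvd ?k w. moebius_mu i *
             ((\<Sum>t | t dvd m. u (t * (?k w * i)) * v (m div t)) / of_nat m)) / of_nat w"
          by (rule sum_divide_distrib[symmetric])
        also have "(\<Sum>m=1..x div w. \<Sum>i | i dvd ?k w. moebius_mu i *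
             ((\<Sum>t | t dvd m. u (t * (?k w * i)) * v (m div t)) / of_nat m))
           = (\<Sum>i | i dvd ?k w. moebius_mu i * A (?k w * i) (x div w))"
          unfolding A_def sum_distrib_left by (rule sum.swap)
        finally show ?thesis using True w by (simp add: f_def)
      qed (simp add: H_def f_def)
    qed
    \<comment> \<open>For \<open>w > x\<close> the sums are empty since \<open>x div w = 0\<close>,
      and \<open>w = 0\<close> is excluded by the guard in \<open>f\<close>; the finite sum thus
      takes the form of a series, as Tannery's theorem requires.\<close>
    also have "\<dots> = (\<Sum>w. f w x)"
      by (rule suminf_finite[symmetric]) (auto simp: f_def A_def not_le Suc_le_eq)
    finally show ?thesis .
  qed
  let ?M = "\<lambda>w. C * (if w > 0 \<and> squarefull w then real (card {i. i dvd ?k w}) / real w else 0)"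
  have "((\<lambda>x. \<Sum>w. f w x) \<longlonglongrightarrow> (\<Sum>w. 0))"
  proof (rule tannerys_theorem[THEN conjunct2, THEN conjunct2])
    show "(\<lambda>x. f w x) \<longlonglongrightarrow> 0" for w
    proof (cases "w > 0 \<and> squarefull w")
      case True
      have div_at_top: "filterlim (\<lambda>x. x div w) at_top sequentially"
        using True by (intro filterlim_div_at_top) auto
      have "(\<lambda>x. (\<Sum>i | i dvd ?k w. moebius_mu i * A (?k w * i) (x div w)) / of_nat w)
         \<longlonglongrightarrow> (\<Sum>i | i dvd ?k w. moebius_mu i * 0) / of_nat w"
        using True by (intro tendsto_intros filterlim_compose[OF A0 div_at_top]) auto
      then show ?thesis using True by (simp add: f_def)
    next
      case False
      then have "f w x = 0" for x by (simp only: f_def if_False)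
      then show ?thesis by simp
    qed
    show "summable ?M" by (intro summable_mult summable_squarefull_weight)
    have "norm (f w x) \<le> ?M w" for w x
    proof (cases "w > 0 \<and> squarefull w")
      case True
      have "norm (\<Sum>i | i dvd ?k w. moebius_mu i * A (?k w * i) (x div w)) \<le> (\<Sum>i | i dvd ?k w. C)"
      proof (rule sum_norm_le)
        fix i
        have "norm (moebius_mu i * A (?k w * i) (x div w)) \<le> 1 * C"
          unfolding norm_mult using norm_moebius_mu_le AC by (intro mult_mono) auto
        then show "norm (moebius_mu i * A (?k w * i) (x div w)) \<le> C" by simp
      qed
      then have "norm (\<Sum>i | i dvd ?k w. moebius_mu i * A (?k w * i) (x div w)) / real w \<le> C * real (card {i. i dvd ?k w}) / real w"
        by (intro divide_right_mono) (auto simp: mult.commute)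
      then show ?thesis using True by (simp add: f_def norm_divide)
    next
      case False
      then show ?thesis by (simp only: f_def if_False norm_zero mult_zero_right order_refl)
    qed
    then show "\<forall>\<^sub>F (w, x) in at_top \<times>\<^sub>F sequentially. norm (f w x) \<le> ?M w"
      by (intro always_eventually) auto
  qed auto
  then show ?thesis unfolding main by simp
qed

section \<open>Periodic functions supported on the units modulo m\<close>

lemma norm_sum_periodic_le:
  fixes g :: "nat \<Rightarrow> complex"
  assumes per: "\<And>t. g (t + m) = g t" and zero: "(\<Sum>t=1..m. g t) = 0"
    and W: "\<And>t. norm (g t) \<le> W" and m: "m > 0"
  shows "norm (\<Sum>t=1..y. g t) \<le> real m * W"
proof (induction y rule: less_induct)
  case (less y)
  show ?case
  proof (cases "m \<le> y")
    case True
    have "(\<Sum>t=1..y. g t) = (\<Sum>t=1..m. g t) + (\<Sum>t=m+1..y. g t)"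
      using True sum.ub_add_nat[of 1 m g "y - m"] by simp
    also have "(\<Sum>t=m+1..y. g t) = (\<Sum>t=1..y-m. g (t + m))"
      by (rule sum.reindex_bij_witness[of _ "\<lambda>t. t + m" "\<lambda>t. t - m"]) auto
    finally have "(\<Sum>t=1..y. g t) = (\<Sum>t=1..y-m. g t)" by (simp add: zero[simplified] per)
    then show ?thesis using less[of "y - m"] True m by simp
  next
    case False
    have "norm (\<Sum>t=1..y. g t) \<le> (\<Sum>t=1..y. W)" by (intro sum_norm_le W)
    also have "\<dots> \<le> real m * W"
      using False order_trans[OF norm_ge_zero W] by (simp add: mult_right_mono)
    finally show ?thesis .
  qed
qed

text \<open>Moebius inversion of the condition \<open>coprime t D\<close> leads to sums over
  multiples \<open>t = k * i\<close>, that is, to the dilates of \<open>w\<close> by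
  \<open>i * c\<close>; this is why the hypothesis covers all dilates. If \<open>c\<close> shares a
  factor with \<open>D\<close>, every term is 0.\<close>

lemma norm_sum_coprime_le:
  fixes w :: "nat \<Rightarrow> complex"
  assumes w: "\<And>c y. norm (\<Sum>t=1..y. w (t * c)) \<le> B" and D: "D > 0"
  shows "norm (\<Sum>t=1..y. if coprime (t * c) D then w (t * c) else 0) \<le> real (card {i. i dvd D}) * B"
proof (cases "coprime c D")
  case True
  have "(if coprime (t * c) D then w (t * c) else 0) = (\<Sum>i | i dvd D. moebius_mu i * (if i dvd t then w (t * c) else 0))"
    if "t \<in> {1..y}" for t
  proof -
    have "(\<Sum>i | i dvd D. moebius_mu i * (if i dvd t then w (t * c) else 0))
       = (\<Sum>i | i dvd gcd t D. moebius_mu i * w (t * c))"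
    proof (rule sum.mono_neutral_cong_right)
      show "finite {i. i dvd D}" using D by simp
    qed auto
    also have "\<dots> = (\<Sum>i | i dvd gcd t D. moebius_mu i) * w (t * c)"
      by (simp add: sum_distrib_right)
    also have "(\<Sum>i | i dvd gcd t D. moebius_mu i) = (if gcd t D = 1 then 1 else 0)"
      using D by (intro sum_moebius_mu_divisors) auto
    also have "gcd t D = 1 \<longleftrightarrow> coprime (t * c) D"
      using True by (simp only: coprime_iff_gcd_eq_1[symmetric] coprime_mult_left_iff simp_thms)
    finally show ?thesis by auto
  qed
  then have "(\<Sum>t=1..y. if coprime (t * c) D then w (t * c) else 0)
     = (\<Sum>t=1..y. \<Sum>i | i dvd D. moebius_mu i * (if i dvd t then w (t * c) else 0))"
    by (intro sum.cong) auto
  also have "\<dots> = (\<Sum>i | i dvd D. \<Sum>t=1..y. moebius_mu i * (if i dvd t then w (t * c) else 0))"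
    by (rule sum.swap)
  also have "\<dots> = (\<Sum>i | i dvd D. moebius_mu i * (\<Sum>k=1..y div i. w (k * (i * c))))"
  proof (rule sum.cong[OF refl])
    fix i assume "i \<in> {i. i dvd D}"
    then have i: "i > 0" using D by (auto intro!: Nat.gr0I)
    have "(\<Sum>t=1..y. if i dvd t then w (t * c) else 0) = (\<Sum>t | t \<in> {1..y} \<and> i dvd t. w (t * c))"
      by (rule sum.inter_filter[symmetric]) simp
    also have "\<dots> = (\<Sum>k=1..y div i. w (i * k * c))" by (rule sum_over_multiples[OF i])
    finally show "(\<Sum>t=1..y. moebius_mu i * (if i dvd t then w (t * c) else 0)) = moebius_mu i * (\<Sum>k=1..y div i. w (k * (i * c)))"
      by (simp only: sum_distrib_left[symmetric] mult_ac)
  qed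
  also have "norm \<dots> \<le> (\<Sum>i | i dvd D. 1 * B)"
    by (intro sum_norm_le) (unfold norm_mult, intro mult_mono norm_moebius_mu_le w, auto)
  finally show ?thesis by simp
next
  case False
  have "0 \<le> B" using w[of 0 1] norm_ge_zero order_trans by blast
  with False show ?thesis by simp
qed

lemma sum_coprime_residue_scale:
  fixes w :: "nat \<Rightarrow> complex"
  assumes per: "\<And>t. w (t + m) = w t" and m: "m > 0" and c: "coprime c m"
  shows "(\<Sum>t=1..m. w (t * c)) = (\<Sum>t=1..m. w t)"
proof -
  have perk: "w (t + k * m) = w t" for t k
    by (induction k) (use per in \<open>simp_all add: add.assoc[symmetric] add.commute[of m]\<close>)
  have permod: "w (t mod m) = w t" for t
    using perk[of "t mod m" "t div m"] by simp
  have shift: "(\<Sum>t=1..m. g t) = (\<Sum>t<m. g t)" if "g m = g 0" for g :: "nat \<Rightarrow> complex"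
  proof -
    obtain n where n: "m = Suc n" using m gr0_implies_Suc by blast
    have "(\<Sum>t<Suc n. g t) = g 0 + (\<Sum>t<n. g (Suc t))" by (rule sum.lessThan_Suc_shift)
    also have "(\<Sum>t<n. g (Suc t)) = (\<Sum>t=1..n. g t)"
      by (rule sum.reindex_bij_witness[of _ "\<lambda>t. t - 1" Suc]) auto
    finally show ?thesis using that n by (simp add: add.commute)
  qed
  have "inj_on (\<lambda>t. t * c mod m) {..<m}"
  proof (rule inj_onI)
    fix s t assume st: "s \<in> {..<m}" "t \<in> {..<m}" "s * c mod m = t * c mod m"
    then have "[s = t] (mod m)" using c by (simp add: cong_def[symmetric] cong_mult_rcancel_nat)
    then show "s = t" using st by (simp add: cong_def)
  qed
  moreover have "(\<lambda>t. t * c mod m) ` {..<m} \<subseteq> {..<m}" using m by auto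
  ultimately have bij: "bij_betw (\<lambda>t. t * c mod m) {..<m} {..<m}"
    by (simp add: bij_betw_def endo_inj_surj)
  have "(\<Sum>t=1..m. w (t * c)) = (\<Sum>t<m. w (t * c))"
    using perk[of 0 c] by (intro shift) (simp add: mult.commute)
  also have "\<dots> = (\<Sum>t<m. w (t * c mod m))" by (simp add: permod)
  also have "\<dots> = (\<Sum>t<m. w t)" by (rule sum.reindex_bij_betw[OF bij])
  also have "\<dots> = (\<Sum>t=1..m. w t)" using per[of 0] by (intro shift[symmetric]) simp
  finally show ?thesis .
qed

text \<open>If \<open>n\<close> divides \<open>m\<close>, then so does \<open>n div s\<close>, which
  is coprime to \<open>m\<close> only for \<open>s = n\<close>. Otherwise some prime
  \<open>p\<close> of \<open>n\<close> does not divide \<open>m\<close>; it has no effect on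
  coprimality to \<open>m\<close>, so \<open>s\<close> and \<open>p * s\<close> cancel.\<close>

lemma sum_moebius_coprime_divisors:
  assumes n: "squarefree n" and m: "m > 0"
  shows "(\<Sum>t | t dvd n. (if coprime t m then 1 else 0) * moebius_mu (n div t)) = (if n dvd m then moebius_mu n else 0)"
proof -
  have n0: "n > 0" using n by (auto intro!: Nat.gr0I)
  have "(\<Sum>t | t dvd n. (if coprime t m then 1 else 0) * moebius_mu (n div t))
     = (\<Sum>s | s dvd n. moebius_mu s * (if coprime (n div s) m then 1 else 0))"
    using sum_dvd_flip[OF n0, of "\<lambda>t s. (if coprime t m then 1 else 0) * moebius_mu s"]
    by (simp add: mult.commute)
  also have "\<dots> = (if n dvd m then moebius_mu n else 0)"
  proof (cases "n dvd m")
    case True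
    have "(\<Sum>s | s dvd n. moebius_mu s * (if coprime (n div s) m then 1 else 0)) = (\<Sum>s\<in>{n}. moebius_mu s)"
    proof (rule sum.mono_neutral_cong_right)
      show "\<forall>s\<in>{s. s dvd n} - {n}. moebius_mu s * (if coprime (n div s) m then 1 else 0) = 0"
      proof
        fix s assume s: "s \<in> {s. s dvd n} - {n}"
        then obtain k where k: "n = s * k" by blast
        then have "k \<noteq> 1" "s > 0" using s n0 by auto
        moreover have "k dvd m" using True k dvd_mult_right by blast
        ultimately have "\<not> coprime k m"
          using coprime_absorb_left[of k m] by auto
        then show "moebius_mu s * (if coprime (n div s) m then 1 else 0) = 0"
          using k \<open>s > 0\<close> by simp
      qed
    qed (use n0 in auto)
    then show ?thesis using True by simp
  next
    case False
    then obtain p where p: "prime p" "p dvd n" "\<not> p dvd m" using squarefree_dvdI[OF n m] by blast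
    have "(\<Sum>s | s dvd n. moebius_mu s * (if coprime (n div s) m then 1 else 0))
       = (\<Sum>s | s dvd n \<and> \<not> p dvd s. moebius_mu s *
          ((if coprime (n div s) m then 1 else 0) - (if coprime (n div (p * s)) m then 1 else 0)))"
      using p n0 by (intro sum_moebius_mu_prime_split)
    also have "\<dots> = 0"
    proof (rule sum.neutral, safe)
      fix s assume s: "s dvd n" "\<not> p dvd s"
      have "coprime p s" using p(1) s(2) by (rule prime_imp_coprime)
      then have "p * s dvd n" using p s by (intro divides_mult)
      then obtain k where k: "n = p * s * k" by blast
      have pos: "p > 0" "s > 0" using n0 k by auto
      have "n div s = p * k" "n div (p * s) = k"
        using pos by (simp_all add: k mult_ac)
      moreover have "coprime p m" using p by (simp add: prime_imp_coprime)
      ultimately show "moebius_mu s * ((if coprime (n div s) m then 1 else 0) - (if coprime (n div (p * s)) m then 1 else 0)) = (0 :: complex)"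
        by simp
    qed
    finally show ?thesis using False by simp
  qed
  finally show ?thesis .
qed

lemma coprime_iff_no_common_prime:
  fixes a b :: nat
  shows "coprime a b \<longleftrightarrow> (\<forall>p. prime p \<longrightarrow> p dvd a \<longrightarrow> \<not> p dvd b)"
proof
  assume *: "\<forall>p. prime p \<longrightarrow> p dvd a \<longrightarrow> \<not> p dvd b"
  show "coprime a b"
  proof (rule ccontr)
    assume "\<not> coprime a b"
    then have "gcd a b \<noteq> 1" by (simp only: coprime_iff_gcd_eq_1 simp_thms)
    then obtain p where "prime p" "p dvd gcd a b" using prime_factor_nat by blast
    then show False using * gcd_dvd1 gcd_dvd2 dvd_trans by metis
  qed
next
  assume "coprime a b"
  then show "\<forall>p. prime p \<longrightarrow> p dvd a \<longrightarrow> \<not> p dvd b"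
    using coprime_common_divisor not_prime_unit by blast
qed

lemma coprime_sqfree_kernel_iff:
  "a > 0 \<Longrightarrow> coprime (sqfree_kernel a) b \<longleftrightarrow> coprime a b"
  unfolding coprime_iff_no_common_prime by (auto simp: prime_dvd_sqfree_kernel_iff)

theorem sum_periodic_eratosthenes_tendsto:
  fixes u :: "nat \<Rightarrow> complex"
  assumes m: "m > 0" and D: "D > 0" and per: "\<And>t. u (t + m) = u t"
    and supp: "\<And>t. \<not> coprime t m \<Longrightarrow> u t = 0"
  shows "(\<lambda>x. \<Sum>n=1..x. if squarefree n \<and> coprime n D then eratosthenes u n / of_nat n else 0)
    \<longlonglongrightarrow> (\<Sum>t=1..m. u t) / of_nat (totient m) * (\<Sum>n | n dvd m \<and> coprime n D. moebius_mu n / of_nat n)"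
proof -
  \<comment> \<open>The mean of \<open>u\<close> over the units, so that \<open>w\<close> sums to 0
    over a period and keeps the period and the support of \<open>u\<close>.\<close>
  define M where "M = (\<Sum>t=1..m. u t) / of_nat (totient m)"
  define w where "w = (\<lambda>t. u t - (if coprime t m then M else 0))"
  have "coprime (t + m) m \<longleftrightarrow> coprime t m" for t
    by (simp only: coprime_iff_gcd_eq_1 gcd_add1)
  then have wper: "w (t + m) = w t" for t
    by (simp add: w_def per)
  have wsupp: "w t = 0" if "\<not> coprime t m" for t using that by (simp add: w_def supp)
  have "(\<Sum>t=1..m. if coprime t m then M else 0) = M * of_nat (totient m)"
  proof -
    have "(\<Sum>t=1..m. if coprime t m then M else 0) = (\<Sum>t | t \<in> {1..m} \<and> coprime t m. M)"
      by (rule sum.inter_filter[symmetric]) simp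
    also have "{t. t \<in> {1..m} \<and> coprime t m} = totatives m"
      by (auto simp: totatives_def)
    finally show ?thesis by (simp add: totient_def mult.commute)
  qed
  then have wsum: "(\<Sum>t=1..m. w t) = 0"
    using m by (simp add: w_def sum_subtractf M_def)
  have perk: "w (t + k * m) = w t" for t k
    by (induction k) (use wper in \<open>simp_all add: add.assoc[symmetric] add.commute[of m]\<close>)
  have wc: "(\<Sum>t=1..m. w (t * c)) = 0" for c
  proof (cases "coprime c m")
    case True
    then show ?thesis using sum_coprime_residue_scale[of w m c] wper m wsum by simp
  qed (simp add: wsupp)
  define W where "W = Max ((\<lambda>t. norm (w t)) ` {..<m})"
  have W: "norm (w t) \<le> W" for t
  proof -
    have "w t = w (t mod m)" using perk[of "t mod m" "t div m"] by simp
    then show ?thesis using m unfolding W_def by (intro Max_ge) auto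
  qed
  have wbound: "norm (\<Sum>t=1..y. w (t * c)) \<le> real m * W" for c y
  proof (rule norm_sum_periodic_le)
    show "w ((t + m) * c) = w (t * c)" for t
      using perk[of "t * c" c] by (simp add: algebra_simps)
  qed (use wc W m in auto)
  \<comment> \<open>\<open>n\<close> is coprime to \<open>D\<close> iff \<open>t\<close> and
    \<open>n div t\<close> both are, so the condition can be imposed on the two factors of the
    convolution separately. Passing from \<open>t\<close> to its kernel does not affect it.\<close>
  define wD where "wD = (\<lambda>t. if coprime t D then w t else 0)"
  define v where "v = (\<lambda>s. if coprime s D then moebius_mu s else 0)"
  have wD: "norm (\<Sum>t=1..y. wD (t * c)) \<le> real (card {i. i dvd D}) * (real m * W)" for c y
    unfolding wD_def by (rule norm_sum_coprime_le[OF wbound D])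
  have lim: "(\<lambda>x. \<Sum>n=1..x. (\<Sum>t | t dvd n. wD (sqfree_kernel t) * v (n div t)) / of_nat n) \<longlonglongrightarrow> 0"
  proof (rule sum_kernel_convolution_tendsto_0[OF wD])
    show "norm (v s) \<le> 1" for s using norm_moebius_mu_le by (simp add: v_def)
    show "(\<lambda>y. \<Sum>s=1..y. v s / of_nat s) \<longlonglongrightarrow> 0"
      unfolding v_def by (rule sum_moebius_mu_coprime_tendsto_0[OF D])
  qed
  have term_eq: "(\<Sum>t | t dvd n. wD (sqfree_kernel t) * v (n div t))
     = (if squarefree n \<and> coprime n D then eratosthenes u n - M * (if n dvd m then moebius_mu n else 0) else 0)"
    if n: "n > 0" for n
  proof -
    note kD = coprime_sqfree_kernel_iff[of _ D]
    have "(\<Sum>t | t dvd n. wD (sqfree_kernel t) * v (n div t))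
       = (\<Sum>t | t dvd n. (if coprime n D then 1 else 0) * (w (sqfree_kernel t) * moebius_mu (n div t)))"
    proof (rule sum.cong[OF refl])
      fix t assume "t \<in> {t. t dvd n}"
      then obtain s where s: "n = t * s" by blast
      then have "t > 0" "s > 0" using n by auto
      then show "wD (sqfree_kernel t) * v (n div t) = (if coprime n D then 1 else 0) * (w (sqfree_kernel t) * moebius_mu (n div t))"
        using s kD[of t] by (auto simp: wD_def v_def)
    qed
    also have "\<dots> = (if coprime n D then 1 else 0) * eratosthenes (\<lambda>t. w (sqfree_kernel t)) n"
      by (simp only: sum_distrib_left[symmetric] eratosthenes_def)
    also have "\<dots> = (if squarefree n \<and> coprime n D then eratosthenes u n - M * (if n dvd m then moebius_mu n else 0) else 0)"
    proof (cases "squarefree n")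
      case False
      then have "eratosthenes (\<lambda>t. w (sqfree_kernel t)) n = 0"
        using n by (intro eratosthenes_kernel_eq_0)
          (auto simp: sqfree_kernel_squarefree squarefree_sqfree_kernel)
      then show ?thesis using False by simp
    next
      case True
      have "eratosthenes (\<lambda>t. w (sqfree_kernel t)) n = (\<Sum>t | t dvd n. w t * moebius_mu (n div t))"
        unfolding eratosthenes_def using True
        by (intro sum.cong) (auto simp: sqfree_kernel_squarefree dest: squarefree_mono)
      also have "\<dots> = eratosthenes u n - M * (\<Sum>t | t dvd n. (if coprime t m then 1 else 0) * moebius_mu (n div t))"
        unfolding eratosthenes_def w_def sum_distrib_left
        by (subst sum_subtractf[symmetric]) (intro sum.cong, auto simp: left_diff_distrib)
      also have "\<dots> = eratosthenes u n - M * (if n dvd m then moebius_mu n else 0)"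
        unfolding sum_moebius_coprime_divisors[OF True m] ..
      finally show ?thesis using True by simp
    qed
    finally show ?thesis .
  qed
  let ?E = "\<lambda>x. \<Sum>n=1..x. if squarefree n \<and> coprime n D then eratosthenes u n / of_nat n else 0"
  let ?V = "\<Sum>n | n dvd m \<and> coprime n D. moebius_mu n / of_nat n"
  \<comment> \<open>From \<open>x \<ge> m\<close> on, all divisors of \<open>m\<close> lie in the
    range and the contribution of the mean is complete.\<close>
  have "?E x - M * ?V = (\<Sum>n=1..x. (\<Sum>t | t dvd n. wD (sqfree_kernel t) * v (n div t)) / of_nat n)" if x: "x \<ge> m" for x
  proof -
    have "?V = (\<Sum>n=1..x. if n dvd m \<and> coprime n D then moebius_mu n / of_nat n else 0)"
    proof (rule sum.mono_neutral_cong_left)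
      show "{n. n dvd m \<and> coprime n D} \<subseteq> {1..x}"
        using m x by (auto intro!: Suc_leI Nat.gr0I intro: order_trans[OF dvd_imp_le])
    qed auto
    then have "?E x - M * ?V = (\<Sum>n=1..x. (if squarefree n \<and> coprime n D then eratosthenes u n / of_nat n else 0)
        - M * (if n dvd m \<and> coprime n D then moebius_mu n / of_nat n else 0))"
      by (simp only: sum_subtractf sum_distrib_left)
    also have "\<dots> = (\<Sum>n=1..x. (\<Sum>t | t dvd n. wD (sqfree_kernel t) * v (n div t)) / of_nat n)"
    proof (rule sum.cong[OF refl])
      fix n assume "n \<in> {1..x}"
      then have n: "n > 0" by simp
      show "(if squarefree n \<and> coprime n D then eratosthenes u n / of_nat n else 0)
        - M * (if n dvd m \<and> coprime n D then moebius_mu n / of_nat n else 0)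
        = (\<Sum>t | t dvd n. wD (sqfree_kernel t) * v (n div t)) / of_nat n"
        unfolding term_eq[OF n] by (auto simp: diff_divide_distrib moebius_mu_def)
    qed
    finally show ?thesis .
  qed
  then have "(\<lambda>x. ?E x - M * ?V) \<longlonglongrightarrow> 0"
    by (intro Lim_transform_eventually[OF lim]) (auto simp: eventually_sequentially intro!: exI[of _ m])
  then show ?thesis
    unfolding M_def[symmetric] by (subst (asm) LIM_zero_iff)
qed

lemma squarefree_mult_imp_coprime:
  fixes a b :: nat
  assumes "squarefree (a * b)" shows "coprime a b"
proof -
  have "(gcd a b)\<^sup>2 dvd a * b" by (simp add: power2_eq_square mult_dvd_mono)
  then have "gcd a b dvd 1" using assms squarefreeD by blast
  then have "gcd a b = 1" by (simp only: nat_dvd_1_iff_1)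
  then show ?thesis by (simp only: coprime_iff_gcd_eq_1)
qed

section \<open>The Wintner coefficients\<close>

text \<open>Both sides are the product of 1 - 1/r over the primes \<open>r\<close> of
  \<open>k\<close>; the induction splits off one prime.\<close>

lemma sum_moebius_mu_over_divisors:
  "squarefree k \<Longrightarrow> (\<Sum>d | d dvd k. moebius_mu d / of_nat d) = of_nat (totient k) / of_nat k"
proof (induction k rule: less_induct)
  case (less k)
  show ?case
  proof (cases "k = 1")
    case False
    have k0: "k > 0" using less.prems by (auto intro!: Nat.gr0I)
    obtain r where r: "prime r" "r dvd k" using False prime_factor_nat by blast
    then obtain k' where k: "k = r * k'" by blast
    have sf: "squarefree k'" "coprime r k'"
    proof -
      show "squarefree k'" using less.prems k by (metis squarefree_mono dvd_triv_right)
      have "\<not> r dvd k'"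
      proof
        assume "r dvd k'"
        then have "r\<^sup>2 dvd k" using k by (simp add: power2_eq_square mult_dvd_mono)
        then show False using less.prems r(1) not_prime_unit by (auto dest: squarefreeD)
      qed
      then show "coprime r k'" using r(1) prime_imp_coprime by blast
    qed
    have r1: "r > 1" using r(1) prime_gt_1_nat by blast
    have k'0: "k' > 0" "k' < k" using k k0 r1 by auto
    have idx: "{s. s dvd k \<and> \<not> r dvd s} = {s. s dvd k'}"
    proof (intro Collect_cong iffI conjI)
      fix s assume s: "s dvd k \<and> \<not> r dvd s"
      then have "coprime s r" using r(1) prime_imp_coprime coprime_commute by blast
      then show "s dvd k'" using s k by (simp add: coprime_dvd_mult_right_iff)
    next
      fix s assume s: "s dvd k'"
      then show "s dvd k" using k by simp
      show "\<not> r dvd s" using s sf(2) r(1) dvd_trans coprime_common_divisor not_prime_unit dvd_refl by metis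
    qed
    have "(\<Sum>d | d dvd k. moebius_mu d / of_nat d) = (\<Sum>d | d dvd k. moebius_mu d * (1 / of_nat d))"
      by simp
    also have "\<dots> = (\<Sum>d | d dvd k'. moebius_mu d * (1 / of_nat d - 1 / of_nat (r * d)))"
      using sum_moebius_mu_prime_split[OF r k0, of "\<lambda>d. 1 / of_nat d"] unfolding idx .
    also have "\<dots> = (\<Sum>d | d dvd k'. (1 - 1 / of_nat r) * (moebius_mu d / of_nat d))"
      by (intro sum.cong refl) (simp add: left_diff_distrib right_diff_distrib diff_divide_distrib mult.commute)
    also have "\<dots> = (1 - 1 / of_nat r) * (of_nat (totient k') / of_nat k')"
      by (simp only: sum_distrib_left[symmetric] less.IH[OF k'0(2) sf(1)])
    also have "\<dots> = of_nat ((r - 1) * totient k') / of_nat k"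
      using r1 k'0 by (simp add: k of_nat_diff field_simps)
    also have "(r - 1) * totient k' = totient k"
      using sf(2) r(1) by (simp add: k totient_mult_coprime totient_prime)
    finally show ?thesis .
  qed simp
qed

lemma sum_dvd_mult_coprime:
  fixes F :: "nat \<Rightarrow> complex"
  assumes ab: "coprime a b" and pos: "a > 0" "b > 0"
  shows "(\<Sum>t | t dvd a * b. F t) = (\<Sum>s | s dvd b. \<Sum>j | j dvd a. F (j * s))"
proof -
  have gcds: "gcd (j * s) a = j" "gcd (j * s) b = s" if "j dvd a" "s dvd b" for j s
  proof -
    have "coprime j b" "coprime s a"
      using ab that coprime_divisors[of j a b b] coprime_divisors[of s b a a] by (auto simp: coprime_commute)
    then show "gcd (j * s) a = j" "gcd (j * s) b = s"
      using that by (simp_all add: gcd_mult_left_left_cancel gcd_mult_left_right_cancel coprime_commute gcd_nat.absorb1)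
  qed
  have "(\<Sum>t | t dvd a * b. F t) = (\<Sum>(s, j)\<in>{s. s dvd b} \<times> {j. j dvd a}. F (j * s))"
  proof (rule sum.reindex_bij_witness[of _ "\<lambda>(s, j). j * s" "\<lambda>t. (gcd t b, gcd t a)"])
    have decomp: "gcd t a * gcd t b = t" if "t dvd a * b" for t
      using division_decomp[OF that] gcds by fastforce
    show "(case (gcd t b, gcd t a) of (s, j) \<Rightarrow> j * s) = t" if "t \<in> {t. t dvd a * b}" for t
      using that decomp by simp
    show "(case (gcd t b, gcd t a) of (s, j) \<Rightarrow> F (j * s)) = F t" if "t \<in> {t. t dvd a * b}" for t
      using that decomp by simp
    show "(gcd (case y of (s, j) \<Rightarrow> j * s) b, gcd (case y of (s, j) \<Rightarrow> j * s) a) = y"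
      if "y \<in> {s. s dvd b} \<times> {j. j dvd a}" for y
      using that gcds by auto
  qed (auto intro: mult_dvd_mono)
  also have "\<dots> = (\<Sum>s | s dvd b. \<Sum>j | j dvd a. F (j * s))"
    by (rule sum.cartesian_product[symmetric])
  finally show ?thesis .
qed

lemma sum_residue_minus_one:
  fixes m c :: nat
  assumes m: "m > 0"
  shows "(\<Sum>t=1..m. if m dvd t * c + 1 then 1 else 0) = (if coprime c m then 1 else (0 :: complex))"
proof (cases "coprime c m")
  case True
  let ?w = "\<lambda>t :: nat. if m dvd t + 1 then 1 else (0 :: complex)"
  have per: "m dvd t + m + 1 \<longleftrightarrow> m dvd t + 1" for t
    using dvd_add_left_iff[of m m "t + 1"] by (simp add: add_ac)
  have "(\<Sum>t=1..m. if m dvd t * c + 1 then 1 else 0) = (\<Sum>t=1..m. ?w t)"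
    using per m True by (intro sum_coprime_residue_scale[where w = ?w]) auto
  \<comment> \<open>The solution of t = -1 modulo \<open>m\<close> within \<open>1..m\<close>; for
    \<open>m = 1\<close> it is 1, as \<open>m - 1\<close> would leave the range.\<close>
  also have "\<dots> = (\<Sum>t\<in>{if m = 1 then 1 else m - 1}. 1)"
  proof (rule sum.mono_neutral_cong_right)
    show "\<forall>t\<in>{1..m} - {if m = 1 then 1 else m - 1}. ?w t = 0"
    proof
      fix t assume t: "t \<in> {1..m} - {if m = 1 then 1 else m - 1}"
      show "?w t = 0"
      proof (cases "t = m")
        case True
        then have "m \<noteq> 1" using t by auto
        then have "\<not> m dvd m + 1" using dvd_add_right_iff[of m m 1] by simp
        then show ?thesis using True by simp
      next
        case False
        then have "t + 1 < m" using t by (auto split: if_splits)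
        then show ?thesis by (auto dest: dvd_imp_le)
      qed
    qed
  qed (use m in auto)
  finally show ?thesis using True by simp
next
  case False
  have "\<not> m dvd t * c + 1" for t
  proof
    assume "m dvd t * c + 1"
    moreover obtain p where p: "prime p" "p dvd c" "p dvd m"
      using False unfolding coprime_iff_no_common_prime by blast
    ultimately have "p dvd t * c + 1" "p dvd t * c" using dvd_trans by auto
    then have "p dvd 1" using dvd_add_right_iff by blast
    then show False using p(1) not_prime_unit by blast
  qed
  then show ?thesis using False by simp
qed

lemma coprime_of_dvd_mult_add_1:
  assumes "m dvd t * c + 1" shows "coprime t (m :: nat)"
  unfolding coprime_iff_no_common_prime
proof (intro allI impI notI)
  fix p assume p: "prime p" "p dvd t" "p dvd m"
  then have "p dvd t * c + 1" "p dvd t * c" using assms dvd_trans by auto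
  then have "p dvd 1" using dvd_add_right_iff by blast
  then show False using p(1) not_prime_unit by blast
qed

text \<open>
  As \<open>S_IPP\<close> is a finite linear combination of these functions, its Wintner coefficients
  are obtained from theirs.
\<close>

definition kernel_progression :: "nat \<Rightarrow> nat \<Rightarrow> nat \<Rightarrow> complex" where
  "kernel_progression p m a =
     (if p dvd a \<and> [int (sqfree_kernel a div p) = - 1] (mod int m) then 1 else 0)"

lemma cong_minus_one_iff: "[int t = - 1] (mod int m) \<longleftrightarrow> m dvd t + 1"
proof -
  have "[int t = - 1] (mod int m) \<longleftrightarrow> int m dvd int (t + 1)"
    by (simp add: cong_iff_dvd_diff add.commute)
  then show ?thesis by (simp only: of_nat_dvd_iff)
qed

lemma kernel_progression_sqfree_kernel:
  assumes "t > 0" "prime p"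
  shows "kernel_progression p m t = kernel_progression p m (sqfree_kernel t)"
  using assms by (simp add: kernel_progression_def prime_dvd_sqfree_kernel_iff
      sqfree_kernel_squarefree squarefree_sqfree_kernel)

lemma wintner_term_not_squarefree:
  assumes "prime p" "\<not> squarefree d" "d > 0"
  shows "wintner_term l (kernel_progression p m) d = 0"
proof -
  have "eratosthenes (kernel_progression p m) d = 0"
    by (rule eratosthenes_kernel_eq_0[of "kernel_progression p m" d, OF _ assms(2,3)])
       (rule kernel_progression_sqfree_kernel[OF _ assms(1)])
  then show ?thesis by (simp add: wintner_term_def)
qed

text \<open>Divisors prime to \<open>p\<close> contribute 0. After division by \<open>p\<close>, a
  divisor of \<open>lam * e\<close> splits uniquely as \<open>j * s\<close>, and collecting the sum
  over \<open>j\<close> gives a function that does not depend on \<open>e\<close>, whose transform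
  is taken at \<open>e\<close> alone.\<close>

lemma eratosthenes_kernel_progression:
  assumes p: "prime p" and lam: "squarefree (p * lam * e)"
  shows "eratosthenes (kernel_progression p m) (p * lam * e)
    = eratosthenes (\<lambda>t. \<Sum>j | j dvd lam. (if m dvd t * j + 1 then 1 else 0) * moebius_mu (lam div j)) e"
proof -
  have "p * lam * e \<noteq> 0" using lam not_squarefree_0 by metis
  then have pos: "p > 0" "lam > 0" "e > 0" by auto
  have cop: "coprime lam e" using squarefree_mult_imp_coprime[OF lam] by simp
  let ?G = "kernel_progression p m"
  have "eratosthenes ?G (p * lam * e) = (\<Sum>t | t dvd p * (lam * e) \<and> p dvd t. ?G t * moebius_mu (p * (lam * e) div t))"
    unfolding eratosthenes_def mult.assoc
    using pos by (intro sum.mono_neutral_right) (auto simp: kernel_progression_def)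
  also have "\<dots> = (\<Sum>t | t dvd lam * e. (if m dvd t + 1 then 1 else 0) * moebius_mu (lam * e div t))"
  proof (rule sum.reindex_bij_witness[of _ "\<lambda>t. p * t" "\<lambda>t. t div p"])
    fix t assume t: "t \<in> {t. t dvd p * (lam * e) \<and> p dvd t}"
    then obtain t' where t': "t = p * t'" by blast
    have "t dvd p * lam * e" using t by (simp add: mult.assoc)
    then have "sqfree_kernel t = t" using squarefree_mono[OF _ lam] sqfree_kernel_squarefree by blast
    then show "(if m dvd t div p + 1 then 1 else 0) * moebius_mu (lam * e div (t div p)) = ?G t * moebius_mu (p * (lam * e) div t)"
      using t' pos by (simp add: kernel_progression_def cong_minus_one_iff)
  qed (use pos in auto)
  also have "\<dots> = (\<Sum>s | s dvd e. \<Sum>j | j dvd lam. (if m dvd j * s + 1 then 1 else 0) * moebius_mu (lam * e div (j * s)))"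
    by (rule sum_dvd_mult_coprime[OF cop pos(2,3)])
  also have "\<dots> = eratosthenes (\<lambda>t. \<Sum>j | j dvd lam. (if m dvd t * j + 1 then 1 else 0) * moebius_mu (lam div j)) e"
    unfolding eratosthenes_def sum_distrib_right
  proof (intro sum.cong refl)
    fix s j assume "s \<in> {s. s dvd e}" "j \<in> {j. j dvd lam}"
    then obtain s' j' where sj: "e = s * s'" "lam = j * j'" by blast
    have c: "coprime j' s'" using cop sj by (auto simp: coprime_mult_left_iff coprime_mult_right_iff)
    have "lam * e div (j * s) = j' * s'" using sj pos by (simp add: mult_ac)
    moreover have "lam div j = j'" "e div s = s'" using sj pos by auto
    ultimately show "(if m dvd j * s + 1 then 1 else 0) * moebius_mu (lam * e div (j * s))
       = (if m dvd s * j + 1 then 1 else 0) * moebius_mu (lam div j) * moebius_mu (e div s)"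
      using c by (simp add: moebius_mu_mult_coprime mult.commute)
  qed
  finally show ?thesis .
qed

text \<open>A nonzero term needs \<open>d\<close> divisible by \<open>p\<close> and
  \<open>l\<close>, hence \<open>d = D * e\<close> with \<open>D = p * lam\<close>; for square-free
  \<open>d\<close> the cofactor \<open>e\<close> is square-free and coprime to \<open>D\<close>. So
  \<open>sum_periodic_eratosthenes_tendsto\<close> applies to the sum over \<open>e\<close>, and the
  sum of \<open>u\<close> over a period is mu(lam) or 0.\<close>

lemma wintner_partial_sums_kernel_progression:
  assumes p: "prime p" and l: "squarefree l" and m: "squarefree m" "\<not> p dvd m"
    and lam: "lam = (if p dvd l then l div p else l)"
  shows "(\<lambda>x. \<Sum>d=1..x. wintner_term l (kernel_progression p m) d)
    \<longlonglongrightarrow> (if lam dvd m then moebius_mu lam / (of_nat p * of_nat m * of_nat (totient lam)) else 0)"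
proof -
  have l0: "l > 0" and m0: "m > 0" using l m by (auto intro!: Nat.gr0I)
  have p0: "p > 0" using p by (simp add: prime_gt_0_nat)
  have lam_l: "lam dvd l" "l dvd p * lam" using lam by auto
  have "\<not> p dvd lam"
  proof
    assume "p dvd lam"
    then have pl: "p dvd l" using lam_l dvd_trans by blast
    with \<open>p dvd lam\<close> have "p\<^sup>2 dvd l"
      unfolding lam using p0 by (auto simp: power2_eq_square dvd_div_iff_mult mult.commute)
    then show False using l p not_prime_unit by (auto dest: squarefreeD)
  qed
  then have cop: "coprime p lam" using p prime_imp_coprime by blast
  have sfl: "squarefree lam" using lam_l(1) l squarefree_mono by blast
  have sfD: "squarefree (p * lam)"
    using cop sfl p by (simp add: squarefree_mult_coprime squarefree_prime)
  have lam0: "lam > 0" using sfl by (auto intro!: Nat.gr0I)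
  define D where "D = p * lam"
  have D0: "D > 0" using p0 lam0 by (simp add: D_def)
  define u where "u = (\<lambda>t. \<Sum>j | j dvd lam. (if m dvd t * j + 1 then 1 else 0) * moebius_mu (lam div j))"
  have uper: "u (t + m) = u t" for t
  proof -
    have "m dvd (t + m) * j + 1 \<longleftrightarrow> m dvd t * j + 1" for j
      using dvd_add_left_iff[of m "m * j" "t * j + 1"] by (simp add: algebra_simps)
    then show ?thesis by (simp only: u_def)
  qed
  have usupp: "u t = 0" if "\<not> coprime t m" for t
    unfolding u_def using that coprime_of_dvd_mult_add_1 by (intro sum.neutral) auto
  have usum: "(\<Sum>t=1..m. u t) = (if lam dvd m then moebius_mu lam else 0)"
  proof -
    have "(\<Sum>t=1..m. u t) = (\<Sum>j | j dvd lam. (\<Sum>t=1..m. if m dvd t * j + 1 then 1 else 0) * moebius_mu (lam div j))"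
      unfolding u_def sum_distrib_right by (rule sum.swap)
    then show ?thesis
      by (simp only: sum_residue_minus_one[OF m0] sum_moebius_coprime_divisors[OF sfl m0])
  qed
  have term_eq: "wintner_term l (kernel_progression p m) d = (if D dvd d then
      (if squarefree (d div D) \<and> coprime (d div D) D then eratosthenes u (d div D) / of_nat (d div D) else 0) / of_nat D else 0)"
    if d: "d > 0" for d
  proof (cases "squarefree d")
    case False
    have "\<not> (squarefree (d div D) \<and> coprime (d div D) D)" if "D dvd d"
      using squarefree_mult_coprime[of "d div D" D] sfD False that by (auto simp: D_def)
    then show ?thesis using wintner_term_not_squarefree[OF p False d] by auto
  next
    case True
    show ?thesis
    proof (cases "D dvd d")
      case dvd: True
      then obtain e where e: "d = p * lam * e" by (auto simp: D_def)
      have "squarefree e" "coprime (p * lam) e"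
        using True squarefree_multD(2)[of "p * lam" e] squarefree_mult_imp_coprime[of "p * lam" e]
        unfolding e by blast+
      moreover have "d div D = e" using e D0 by (simp add: D_def)
      moreover have "l dvd d" using lam_l(2) e by auto
      ultimately show ?thesis
        using eratosthenes_kernel_progression[OF p True[unfolded e], of m] e
        by (simp add: wintner_term_def D_def u_def coprime_commute)
    next
      case False
      have "eratosthenes (kernel_progression p m) d = 0" if "l dvd d"
      proof -
        have "\<not> p dvd d"
        proof
          assume "p dvd d"
          then have "p * lam dvd d" using cop lam_l(1) \<open>l dvd d\<close> dvd_trans by (blast intro: divides_mult)
          then show False using False by (simp add: D_def)
        qed
        then have "\<not> p dvd t" if "t dvd d" for t using that dvd_trans by blast
        then show ?thesis unfolding eratosthenes_def
          by (intro sum.neutral) (auto simp: kernel_progression_def)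
      qed
      then show ?thesis using False by (simp add: wintner_term_def)
    qed
  qed
  let ?E = "\<lambda>x. \<Sum>n=1..x. if squarefree n \<and> coprime n D then eratosthenes u n / of_nat n else 0"
  have partial: "(\<Sum>d=1..x. wintner_term l (kernel_progression p m) d) = ?E (x div D) / of_nat D" for x
  proof -
    let ?H = "\<lambda>d. (if squarefree (d div D) \<and> coprime (d div D) D then eratosthenes u (d div D) / of_nat (d div D) else 0) / of_nat D"
    have "(\<Sum>d=1..x. wintner_term l (kernel_progression p m) d) = (\<Sum>d=1..x. if D dvd d then ?H d else 0)"
      by (intro sum.cong refl term_eq) auto
    also have "\<dots> = (\<Sum>d | d \<in> {1..x} \<and> D dvd d. ?H d)" by (rule sum.inter_filter[symmetric]) simp
    also have "\<dots> = (\<Sum>k=1..x div D. ?H (D * k))" by (rule sum_over_multiples[OF D0])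
    also have "\<dots> = ?E (x div D) / of_nat D"
    proof -
      have "D * k div D = k" for k using D0 by simp
      then show ?thesis by (simp only: sum_divide_distrib dvd_triv_left)
    qed
    finally show ?thesis .
  qed
  note div_at_top = filterlim_div_at_top[OF D0]
  let ?V = "\<Sum>n | n dvd m \<and> coprime n D. moebius_mu n / of_nat n"
  have "(\<lambda>x. ?E (x div D) / of_nat D) \<longlonglongrightarrow> ((\<Sum>t=1..m. u t) / of_nat (totient m) * ?V) / of_nat D"
    using D0 by (intro tendsto_divide tendsto_const
      filterlim_compose[OF sum_periodic_eratosthenes_tendsto[of m D u, OF m0 D0 uper usupp] div_at_top]) auto
  moreover have "((\<Sum>t=1..m. u t) / of_nat (totient m) * ?V) / of_nat D
     = (if lam dvd m then moebius_mu lam / (of_nat p * of_nat m * of_nat (totient lam)) else 0)"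
  proof (cases "lam dvd m")
    case True
    then obtain k where k: "m = lam * k" by blast
    have k0: "k > 0" using m0 k by auto
    have sfk: "squarefree k" using m(1) k squarefree_multD(2) by blast
    have copk: "coprime lam k" using m(1) k squarefree_mult_imp_coprime by blast
    \<comment> \<open>\<open>m = lam * k\<close> is square-free and prime to \<open>p\<close>. The
      resulting value \<open>totient k / k\<close> then cancels the factor \<open>totient k\<close>
      of \<open>totient m\<close>.\<close>
    have "{n. n dvd m \<and> coprime n D} = {n. n dvd k}"
    proof (intro Collect_cong iffI conjI)
      fix n assume "n dvd m \<and> coprime n D"
      then have "n dvd lam * k" "coprime n lam" by (simp_all add: k D_def)
      then show "n dvd k" using coprime_dvd_mult_right_iff by blast
    next
      fix n assume n: "n dvd k"
      show "n dvd m" using n k by simp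
      have "\<not> p dvd n" using n k m(2) dvd_trans by auto
      then have "coprime n p" using p prime_imp_coprime coprime_commute by blast
      moreover have "coprime n lam" using n copk by (metis coprime_commute coprime_divisors dvd_refl)
      ultimately show "coprime n D" by (simp add: D_def)
    qed
    then have V: "?V = of_nat (totient k) / of_nat k"
      using sum_moebius_mu_over_divisors[OF sfk] by simp
    have tm: "totient m = totient lam * totient k"
      using copk by (simp add: k totient_mult_coprime)
    show ?thesis
      unfolding usum V tm using True k0 lam0 p0 by (simp add: D_def k field_simps)
  next
    case False
    then show ?thesis unfolding usum by simp
  qed
  ultimately show ?thesis unfolding partial by simp
qed

lemma wintner_term_sum:
  assumes "\<And>a. a > 0 \<Longrightarrow> F a = (\<Sum>i\<in>I. c i * G i a)" and d: "d > 0"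
  shows "wintner_term l F d = (\<Sum>i\<in>I. c i * wintner_term l (G i) d)"
proof -
  have "eratosthenes F d = (\<Sum>t | t dvd d. \<Sum>i\<in>I. c i * (G i t * moebius_mu (d div t)))"
    unfolding eratosthenes_def
  proof (rule sum.cong[OF refl])
    fix t assume "t \<in> {t. t dvd d}"
    then have "t > 0" using d by (auto intro!: Nat.gr0I)
    then show "F t * moebius_mu (d div t) = (\<Sum>i\<in>I. c i * (G i t * moebius_mu (d div t)))"
      by (simp add: assms(1) sum_distrib_right mult.assoc)
  qed
  also have "\<dots> = (\<Sum>i\<in>I. c i * eratosthenes (G i) d)"
    unfolding eratosthenes_def sum_distrib_left by (rule sum.swap)
  finally show ?thesis
    by (simp add: wintner_term_def sum_divide_distrib)
qed

lemma ghat_eq_0: "n > Q \<Longrightarrow> ghat Q g n = 0"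
  by (auto simp: ghat_def dest: dvd_imp_le intro!: sum.neutral)

text \<open>\<open>ghat\<close> vanishes beyond \<open>Q\<close>, so \<open>p\<close> and
  \<open>q\<close> may both be cut off at \<open>Q\<close>, and the condition \<open>p dvd a\<close>
  moves into \<open>kernel_progression\<close>. The index set then no longer depends on
  \<open>a\<close>, and the Eratosthenes transform can be taken termwise.\<close>

lemma S_IPP_eq_sum_kernel_progression:
  assumes a: "a > 0"
  shows "S_IPP f Q g N a = (\<Sum>(p, q, m)\<in>(SIGMA p:{p. prime p \<and> p \<le> Q}. SIGMA q:{1..Q}. {m. m dvd q}).
    (f p * of_nat p * (moebius_mu q * ghat Q g (p * q)) * (moebius_mu m * of_nat m)) * kernel_progression p m a)"
proof -
  let ?X = "\<lambda>p. f p * of_nat p * (\<Sum>q=1..Q. moebius_mu q * ghat Q g (p * q) *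
     (\<Sum>m | m dvd q. moebius_mu m * of_nat m * (if [int (sqfree_kernel a div p) = - 1] (mod int m) then 1 else 0)))"
  have "S_IPP f Q g N a = (\<Sum>p\<in>prime_factors a. ?X p)"
    unfolding S_IPP_def S_sum_def prime_factors_sqfree_kernel
  proof (rule sum.cong[OF refl])
    fix p assume "p \<in> prime_factors a"
    then have p: "p > 0" by (auto intro: prime_gt_0_nat)
    have m_sum: "(\<Sum>m | m dvd q \<and> [int (sqfree_kernel a div p) = - 1] (mod int m). moebius_mu m * of_nat m)
        = (\<Sum>m | m dvd q. moebius_mu m * of_nat m * (if [int (sqfree_kernel a div p) = - 1] (mod int m) then 1 else 0))"
      if "q > 0" for q
      using that by (intro sum.mono_neutral_cong_left) auto
    have "(\<Sum>\<^sub>\<infinity>q\<in>{1..}. moebius_mu q * ghat Q g (p * q) *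
       (\<Sum>m | m dvd q \<and> [int (sqfree_kernel a div p) = - 1] (mod int m). moebius_mu m * of_nat m))
       = (\<Sum>q=1..Q. moebius_mu q * ghat Q g (p * q) *
       (\<Sum>m | m dvd q \<and> [int (sqfree_kernel a div p) = - 1] (mod int m). moebius_mu m * of_nat m))"
    proof (rule infsumI, rule has_sum_finite_neutralI[OF _ _ _ refl])
      fix q assume "q \<in> {1..} - {1..Q}"
      then have "Q < 1 * q" by auto
      also have "1 * q \<le> p * q" using p by (intro mult_le_mono1) simp
      finally have "ghat Q g (p * q) = 0" by (rule ghat_eq_0)
      then show "moebius_mu q * ghat Q g (p * q) *
       (\<Sum>m | m dvd q \<and> [int (sqfree_kernel a div p) = - 1] (mod int m). moebius_mu m * of_nat m) = 0" by simp
    qed auto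
    also have "\<dots> = (\<Sum>q=1..Q. moebius_mu q * ghat Q g (p * q) *
       (\<Sum>m | m dvd q. moebius_mu m * of_nat m * (if [int (sqfree_kernel a div p) = - 1] (mod int m) then 1 else 0)))"
      by (intro sum.cong refl arg_cong2[of _ _ _ _ "(*)"] m_sum) auto
    finally show "f p * of_nat p * (\<Sum>\<^sub>\<infinity>q\<in>{1..}. moebius_mu q * ghat Q g (p * q) *
       (\<Sum>m | m dvd q \<and> [int (sqfree_kernel a div p) = - 1] (mod int m). moebius_mu m * of_nat m)) = ?X p"
      by (rule arg_cong)
  qed
  also have "\<dots> = (\<Sum>p | prime p \<and> p \<le> Q \<and> p dvd a. ?X p)"
  proof (rule sum.mono_neutral_right)
    show "\<forall>p\<in>prime_factors a - {p. prime p \<and> p \<le> Q \<and> p dvd a}. ?X p = 0"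
    proof
      fix p assume "p \<in> prime_factors a - {p. prime p \<and> p \<le> Q \<and> p dvd a}"
      then have p: "p > Q" using a by auto
      have "ghat Q g (p * q) = 0" if "q \<in> {1..Q}" for q
      proof (rule ghat_eq_0)
        have "p \<le> p * q" using that by simp
        then show "Q < p * q" by (rule less_le_trans[OF p])
      qed
      then show "?X p = 0" by simp
    qed
  qed (use a in \<open>auto simp: prime_factors_dvd\<close>)
  also have "\<dots> = (\<Sum>p | p \<in> {p. prime p \<and> p \<le> Q} \<and> p dvd a. ?X p)"
    by (rule sum.cong) auto
  also have "\<dots> = (\<Sum>p | prime p \<and> p \<le> Q. if p dvd a then ?X p else 0)"
    by (rule sum.inter_filter) simp
  also have "\<dots> = (\<Sum>p | prime p \<and> p \<le> Q. \<Sum>q=1..Q. \<Sum>m | m dvd q.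
     (f p * of_nat p * (moebius_mu q * ghat Q g (p * q)) * (moebius_mu m * of_nat m)) * kernel_progression p m a)"
    by (intro sum.cong refl) (auto simp: kernel_progression_def sum_distrib_left mult.assoc intro!: sum.cong)
  also have "\<dots> = (\<Sum>p | prime p \<and> p \<le> Q. \<Sum>(q, m)\<in>(SIGMA q:{1..Q}. {m. m dvd q}).
     (f p * of_nat p * (moebius_mu q * ghat Q g (p * q)) * (moebius_mu m * of_nat m)) * kernel_progression p m a)"
    by (intro sum.cong refl sum.Sigma) auto
  also have "\<dots> = (\<Sum>(p, q, m)\<in>(SIGMA p:{p. prime p \<and> p \<le> Q}. SIGMA q:{1..Q}. {m. m dvd q}).
    (f p * of_nat p * (moebius_mu q * ghat Q g (p * q)) * (moebius_mu m * of_nat m)) * kernel_progression p m a)"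
    by (rule sum.Sigma) (auto intro!: finite_SigmaI)
  finally show ?thesis .
qed

text \<open>Only \<open>m = k * s\<close> with \<open>s dvd q div k\<close> contributes, and the sum
  of mu(s) singles out \<open>q = k\<close>.\<close>

lemma sum_moebius_mu_between:
  assumes q: "squarefree q"
  shows "(\<Sum>m | m dvd q. if k dvd m then moebius_mu m else 0) = (if q = k then moebius_mu k else 0)"
proof (cases "k dvd q")
  case True
  then obtain r where r: "q = k * r" by blast
  have q0: "q > 0" using q by (auto intro!: Nat.gr0I)
  have pos: "k > 0" "r > 0" using q0 r by auto
  have cop: "coprime k r" using q r squarefree_mult_imp_coprime by blast
  have "(\<Sum>m | m dvd q. if k dvd m then moebius_mu m else 0) = (\<Sum>m | m \<in> {m. m dvd q} \<and> k dvd m. moebius_mu m)"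
    using q0 by (intro sum.inter_filter[symmetric]) simp
  also have "\<dots> = (\<Sum>s | s dvd r. moebius_mu (k * s))"
    by (rule sum.reindex_bij_witness[of _ "\<lambda>s. k * s" "\<lambda>m. m div k"]) (use pos r in auto)
  also have "\<dots> = (\<Sum>s | s dvd r. moebius_mu k * moebius_mu s)"
    using cop by (intro sum.cong refl moebius_mu_mult_coprime) (auto intro: coprime_divisors[of k k _ r])
  also have "\<dots> = moebius_mu k * (if r = 1 then 1 else 0)"
    using pos by (simp only: sum_distrib_left[symmetric] sum_moebius_mu_divisors)
  finally show ?thesis using r pos by simp
next
  case False
  then have "(\<Sum>m | m dvd q. if k dvd m then moebius_mu m else 0) = 0"
    by (intro sum.neutral) (auto intro: dvd_trans)
  then show ?thesis using False by auto
qed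

text \<open>
  In the sum of the Wintner coefficients \<open>W\<close> of the terms, summing over \<open>m\<close> first leaves only
  \<open>q = l / gcd(l, p)\<close>.
\<close>

lemma S_IPP_partial_sums_tendsto:
  assumes sf: "\<And>n. n \<ge> 1 \<Longrightarrow> \<not> squarefree n \<Longrightarrow> ghat Q g n = 0" and l: "squarefree l"
  defines "k \<equiv> \<lambda>p. if p dvd l then l div p else l"
  shows "(\<lambda>x. \<Sum>d=1..x. wintner_term l (S_IPP f Q g N) d) \<longlonglongrightarrow>
    (\<Sum>p | prime p \<and> p \<le> Q. f p * (ghat Q g (p * k p) * (moebius_mu (k p) / of_nat (totient (k p)))))"
proof -
  let ?I = "SIGMA p:{p. prime p \<and> p \<le> Q}. SIGMA q:{1..Q}. {m. m dvd q}"
  define c where "c = (\<lambda>(p, q, m). f p * of_nat p * (moebius_mu q * ghat Q g (p * q)) * (moebius_mu m * of_nat m))"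
  define G where "G = (\<lambda>(p, q :: nat, m). kernel_progression p m)"
  define W where "W = (\<lambda>(p, q :: nat, m). if k p dvd m then moebius_mu (k p) / (of_nat p * of_nat m * of_nat (totient (k p))) else 0)"
  have l0: "l > 0" using l by (auto intro!: Nat.gr0I)
  have F: "S_IPP f Q g N a = (\<Sum>i\<in>?I. c i * G i a)" if "a > 0" for a
    unfolding S_IPP_eq_sum_kernel_progression[OF that] by (intro sum.cong) (auto simp: c_def G_def)
  \<comment> \<open>Where the coefficient is nonzero, the support of \<open>ghat\<close> makes
    \<open>p * q\<close> square-free; this yields the conditions \<open>squarefree m\<close> and
    \<open>\<not> p dvd m\<close> needed for a single progression.\<close>
  have lim: "(\<lambda>x. c i * (\<Sum>d=1..x. wintner_term l (G i) d)) \<longlonglongrightarrow> c i * W i" if i: "i \<in> ?I" for i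
  proof (cases "c i = 0")
    case False
    obtain p q m where pqm: "i = (p, q, m)" "prime p" "q > 0" "m dvd q" using i by auto
    have "ghat Q g (p * q) \<noteq> 0" using False by (auto simp: c_def pqm)
    moreover have "p * q \<ge> 1" using pqm prime_gt_0_nat by (simp add: Suc_le_eq)
    ultimately have pq: "squarefree (p * q)" using sf by blast
    then have "coprime p q" by (rule squarefree_mult_imp_coprime)
    then have "coprime p m" using pqm by (metis coprime_divisors dvd_refl)
    then have "\<not> p dvd m" using pqm(2) coprime_common_divisor[of p m p] not_prime_unit by auto
    moreover have "squarefree m" using pq pqm(4) by (metis squarefree_mono dvd_mult)
    moreover have "k p = (if p dvd l then l div p else l)" by (simp only: k_def)
    ultimately have "(\<lambda>x. \<Sum>d=1..x. wintner_term l (kernel_progression p m) d) \<longlonglongrightarrow> W i"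
      unfolding W_def pqm prod.case by (intro wintner_partial_sums_kernel_progression pqm(2) l)
    then show ?thesis by (intro tendsto_mult_left) (simp add: G_def pqm)
  qed simp
  have "(\<lambda>x. \<Sum>i\<in>?I. c i * (\<Sum>d=1..x. wintner_term l (G i) d)) \<longlonglongrightarrow> (\<Sum>i\<in>?I. c i * W i)"
    by (intro tendsto_sum lim)
  moreover have "(\<Sum>d=1..x. wintner_term l (S_IPP f Q g N) d) = (\<Sum>i\<in>?I. c i * (\<Sum>d=1..x. wintner_term l (G i) d))" for x
  proof -
    have "(\<Sum>d=1..x. wintner_term l (S_IPP f Q g N) d) = (\<Sum>d=1..x. \<Sum>i\<in>?I. c i * wintner_term l (G i) d)"
      by (intro sum.cong refl wintner_term_sum[OF F]) auto
    also have "\<dots> = (\<Sum>i\<in>?I. c i * (\<Sum>d=1..x. wintner_term l (G i) d))"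
      unfolding sum_distrib_left by (rule sum.swap)
    finally show ?thesis .
  qed
  moreover have "(\<Sum>i\<in>?I. c i * W i)
      = (\<Sum>p | prime p \<and> p \<le> Q. f p * (ghat Q g (p * k p) * (moebius_mu (k p) / of_nat (totient (k p)))))"
  proof -
    have "(\<Sum>i\<in>?I. c i * W i) = (\<Sum>p | prime p \<and> p \<le> Q. \<Sum>(q, m)\<in>(SIGMA q:{1..Q}. {m. m dvd q}). c (p, q, m) * W (p, q, m))"
      by (subst sum.Sigma) (auto intro!: finite_SigmaI sum.cong)
    also have "\<dots> = (\<Sum>p | prime p \<and> p \<le> Q. \<Sum>q=1..Q. \<Sum>m | m dvd q. c (p, q, m) * W (p, q, m))"
      by (intro sum.cong refl sum.Sigma[symmetric]) auto
    also have "\<dots> = (\<Sum>p | prime p \<and> p \<le> Q. f p * (ghat Q g (p * k p) * (moebius_mu (k p) / of_nat (totient (k p)))))"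
    proof (rule sum.cong[OF refl])
      fix p assume "p \<in> {p. prime p \<and> p \<le> Q}"
      then have p: "prime p" "p > 0" by (auto simp: prime_gt_0_nat)
      have kdvd: "k p dvd l" using l0 by (auto simp: k_def)
      then have k0: "k p > 0" and sfk: "squarefree (k p)"
        using l0 l squarefree_mono by (auto intro!: Nat.gr0I)
      define b where "b = moebius_mu (k p) / of_nat (totient (k p))"
      have "(\<Sum>m | m dvd q. c (p, q, m) * W (p, q, m))
         = (if q = k p then f p * (ghat Q g (p * k p) * b) else 0)" if q: "q \<in> {1..Q}" for q
      proof -
        have "(\<Sum>m | m dvd q. c (p, q, m) * W (p, q, m))
           = (\<Sum>m | m dvd q. (f p * ghat Q g (p * q) * moebius_mu q * b) * (if k p dvd m then moebius_mu m else 0))"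
        proof (rule sum.cong[OF refl])
          fix m assume "m \<in> {m. m dvd q}"
          then have "m > 0" using q by (auto intro!: Nat.gr0I)
          then show "c (p, q, m) * W (p, q, m) = (f p * ghat Q g (p * q) * moebius_mu q * b) * (if k p dvd m then moebius_mu m else 0)"
            using p(2) by (simp add: c_def W_def b_def field_simps)
        qed
        \<comment> \<open>For \<open>q = k p\<close>, the factor \<open>moebius_mu q\<close> and the
          value of the inner sum multiply to 1; the Moebius value in the result is the one inside
          \<open>b\<close>.\<close>
        also have "\<dots> = (f p * ghat Q g (p * q) * moebius_mu q * b) * (\<Sum>m | m dvd q. if k p dvd m then moebius_mu m else 0)"
          by (rule sum_distrib_left[symmetric])
        also have "\<dots> = (if q = k p then f p * (ghat Q g (p * k p) * b) else 0)"
        proof (cases "squarefree q")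
          case True
          then show ?thesis
            using moebius_mu_square[OF sfk] by (simp add: sum_moebius_mu_between mult_ac)
        next
          case False
          then show ?thesis using sfk by (auto simp: moebius_mu_def)
        qed
        finally show ?thesis .
      qed
      then have "(\<Sum>q=1..Q. \<Sum>m | m dvd q. c (p, q, m) * W (p, q, m))
         = (\<Sum>q=1..Q. if q = k p then f p * (ghat Q g (p * k p) * b) else 0)"
        by (intro sum.cong) auto
      also have "\<dots> = (if k p \<in> {1..Q} then f p * (ghat Q g (p * k p) * b) else 0)"
        by (rule sum.delta) simp
      \<comment> \<open>If \<open>k p > Q\<close>, it is outside the range of \<open>q\<close>, but
        then \<open>ghat Q g (p * k p) = 0\<close>.\<close>
      also have "\<dots> = f p * (ghat Q g (p * k p) * b)"
      proof (cases "k p \<le> Q")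
        case False
        have "k p \<le> p * k p" using p(2) by simp
        then have "ghat Q g (p * k p) = 0" using False by (intro ghat_eq_0) linarith
        then show ?thesis by simp
      qed (use k0 in auto)
      finally show "(\<Sum>q=1..Q. \<Sum>m | m dvd q. c (p, q, m) * W (p, q, m))
         = f p * (ghat Q g (p * k p) * (moebius_mu (k p) / of_nat (totient (k p))))"
        by (simp add: b_def)
    qed
    finally show ?thesis .
  qed
  ultimately show ?thesis by simp
qed

theorem theorem3p4:
  fixes N Q l :: nat and f g :: "nat \<Rightarrow> complex"
  assumes "1 \<le> Q" and "Q \<le> N"
    and "\<And>d. d \<ge> 1 \<Longrightarrow> d \<notin> {1..Q} \<Longrightarrow> eratosthenes g d = 0"
    and "\<And>n. n \<ge> 1 \<Longrightarrow> \<not> squarefree n \<Longrightarrow> ghat Q g n = 0"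
    and "\<And>n. n \<ge> 1 \<Longrightarrow> \<not> prime n \<Longrightarrow> f n = 0"
    and "l \<ge> 1"
  shows "wintner_converges l (\<lambda>a. S_IPP f Q g N a) \<and>
    wintner l (\<lambda>a. S_IPP f Q g N a) =
      - (moebius_mu l * ghat Q g l / of_nat (totient l))
          * (\<Sum>p\<in>prime_factors l. f p * of_nat (totient p))
      + moebius_mu l / of_nat (totient l)
          * (\<Sum>\<^sub>\<infinity>p | prime p \<and> \<not> p dvd l. f p * ghat Q g (p * l))"
    (is "_ \<and> _ = ?rhs")
proof -
  have "(\<lambda>x. \<Sum>d=1..x. wintner_term l (S_IPP f Q g N) d) \<longlonglongrightarrow> ?rhs"
  proof (cases "squarefree l")
    \<comment> \<open>Every multiple of \<open>l\<close> fails to be square-free, where the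
      transform of a function of the kernel vanishes; on the right,
      \<open>moebius_mu l = 0\<close>.\<close>
    case False
    have zero: "wintner_term l (S_IPP f Q g N) d = 0" if d: "d > 0" for d
    proof (cases "l dvd d")
      case True
      then have "\<not> squarefree d" using False squarefree_mono by blast
      moreover have "S_IPP f Q g N t = S_IPP f Q g N (sqfree_kernel t)" for t
        by (simp add: S_IPP_def sqfree_kernel_squarefree squarefree_sqfree_kernel)
      ultimately have "eratosthenes (S_IPP f Q g N) d = 0"
        using d by (intro eratosthenes_kernel_eq_0)
      then show ?thesis by (simp add: wintner_term_def)
    qed (simp add: wintner_term_def)
    have "(\<lambda>x. \<Sum>d=1..x. wintner_term l (S_IPP f Q g N) d) = (\<lambda>x. 0)"
      by (intro ext sum.neutral) (auto intro!: zero)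
    then have "(\<lambda>x. \<Sum>d=1..x. wintner_term l (S_IPP f Q g N) d) \<longlonglongrightarrow> 0" by simp
    moreover have "moebius_mu l = 0" using False by (simp add: moebius_mu_def)
    then have "?rhs = 0" by simp
    ultimately show ?thesis by (simp only:)
  next
    case True
    define k where "k = (\<lambda>p. if p dvd l then l div p else l)"
    define h where "h = (\<lambda>p. f p * (ghat Q g (p * k p) * (moebius_mu (k p) / of_nat (totient (k p)))))"
    have lim: "(\<lambda>x. \<Sum>d=1..x. wintner_term l (S_IPP f Q g N) d) \<longlonglongrightarrow> (\<Sum>p | prime p \<and> p \<le> Q. h p)"
      unfolding h_def k_def by (rule S_IPP_partial_sums_tendsto[OF assms(4) True])
    have "(\<Sum>p | prime p \<and> p \<le> Q. h p)
       = (\<Sum>p | prime p \<and> p \<le> Q \<and> p dvd l. h p) + (\<Sum>p | prime p \<and> p \<le> Q \<and> \<not> p dvd l. h p)"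
    proof -
      have "{p. prime p \<and> p \<le> Q} = {p. prime p \<and> p \<le> Q \<and> p dvd l} \<union> {p. prime p \<and> p \<le> Q \<and> \<not> p dvd l}"
        by blast
      then show ?thesis
        by (simp only:) (rule sum.union_disjoint, auto)
    qed
    \<comment> \<open>For \<open>p dvd l\<close> one has \<open>p * k p = l\<close>, mu(k p) = -
      mu(l) and \<open>totient l = totient p * totient (k p)\<close>: the origin of the minus sign
      and of the factor \<open>totient p\<close>.\<close>
    moreover have "(\<Sum>p | prime p \<and> p \<le> Q \<and> p dvd l. h p)
       = - (moebius_mu l * ghat Q g l / of_nat (totient l)) * (\<Sum>p\<in>prime_factors l. f p * of_nat (totient p))"
    proof -
      have "(\<Sum>p | prime p \<and> p \<le> Q \<and> p dvd l. h p) = (\<Sum>p\<in>prime_factors l.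
          - (moebius_mu l * ghat Q g l / of_nat (totient l)) * (f p * of_nat (totient p)))"
      proof (rule sum.mono_neutral_cong_left)
        show "{p. prime p \<and> p \<le> Q \<and> p dvd l} \<subseteq> prime_factors l"
          using assms(6) by (auto simp: prime_factors_dvd)
        show "\<forall>p\<in>prime_factors l - {p. prime p \<and> p \<le> Q \<and> p dvd l}.
           - (moebius_mu l * ghat Q g l / of_nat (totient l)) * (f p * of_nat (totient p)) = 0"
        proof
          \<comment> \<open>A prime factor of \<open>l\<close> beyond \<open>Q\<close> is missing on
            the left, but it forces \<open>l > Q\<close> and so
            \<open>ghat Q g l = 0\<close>.\<close>
          fix p assume "p \<in> prime_factors l - {p. prime p \<and> p \<le> Q \<and> p dvd l}"
          then have "p > Q" "p dvd l" by auto
          then have "Q < l" using assms(6) dvd_imp_le[of p l] by auto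
          then show "- (moebius_mu l * ghat Q g l / of_nat (totient l)) * (f p * of_nat (totient p)) = 0"
            by (simp add: ghat_eq_0)
        qed
        fix p assume p: "p \<in> {p. prime p \<and> p \<le> Q \<and> p dvd l}"
        then obtain r where r: "l = p * r" by blast
        have p0: "p > 0" "r > 0" using assms(6) r by (auto intro!: Nat.gr0I)
        have cop: "coprime p r" using True r squarefree_mult_imp_coprime by blast
        have "k p = r" using r p0 by (simp add: k_def)
        moreover have "moebius_mu l = - moebius_mu r"
          using p cop by (simp add: r moebius_mu_mult_coprime moebius_mu_prime)
        moreover have "totient l = totient p * totient r"
          using cop by (simp add: r totient_mult_coprime)
        moreover have "totient p > 0" "totient r > 0" using p0 by simp_all
        ultimately show "h p = - (moebius_mu l * ghat Q g l / of_nat (totient l)) * (f p * of_nat (totient p))"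
          by (simp add: h_def r[symmetric] field_simps)
      qed simp
      then show ?thesis by (simp only: sum_distrib_left)
    qed
    moreover have "(\<Sum>p | prime p \<and> p \<le> Q \<and> \<not> p dvd l. h p)
       = moebius_mu l / of_nat (totient l) * (\<Sum>\<^sub>\<infinity>p | prime p \<and> \<not> p dvd l. f p * ghat Q g (p * l))"
    proof -
      have "(\<Sum>\<^sub>\<infinity>p | prime p \<and> \<not> p dvd l. f p * ghat Q g (p * l)) = (\<Sum>p | prime p \<and> p \<le> Q \<and> \<not> p dvd l. f p * ghat Q g (p * l))"
      proof (rule infsumI, rule has_sum_finite_neutralI[OF _ _ _ refl])
        fix p assume "p \<in> {p. prime p \<and> \<not> p dvd l} - {p. prime p \<and> p \<le> Q \<and> \<not> p dvd l}"
        then have "Q < p * 1" by auto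
        also have "p * 1 \<le> p * l" using assms(6) by (intro mult_le_mono2)
        finally show "f p * ghat Q g (p * l) = 0" by (simp add: ghat_eq_0)
      qed auto
      moreover have "h p = moebius_mu l / of_nat (totient l) * (f p * ghat Q g (p * l))" if "\<not> p dvd l" for p
        using that by (simp add: h_def k_def)
      ultimately show ?thesis by (simp add: sum_distrib_left)
    qed
    ultimately show ?thesis using lim by simp
  qed
  moreover have "(\<Sum>d=1..x. F d) = (\<Sum>n<x. F (Suc n))" for F :: "nat \<Rightarrow> complex" and x
    by (rule sum.reindex_bij_witness[of _ Suc "\<lambda>d. d - 1"]) auto
  ultimately have "(\<lambda>n. wintner_term l (S_IPP f Q g N) (Suc n)) sums ?rhs"
    by (simp add: sums_def)
  then show ?thesis
    by (simp add: wintner_converges_def wintner_def sums_iff)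
qed

end
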